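(* Let $n\ge2$ and $p<-n$. In $\mathbb{R}^n$ with density $r^p$, hyperspheres about the origin are uniquely isoperimetric, bounding volume away from the origin: for every $V>0$, the complement of the ball about the origin whose exterior has weighted volume $V$ is the unique region of weighted volume $V$ with least weighted perimeter.
   Context: $r=|x|$. Density $r^p$ means that weighted volume is $\int r^p\,dV_0$ and weighted perimeter is $\int_{\partial} r^p\,dA_0$, with $dV_0$, $dA_0$ Euclidean volume and hypersurface area. Regions are understood to be bounded by rectifiable hypersurfaces, up to sets of measure zero. A region is isoperimetric if it has least weighted perimeter among regions with the same weighted volume. *)

theory Defs
  imports "HOL-Analysis.Analysis"
begin

section \<open>Hausdorff measure\<close>

text \<open>
  The size-\<open>\<delta>\<close> approximation, normalised by the volume of the \<open>d\<close>-dimensional unit ball.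
  Covering by exactly \<open>nat\<close> many sets is no restriction because the empty set may be used
  and costs nothing (also for \<open>d = 0\<close>, where \<open>0 ^ 0 = 1\<close> would be charged otherwise).
  Boundedness is required because \<^const>\<open>diameter\<close> is unspecified on unbounded sets.
\<close>

definition hausdorff_cost :: "nat \<Rightarrow> 'a::metric_space set \<Rightarrow> ennreal" where
  "hausdorff_cost d C =
     (if C = {} then 0 else ennreal (unit_ball_vol (real d) * (diameter C / 2) ^ d))"

definition hausdorff_covers :: "real \<Rightarrow> 'a::metric_space set \<Rightarrow> (nat \<Rightarrow> 'a set) set" where
  "hausdorff_covers \<delta> A =
     {C. A \<subseteq> (\<Union>i. C i) \<and> (\<forall>i. bounded (C i) \<and> diameter (C i) \<le> \<delta>)}"

definition hausdorff_pre :: "nat \<Rightarrow> real \<Rightarrow> 'a::metric_space set \<Rightarrow> ennreal" where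
  "hausdorff_pre d \<delta> A = (INF C \<in> hausdorff_covers \<delta> A. \<Sum>i. hausdorff_cost d (C i))"

definition hausdorff_outer :: "nat \<Rightarrow> 'a::metric_space set \<Rightarrow> ennreal" where
  "hausdorff_outer d A = (SUP \<delta>\<in>{0<..}. hausdorff_pre d \<delta> A)"

definition hausdorff_measure :: "nat \<Rightarrow> 'a::metric_space measure" where
  "hausdorff_measure d = measure_of UNIV (sets borel) (hausdorff_outer d)"

text \<open>
  \<^const>\<open>measure_of\<close> collapses to the zero measure when its argument is not countably additive.
  The following shows that this does not happen here, ending in \<open>emeasure_hausdorff_measure\<close>.
\<close>

lemma space_hausdorff_measure [simp]: "space (hausdorff_measure d) = UNIV"
  by (simp add: hausdorff_measure_def space_measure_of_conv)

lemma sets_hausdorff_measure [simp, measurable_cong]: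
  "sets (hausdorff_measure d) = sets borel"
  unfolding hausdorff_measure_def
  by (metis sets.sets_measure_of_eq space_borel)

lemma hausdorff_pre_mono: "A \<subseteq> B \<Longrightarrow> hausdorff_pre d \<delta> A \<le> hausdorff_pre d \<delta> B"
  unfolding hausdorff_pre_def by (intro INF_superset_mono) (auto simp: hausdorff_covers_def)

lemma hausdorff_pre_antimono: "\<delta> \<le> \<epsilon> \<Longrightarrow> hausdorff_pre d \<epsilon> A \<le> hausdorff_pre d \<delta> A"
  unfolding hausdorff_pre_def
  by (intro INF_superset_mono) (auto simp: hausdorff_covers_def intro: order_trans)

lemma hausdorff_outer_mono: "A \<subseteq> B \<Longrightarrow> hausdorff_outer d A \<le> hausdorff_outer d B"
  unfolding hausdorff_outer_def by (intro SUP_mono') (rule hausdorff_pre_mono)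

lemma hausdorff_pre_empty: "\<delta> > 0 \<Longrightarrow> hausdorff_pre d \<delta> {} = 0"
proof -
  assume "\<delta> > 0"
  then have "(\<lambda>_. {}) \<in> hausdorff_covers \<delta> ({} :: 'a set)"
    by (auto simp: hausdorff_covers_def)
  then have "hausdorff_pre d \<delta> ({} :: 'a set) \<le> (\<Sum>i::nat. hausdorff_cost d ({} :: 'a set))"
    unfolding hausdorff_pre_def by (rule INF_lower)
  then show ?thesis by (simp add: hausdorff_cost_def)
qed

lemma hausdorff_outer_empty [simp]: "hausdorff_outer d {} = 0"
  unfolding hausdorff_outer_def by (simp add: hausdorff_pre_empty)

lemma ennreal_suminf_tail:
  fixes f :: "nat \<Rightarrow> ennreal"
  assumes fin: "(\<Sum>i. f i) < top" and e: "0 < e"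
  shows "\<exists>N. \<forall>n\<ge>N. (\<Sum>k. f (k + n)) \<le> ennreal e"
proof -
  define g where "g i = enn2real (f i)" for i
  have f: "f i = ennreal (g i)" for i
    using ennreal_suminf_lessD[OF fin] by (simp add: g_def)
  have g: "0 \<le> g i" for i by (simp add: g_def)
  have "summable g"
    using fin g by (intro summable_suminf_not_top) (auto simp: f)
  then obtain N where N: "\<And>n. n \<ge> N \<Longrightarrow> norm (\<Sum>k. g (k + n)) < e"
    using suminf_exist_split[OF e] by blast
  have "(\<Sum>k. f (k + n)) = ennreal (\<Sum>k. g (k + n))" for n
    using \<open>summable g\<close> g by (simp add: f suminf_ennreal2 summable_ignore_initial_segment)
  then show ?thesis using N by (auto intro!: exI[of _ N] ennreal_leI simp: abs_less_iff less_imp_le)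
qed

lemma hausdorff_pre_subadditive:
  fixes A :: "nat \<Rightarrow> 'a::metric_space set"
  shows "hausdorff_pre d \<delta> (\<Union>i. A i) \<le> (\<Sum>i. hausdorff_pre d \<delta> (A i))"
proof (rule ennreal_le_epsilon)
  fix e :: real
  assume fin: "(\<Sum>i. hausdorff_pre d \<delta> (A i)) < top" and e: "0 < e"
  have "\<exists>C. C \<in> hausdorff_covers \<delta> (A j) \<and>
          (\<Sum>i. hausdorff_cost d (C i)) \<le> hausdorff_pre d \<delta> (A j) + ennreal (e * (1/2) ^ Suc j)" for j
  proof -
    have "hausdorff_pre d \<delta> (A j) \<noteq> top"
      using ennreal_suminf_lessD[OF fin, of j] by simp
    then have "hausdorff_pre d \<delta> (A j) <
               hausdorff_pre d \<delta> (A j) + ennreal (e * (1/2) ^ Suc j)"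
      using e by (cases "hausdorff_pre d \<delta> (A j)") (auto simp flip: ennreal_plus simp: ennreal_less_iff)
    then obtain C where "C \<in> hausdorff_covers \<delta> (A j)"
      "(\<Sum>i. hausdorff_cost d (C i)) < hausdorff_pre d \<delta> (A j) + ennreal (e * (1/2) ^ Suc j)"
      by (subst (asm) hausdorff_pre_def) (auto simp: INF_less_iff)
    then show ?thesis by (auto intro: less_imp_le)
  qed
  then obtain C where C: "\<And>j. C j \<in> hausdorff_covers \<delta> (A j)"
    "\<And>j. (\<Sum>i. hausdorff_cost d (C j i)) \<le> hausdorff_pre d \<delta> (A j) + ennreal (e * (1/2) ^ Suc j)"
    by metis
  define D where "D = (\<lambda>k. case prod_decode k of (j, i) \<Rightarrow> C j i)"
  have "D \<in> hausdorff_covers \<delta> (\<Union>i. A i)"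
  proof -
    have "\<exists>k. x \<in> D k" if xj: "x \<in> A j" for x j
    proof -
      obtain i where "x \<in> C j i" using C(1)[of j] xj unfolding hausdorff_covers_def by blast
      then have "x \<in> D (prod_encode (j, i))" by (simp add: D_def)
      then show ?thesis ..
    qed
    moreover have "bounded (D k) \<and> diameter (D k) \<le> \<delta>" for k
      using C(1) by (auto simp: D_def hausdorff_covers_def split: prod.split)
    ultimately show ?thesis by (auto simp: hausdorff_covers_def)
  qed
  then have "hausdorff_pre d \<delta> (\<Union>i. A i) \<le> (\<Sum>k. hausdorff_cost d (D k))"
    unfolding hausdorff_pre_def by (rule INF_lower)
  also have "(\<Sum>k. hausdorff_cost d (D k)) = (\<Sum>j. \<Sum>i. hausdorff_cost d (C j i))"
    using suminf_ennreal_2dimen[of "\<lambda>j. \<Sum>i. hausdorff_cost d (C j i)"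
        "\<lambda>(j, i). hausdorff_cost d (C j i)"]
    by (simp add: D_def comp_def case_prod_unfold)
  also have "\<dots> \<le> (\<Sum>j. hausdorff_pre d \<delta> (A j) + ennreal (e * (1/2) ^ Suc j))"
    by (intro suminf_le C(2) summableI)
  also have "\<dots> = (\<Sum>j. hausdorff_pre d \<delta> (A j)) + (\<Sum>j. ennreal (e * (1/2) ^ Suc j))"
    by (intro suminf_add[symmetric] summableI)
  also have "(\<Sum>j. ennreal (e * (1/2) ^ Suc j)) = ennreal e"
  proof (rule suminf_ennreal_eq)
    show "(\<lambda>j. e * (1/2) ^ Suc j) sums e"
      using sums_mult[OF power_half_series, of e] by simp
  qed (use e in auto)
  finally show "hausdorff_pre d \<delta> (\<Union>i. A i) \<le> (\<Sum>i. hausdorff_pre d \<delta> (A i)) + ennreal e" .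
qed

lemma outer_measure_space_hausdorff: "outer_measure_space UNIV (hausdorff_outer d)"
  unfolding outer_measure_space_def
proof (intro conjI)
  show "positive UNIV (hausdorff_outer d)" by (simp add: positive_def)
  show "increasing UNIV (hausdorff_outer d)" by (simp add: increasing_def hausdorff_outer_mono)
  show "countably_subadditive UNIV (hausdorff_outer d :: 'a set \<Rightarrow> ennreal)"
    unfolding countably_subadditive_def
  proof (intro allI impI)
    fix A :: "nat \<Rightarrow> 'a set"
    have "hausdorff_pre d \<delta> (\<Union>i. A i) \<le> (\<Sum>i. hausdorff_outer d (A i))" if "\<delta> > 0" for \<delta>
    proof -
      have "hausdorff_pre d \<delta> (\<Union>i. A i) \<le> (\<Sum>i. hausdorff_pre d \<delta> (A i))"
        by (rule hausdorff_pre_subadditive)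
      also have "\<dots> \<le> (\<Sum>i. hausdorff_outer d (A i))"
        unfolding hausdorff_outer_def using that by (intro suminf_le SUP_upper summableI) auto
      finally show ?thesis .
    qed
    then show "hausdorff_outer d (\<Union>i. A i) \<le> (\<Sum>i. hausdorff_outer d (A i))"
      by (subst hausdorff_outer_def) (auto intro: SUP_least)
  qed
qed

lemma hausdorff_outer_UN: "hausdorff_outer d (\<Union>i::nat. A i) \<le> (\<Sum>i. hausdorff_outer d (A i))"
proof -
  have "hausdorff_outer d (\<Union>i. disjointed A i) \<le> (\<Sum>i. hausdorff_outer d (disjointed A i))"
    using outer_measure_space_hausdorff[of d] disjoint_family_disjointed[of A]
    unfolding outer_measure_space_def countably_subadditive_def by blast
  also have "\<dots> \<le> (\<Sum>i. hausdorff_outer d (A i))"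
    by (intro suminf_le hausdorff_outer_mono disjointed_subset summableI)
  finally show ?thesis by (simp add: UN_disjointed_eq)
qed

lemma hausdorff_outer_Un: "hausdorff_outer d (A \<union> B) \<le> hausdorff_outer d A + hausdorff_outer d B"
  using hausdorff_outer_UN[of d "binaryset A B"]
    suminf_binaryset_eq[of "hausdorff_outer d" A B]
  by (simp add: UN_binaryset_eq)

lemma hausdorff_pre_separated:
  assumes "\<delta> < e" and sep: "\<And>x y. x \<in> A \<Longrightarrow> y \<in> B \<Longrightarrow> e \<le> dist x y" and "0 < \<delta>"
  shows "hausdorff_pre d \<delta> A + hausdorff_pre d \<delta> B \<le> hausdorff_pre d \<delta> (A \<union> B)"
  unfolding hausdorff_pre_def[of _ _ "A \<union> B"]
proof (rule INF_greatest)
  fix C assume C: "C \<in> hausdorff_covers \<delta> (A \<union> B)"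
  define P where "P S = (\<lambda>i. if C i \<inter> S = {} then {} else C i)" for S
  have "P S \<in> hausdorff_covers \<delta> S" if "S \<subseteq> A \<union> B" for S
    using C that \<open>0 < \<delta>\<close> by (fastforce simp: hausdorff_covers_def P_def)
  then have *: "hausdorff_pre d \<delta> S \<le> (\<Sum>i. hausdorff_cost d (P S i))" if "S \<subseteq> A \<union> B" for S
    unfolding hausdorff_pre_def using that by (intro INF_lower) auto
  have "hausdorff_pre d \<delta> A + hausdorff_pre d \<delta> B
      \<le> (\<Sum>i. hausdorff_cost d (P A i)) + (\<Sum>i. hausdorff_cost d (P B i))"
    by (intro add_mono *) auto
  also have "\<dots> = (\<Sum>i. hausdorff_cost d (P A i) + hausdorff_cost d (P B i))"
    by (intro suminf_add summableI)
  also have "\<dots> \<le> (\<Sum>i. hausdorff_cost d (C i))"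
  proof (intro suminf_le summableI)
    fix i
    have "C i \<inter> A = {} \<or> C i \<inter> B = {}"
    proof (rule ccontr)
      assume "\<not> ?thesis"
      then obtain x y where xy: "x \<in> C i" "x \<in> A" "y \<in> C i" "y \<in> B" by auto
      have "dist x y \<le> diameter (C i)"
        using C xy by (intro diameter_bounded_bound) (auto simp: hausdorff_covers_def)
      also have "\<dots> \<le> \<delta>" using C by (auto simp: hausdorff_covers_def)
      finally show False using sep[of x y] xy \<open>\<delta> < e\<close> by simp
    qed
    then show "hausdorff_cost d (P A i) + hausdorff_cost d (P B i) \<le> hausdorff_cost d (C i)"
      by (auto simp: P_def hausdorff_cost_def)
  qed
  finally show "hausdorff_pre d \<delta> A + hausdorff_pre d \<delta> B \<le> (\<Sum>i. hausdorff_cost d (C i))" .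
qed

lemma hausdorff_outer_separated:
  assumes "0 < e" and sep: "\<And>x y. x \<in> A \<Longrightarrow> y \<in> B \<Longrightarrow> e \<le> dist x y"
  shows "hausdorff_outer d A + hausdorff_outer d B \<le> hausdorff_outer d (A \<union> B)"
proof -
  have *: "hausdorff_pre d \<delta> A + hausdorff_pre d \<epsilon> B \<le> hausdorff_outer d (A \<union> B)"
    if "\<delta> > 0" "\<epsilon> > 0" for \<delta> \<epsilon>
  proof -
    define m where "m = min (min \<delta> \<epsilon>) (e / 2)"
    have m: "m > 0" "m < e" "m \<le> \<delta>" "m \<le> \<epsilon>" using that \<open>0 < e\<close> by (auto simp: m_def)
    have "hausdorff_pre d \<delta> A + hausdorff_pre d \<epsilon> B \<le> hausdorff_pre d m A + hausdorff_pre d m B"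
      by (intro add_mono hausdorff_pre_antimono m)
    also have "\<dots> \<le> hausdorff_pre d m (A \<union> B)"
      by (rule hausdorff_pre_separated[OF m(2) sep m(1)])
    also have "\<dots> \<le> hausdorff_outer d (A \<union> B)"
      unfolding hausdorff_outer_def using m by (intro SUP_upper) auto
    finally show ?thesis .
  qed
  have ne: "{0<..} \<noteq> ({} :: real set)" by simp
  have "hausdorff_outer d A + hausdorff_pre d \<epsilon> B \<le> hausdorff_outer d (A \<union> B)" if "\<epsilon> > 0" for \<epsilon>
    unfolding hausdorff_outer_def[of d A] ennreal_SUP_add_left[OF ne, symmetric]
    using * that by (auto intro: SUP_least)
  then have "(SUP \<epsilon>\<in>{0<..}. hausdorff_outer d A + hausdorff_pre d \<epsilon> B) \<le> hausdorff_outer d (A \<union> B)"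
    by (auto intro: SUP_least)
  then show ?thesis
    unfolding hausdorff_outer_def[of d B] by (simp add: ennreal_SUP_add_right[OF ne])
qed

lemma hausdorff_outer_closed:
  fixes F :: "'a::metric_space set"
  assumes F: "closed F"
  shows "hausdorff_outer d (A \<inter> F) + hausdorff_outer d (A - F) \<le> hausdorff_outer d A"
proof (cases "F = {} \<or> hausdorff_outer d A = top")
  case True
  then show ?thesis by auto
next
  case False
  then have ne: "F \<noteq> {}" and fin: "hausdorff_outer d A < top" by (auto simp: top.not_eq_extremum)
  define G where "G n = {x \<in> A. infdist x F \<ge> 1 / Suc n}" for n
  define R where "R n = G (Suc n) - G n" for n
  have frac: "1 / real (Suc n) < 1 / real (Suc m)" if "m < n" for m n
    using that by (simp add: frac_less2)
  have Gmono: "G m \<subseteq> G n" if "m \<le> n" for m n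
    using that frac[of m n] by (cases "m = n") (auto simp: G_def)
  have sep: "1 / Suc n - 1 / Suc m \<le> dist x y" if "x \<in> G n" "infdist y F \<le> 1 / Suc m" for x y m n
    using that infdist_triangle[of x F y] by (auto simp: G_def)
  have G_sep: "hausdorff_outer d (A \<inter> F) + hausdorff_outer d (G n) \<le> hausdorff_outer d A" for n
  proof -
    have "hausdorff_outer d (G n) + hausdorff_outer d (A \<inter> F)
        \<le> hausdorff_outer d (G n \<union> A \<inter> F)"
    proof (rule hausdorff_outer_separated)
      show "0 < 1 / real (Suc n)" by simp
      fix x y assume "x \<in> G n" "y \<in> A \<inter> F"
      then show "1 / real (Suc n) \<le> dist x y"
        using infdist_le[of y F x] by (auto simp: G_def)
    qed
    also have "\<dots> \<le> hausdorff_outer d A" by (intro hausdorff_outer_mono) (auto simp: G_def)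
    finally show ?thesis by (simp add: add.commute)
  qed
  have R_sep: "hausdorff_outer d (G n) + hausdorff_outer d (R (Suc n)) \<le> hausdorff_outer d (G n \<union> R (Suc n))" for n
  proof (rule hausdorff_outer_separated)
    show "0 < 1 / real (Suc n) - 1 / real (Suc (Suc n))" using frac[of n "Suc n"] by simp
    fix x y assume "x \<in> G n" "y \<in> R (Suc n)"
    then show "1 / real (Suc n) - 1 / real (Suc (Suc n)) \<le> dist x y"
      by (intro sep) (auto simp: R_def G_def)
  qed
  have step: "(\<Sum>k<n. hausdorff_outer d (R (2 * k + c + 1))) \<le> hausdorff_outer d (G (2 * n + c))"
    for n c
  proof (induction n)
    case (Suc n)
    have "(\<Sum>k<Suc n. hausdorff_outer d (R (2 * k + c + 1)))
        \<le> hausdorff_outer d (G (2 * n + c)) + hausdorff_outer d (R (Suc (2 * n + c)))"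
      using Suc by (simp add: add_mono)
    also have "\<dots> \<le> hausdorff_outer d (G (2 * n + c) \<union> R (Suc (2 * n + c)))" by (rule R_sep)
    also have "\<dots> \<le> hausdorff_outer d (G (2 * Suc n + c))"
      using Gmono[of "2 * n + c" "2 * Suc n + c"]
      by (intro hausdorff_outer_mono) (auto simp: R_def)
    finally show ?case .
  qed simp
  have tails: "\<exists>N. \<forall>n\<ge>N. (\<Sum>k. hausdorff_outer d (R (2 * (k + n) + c + 1))) \<le> ennreal e"
    if "e > 0" for e c
  proof (rule ennreal_suminf_tail[OF _ that])
    have "(\<Sum>k. hausdorff_outer d (R (2 * k + c + 1))) \<le> hausdorff_outer d A"
      by (rule suminf_le_const[OF summableI], rule order_trans[OF step], rule hausdorff_outer_mono)
         (auto simp: G_def)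
    then show "(\<Sum>k. hausdorff_outer d (R (2 * k + c + 1))) < top" using fin by simp
  qed
  show ?thesis
  proof (rule ennreal_le_epsilon)
    fix e :: real assume "e > 0"
    obtain N0 where N0: "\<And>n. n \<ge> N0 \<Longrightarrow>
        (\<Sum>k. hausdorff_outer d (R (2 * (k + n) + 0 + 1))) \<le> ennreal (e / 2)"
      using tails[of "e / 2" 0] \<open>e > 0\<close> by auto
    obtain N1 where N1: "\<And>n. n \<ge> N1 \<Longrightarrow>
        (\<Sum>k. hausdorff_outer d (R (2 * (k + n) + 1 + 1))) \<le> ennreal (e / 2)"
      using tails[of "e / 2" 1] \<open>e > 0\<close> by auto
    define N where "N = max N0 N1"
    let ?S = "\<lambda>c. \<Union>k. R (2 * (k + N) + c + 1)"
    have "A - F \<subseteq> G (2 * N + 1) \<union> (?S 0 \<union> ?S 1)"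
    proof
      fix x assume x: "x \<in> A - F"
      then have "infdist x F > 0"
        using F ne by (simp add: infdist_pos_not_in_closed)
      then obtain m where m: "1 / real (Suc m) < infdist x F"
        using nat_approx_posE by blast
      define l where "l = (LEAST m. x \<in> G m)"
      have "x \<in> G m" using m x by (simp add: G_def)
      then have l: "x \<in> G l" "\<And>k. k < l \<Longrightarrow> x \<notin> G k"
        unfolding l_def by (auto intro: LeastI dest: not_less_Least)
      show "x \<in> G (2 * N + 1) \<union> (?S 0 \<union> ?S 1)"
      proof (cases "l \<le> 2 * N + 1")
        case True
        then show ?thesis using l Gmono by blast
      next
        case False
        then obtain j where j: "l = Suc (2 * N + 1 + j)"
          by (metis add_Suc_right less_imp_Suc_add not_le)
        then have xR: "x \<in> R (2 * N + 1 + j)" using l by (simp add: R_def)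
        show ?thesis
        proof (cases "even j")
          case True
          then obtain k where "j = 2 * k" by blast
          then have "x \<in> R (2 * (k + N) + 0 + 1)" using xR by (simp add: algebra_simps)
          then show ?thesis by blast
        next
          case False
          then obtain k where "j = 2 * k + 1" using oddE by blast
          then have "x \<in> R (2 * (k + N) + 1 + 1)" using xR by (simp add: algebra_simps)
          then show ?thesis by blast
        qed
      qed
    qed
    then have "hausdorff_outer d (A - F)
        \<le> hausdorff_outer d (G (2 * N + 1) \<union> (?S 0 \<union> ?S 1))"
      by (rule hausdorff_outer_mono)
    also have "\<dots> \<le> hausdorff_outer d (G (2 * N + 1)) +
        (hausdorff_outer d (?S 0) + hausdorff_outer d (?S 1))"
      by (rule order_trans[OF hausdorff_outer_Un add_left_mono[OF hausdorff_outer_Un]])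
    also have "hausdorff_outer d (?S 0) + hausdorff_outer d (?S 1) \<le> ennreal (e / 2) + ennreal (e / 2)"
      by (intro add_mono order_trans[OF hausdorff_outer_UN] N0 N1) (auto simp: N_def)
    also have "\<dots> = ennreal e" using \<open>e > 0\<close> by (simp flip: ennreal_plus)
    finally have "hausdorff_outer d (A \<inter> F) + hausdorff_outer d (A - F)
        \<le> hausdorff_outer d (A \<inter> F) + (hausdorff_outer d (G (2 * N + 1)) + ennreal e)"
      by (auto intro: add_left_mono)
    also have "\<dots> \<le> hausdorff_outer d A + ennreal e"
      using G_sep[of "2 * N + 1"] by (simp add: add.assoc[symmetric] add_right_mono)
    finally show "hausdorff_outer d (A \<inter> F) + hausdorff_outer d (A - F)
        \<le> hausdorff_outer d A + ennreal e" .
  qed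
qed

lemma measure_space_hausdorff:
  "measure_space UNIV (sets borel) (hausdorff_outer d :: 'a::metric_space set \<Rightarrow> ennreal)"
proof -
  interpret P: sigma_algebra UNIV "UNIV :: 'a set set"
    using sigma_algebra_Pow[of "UNIV :: 'a set"] by simp
  let ?L = "lambda_system UNIV UNIV (hausdorff_outer d) :: 'a set set"
  have L: "measure_space UNIV ?L (hausdorff_outer d)"
    using P.caratheodory_lemma[OF outer_measure_space_hausdorff] .
  then have sa: "sigma_algebra UNIV ?L" by (simp add: measure_space_def)
  have "Collect closed \<subseteq> ?L"
  proof
    fix F :: "'a set" assume "F \<in> Collect closed"
    then have "hausdorff_outer d (A \<inter> F) + hausdorff_outer d (A - F) = hausdorff_outer d A" for A
      using hausdorff_outer_closed[of F d A] hausdorff_outer_Un[of d "A \<inter> F" "A - F"]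
      by (simp add: Int_Diff_Un order_antisym)
    then show "F \<in> ?L" by (simp add: P.lambda_system_eq)
  qed
  then have sub: "sets borel \<subseteq> ?L"
    using sigma_algebra.sigma_sets_subset[OF sa] by (simp add: borel_eq_closed)
  have "sigma_algebra UNIV (sets (borel :: 'a measure))"
    using sets.sigma_algebra_axioms[of "borel :: 'a measure"] by simp
  with L sub show ?thesis
    unfolding measure_space_def positive_def countably_additive_def by blast
qed

lemma emeasure_hausdorff_measure:
  "A \<in> sets borel \<Longrightarrow> emeasure (hausdorff_measure d) A = hausdorff_outer d A"
  using measure_space_hausdorff[of d] sets_hausdorff_measure[of d]
  unfolding measure_space_def
  by (intro emeasure_measure_of[OF hausdorff_measure_def]) auto


section \<open>Regions with a power density\<close>

definition has_lebesgue_density_at :: "'a::euclidean_space set \<Rightarrow> real \<Rightarrow> 'a \<Rightarrow> bool" where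
  "has_lebesgue_density_at E t x \<longleftrightarrow>
     ((\<lambda>r. measure lebesgue (E \<inter> ball x r) / measure lebesgue (ball x r)) \<longlongrightarrow> t) (at_right 0)"

text \<open>
  Regions only matter up to Lebesgue null sets, so the bounding hypersurface \<open>\<partial>E\<close> is the
  measure-theoretic boundary, which a null set does not change; the topological boundary would
  depend on the representative. By Federer's theorem the two usual candidates, this one and De
  Giorgi's reduced boundary, differ by an \<open>(n-1)\<close>-dimensional Hausdorff null set as soon as \<open>E\<close>
  has locally finite perimeter.
\<close>

definition essential_boundary :: "'a::euclidean_space set \<Rightarrow> 'a set" where
  "essential_boundary E =
     {x. \<not> has_lebesgue_density_at E 0 x \<and> \<not> has_lebesgue_density_at E 1 x}"

text \<open>
  Rectifiability in dimension \<open>n - 1\<close>: almost all of \<open>M\<close> is covered by countably many Lipschitz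
  images of \<open>\<real>\<^sup>n\<^sup>-\<^sup>1\<close>, the latter being realised as a coordinate hyperplane of the ambient space.
  The outer measure is used because \<open>M\<close> is not assumed to be Borel.
\<close>

definition rectifiable_hypersurface :: "'a::euclidean_space set \<Rightarrow> bool" where
  "rectifiable_hypersurface M \<longleftrightarrow>
     (\<exists>b\<in>Basis. \<exists>(f :: nat \<Rightarrow> 'a \<Rightarrow> 'a) L.
        (\<forall>i. (L i)-lipschitz_on {x. x \<bullet> b = 0} (f i)) \<and>
        hausdorff_outer (DIM('a) - 1) (M - (\<Union>i. f i ` {x. x \<bullet> b = 0})) = 0)"

definition region :: "'a::euclidean_space set \<Rightarrow> bool" where
  "region E \<longleftrightarrow> E \<in> sets lebesgue \<and> rectifiable_hypersurface (essential_boundary E)"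

text \<open>
  At the origin \<open>0 powr p = 0\<close>; this is immaterial, since for \<open>n \<ge> 2\<close> a point is null for both
  measures below.
\<close>

definition weighted_volume :: "real \<Rightarrow> 'a::euclidean_space set \<Rightarrow> ennreal" where
  "weighted_volume p E = (\<integral>\<^sup>+x\<in>E. ennreal (norm x powr p) \<partial>lebesgue)"

definition weighted_perimeter :: "real \<Rightarrow> 'a::euclidean_space set \<Rightarrow> ennreal" where
  "weighted_perimeter p E =
     (\<integral>\<^sup>+x\<in>essential_boundary E. ennreal (norm x powr p) \<partial>hausdorff_measure (DIM('a) - 1))"

definition isoperimetric :: "real \<Rightarrow> 'a::euclidean_space set \<Rightarrow> bool" where
  "isoperimetric p E \<longleftrightarrow>
     region E \<and>
     (\<forall>F :: 'a set. region F \<and> weighted_volume p F = weighted_volume p E \<longrightarrow>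
          weighted_perimeter p E \<le> weighted_perimeter p F)"

end

theory Submission
  imports Defs
begin

text \<open>
  Write \<open>n\<close> for the dimension, \<open>H\<close> for the Hausdorff measure of dimension \<open>n - 1\<close>, and \<open>M\<close> for the
  essential boundary of a region \<open>E\<close> of finite weighted volume. The vector field \<open>- r\<^sup>p x / r\<close> has
  length \<open>r\<^sup>p\<close> and divergence \<open>- (p + n - 1) r\<^sup>p\<^sup>-\<^sup>1\<close>, so the divergence theorem suggests

    weighted perimeter of \<open>E\<close>  \<open>\<ge>\<close>  \<open>c\<close> times the integral of \<open>r\<^sup>p\<^sup>-\<^sup>1\<close> over \<open>E\<close>,

  with equality for the exterior of a ball. Since \<open>r\<^sup>p\<^sup>-\<^sup>1 = r\<^sup>p / r\<close>, among the sets of prescribed weighted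
  volume the right-hand side is least exactly when the mass lies as far out as possible, that is,
  for the exterior of a ball, and for no other set up to null sets (\<open>bathtub_exterior\<close>). Together
  these give minimality and uniqueness.

  The perimeter here is the \<open>H\<close> measure of the essential boundary, and the inequality is proved for this
  measure directly. Only the first hit of each ray matters: if almost every point \<open>x\<close> of
  \<open>E\<close> has a boundary point \<open>t x\<close> with \<open>0 < t \<le> 1\<close>, then \<open>E\<close> is contained, up to a null set, in the
  union over thin spherical shells \<open>a \<le> r < a q\<close> of the truncated cones \<open>r \<ge> a\<close> over the radial projection
  of the part of \<open>M\<close> in the shell. Projecting that part to the unit sphere contracts by
  \<open>1 / a\<close>, and the integral of \<open>r\<^sup>p\<^sup>-\<^sup>1\<close> over a truncated cone is proportional to the \<open>H\<close> measure of its
  trace on the sphere (\<open>sphere_measure_proportional\<close>). Summing over the shells and letting \<open>q\<close> tend to \<open>1\<close> gives the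
  inequality (\<open>weighted_perimeter_ge\<close>).

  Two points carry this argument.

  First, almost every ray segment from the origin to a point of \<open>E\<close> meets \<open>M\<close>
  (\<open>negligible_rays_missing_boundary\<close>). A segment that avoids \<open>M\<close> consists of points of density \<open>0\<close> and
  points of density \<open>1\<close>. If both kinds occur, Baire's theorem yields a point of one kind with an adjacent
  interval of the other kind (\<open>exists_one_sided_contact\<close>), and the rays through such points form a
  null set (\<open>negligible_cone_contact\<close>); this is the argument in Federer's criterion for finite perimeter,
  with rays from the origin in place of parallel lines. If only density \<open>1\<close> occurs, the
  points in question form a set that is invariant under shrinking, and a set of that kind with positive
  measure has infinite weighted volume because \<open>p < - n\<close>.

  Second, the constant \<open>c\<close> exists because of symmetry. Both \<open>H\<close> on the unit sphere and the integral of
  \<open>r\<^sup>p\<^sup>-\<^sup>1\<close> over truncated cones are finite rotation-invariant measures, and two measures that give equal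
  mass to all balls of equal radius are proportional (\<open>uniformly_distributed_proportional\<close>). For \<open>c\<close> to be
  positive and finite, the sphere must have positive finite \<open>H\<close> measure; this follows from packing and
  covering estimates.
\<close>


section \<open>Porous sets and Lebesgue density\<close>

text \<open>
  Suppose a bounded part \<open>B\<close> of \<open>A\<close> had outer measure \<open>m > 0\<close>. Inside an open set of measure close to
  \<open>m\<close>, Vitali's theorem selects disjoint balls that cover almost all of \<open>B\<close>. The hole in each ball misses
  \<open>A\<close>, so \<open>B\<close> is covered by a set of measure about \<open>(1 - k) m\<close>, which is less than \<open>m\<close>. The set \<open>A\<close> is
  arbitrary because it will later be a cone over a Borel set, and such a cone need not be Borel.
\<close>
lemma negligible_if_porous:
  fixes A :: "'a::euclidean_space set"
  assumes k: "0 < k" "k \<le> 1"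
    and por: "\<And>x e. x \<in> A \<Longrightarrow> 0 < e \<Longrightarrow> \<exists>r Z. 0 < r \<and> r < e \<and> Z \<in> sets lebesgue \<and> Z \<subseteq> ball x r \<and> Z \<inter> A = {} \<and>
            k * measure lebesgue (ball x r) \<le> measure lebesgue Z"
  shows "negligible A"
proof -
  have main: "negligible B" if BA: "B \<subseteq> A" and bB: "bounded B" for B
  proof -
    define M where "M = measure lebesgue ` {U. U \<in> lmeasurable \<and> B \<subseteq> U}"
    define m where "m = Inf M"
    have bdd: "bdd_below M" unfolding M_def by (auto intro!: bdd_belowI[of _ 0])
    obtain R where "B \<subseteq> ball 0 R" using bB bounded_subset_ballD by blast
    then have ne: "M \<noteq> {}" unfolding M_def by (auto intro!: exI[of _ "ball 0 R"])
    have mle: "m \<le> measure lebesgue U" if "U \<in> lmeasurable" "B \<subseteq> U" for U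
      unfolding m_def using that by (intro cInf_lower[OF _ bdd]) (auto simp: M_def)
    have m0: "0 \<le> m" unfolding m_def using ne by (intro cInf_greatest) (auto simp: M_def)
    have step: "m \<le> (1 - k) * measure lebesgue U" if U: "open U" "U \<in> lmeasurable" "B \<subseteq> U" for U
    proof -
      define K where "K = {i. fst i \<in> B \<and> 0 < fst (snd i) \<and> ball (fst i) (fst (snd i)) \<subseteq> U \<and> snd (snd i) \<in> sets lebesgue \<and>
            snd (snd i) \<subseteq> ball (fst i) (fst (snd i)) \<and> snd (snd i) \<inter> A = {} \<and>
            k * measure lebesgue (ball (fst i) (fst (snd i))) \<le> measure lebesgue (snd (snd i))}"
      obtain C where C: "countable C" "C \<subseteq> K"
        and pw: "pairwise (\<lambda>i j. disjnt (ball (fst i) (fst (snd i))) (ball (fst j) (fst (snd j)))) C"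
        and neg: "negligible (B - (\<Union>i\<in>C. ball (fst i) (fst (snd i))))"
      proof (rule Vitali_covering_theorem_balls[of B K fst "\<lambda>i. fst (snd i)"])
        fix x and d :: real assume x: "x \<in> B" and "0 < d"
        obtain e where e: "0 < e" "ball x e \<subseteq> U" using U x by (meson openE subsetD)
        obtain r Z where *: "0 < r" "r < min d e" "Z \<in> sets lebesgue" "Z \<subseteq> ball x r" "Z \<inter> A = {}"
            "k * measure lebesgue (ball x r) \<le> measure lebesgue Z"
          using por[of x "min d e"] x BA e(1) \<open>0 < d\<close> by auto
        have "ball x r \<subseteq> U" using * e subset_ball[of r e x] by auto
        then show "\<exists>i. i \<in> K \<and> x \<in> ball (fst i) (fst (snd i)) \<and> fst (snd i) < d"
          using * x by (intro exI[of _ "(x, r, Z)"]) (auto simp: K_def)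
      qed
      define b where "b i = ball (fst i) (fst (snd i))" for i :: "'a \<times> real \<times> 'a set"
      \<comment> \<open>What remains of each Vitali ball once its hole is removed.\<close>
      define W where "W i = b i - snd (snd i)" for i :: "'a \<times> real \<times> 'a set"
      have CK: "b i \<subseteq> U" "snd (snd i) \<in> sets lebesgue" "snd (snd i) \<subseteq> b i" "snd (snd i) \<inter> A = {}"
            "k * measure lebesgue (b i) \<le> measure lebesgue (snd (snd i))" if "i \<in> C" for i
        using subsetD[OF C(2) that] unfolding K_def b_def by blast+
      have Wi: "emeasure lebesgue (W i) \<le> ennreal (1 - k) * emeasure lebesgue (b i)" if i: "i \<in> C" for i
      proof -
        have "measure lebesgue (W i) = measure lebesgue (b i) - measure lebesgue (snd (snd i))"
          unfolding W_def using CK[OF i]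
          by (intro measurable_measure_Diff) (auto simp: b_def)
        also have "\<dots> \<le> (1 - k) * measure lebesgue (b i)" using CK(5)[OF i] by (simp add: algebra_simps)
        finally have *: "measure lebesgue (W i) \<le> (1 - k) * measure lebesgue (b i)" .
        have "W i \<in> lmeasurable" unfolding W_def b_def using CK(2)[OF i]
          by (intro fmeasurable_Diff) auto
        moreover have "b i \<in> lmeasurable" by (simp add: b_def)
        moreover have "0 \<le> measure lebesgue (W i)" by simp
        ultimately show ?thesis using *
          by (simp add: emeasure_eq_measure2 ennreal_mult''[symmetric] ennreal_leI)
      qed
      have dis: "disjoint_family_on b C" "disjoint_family_on W C"
        using pw unfolding disjoint_family_on_def pairwise_def disjnt_def b_def W_def by blast+
      let ?T = "(B - (\<Union>i\<in>C. b i)) \<union> (\<Union>i\<in>C. W i)"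
      have ms: "W i \<in> sets lebesgue" "b i \<in> sets lebesgue" if "i \<in> C" for i
        unfolding W_def using CK(2)[OF that] by (auto simp: b_def)
      have "emeasure lebesgue (\<Union>i\<in>C. W i) = (\<integral>\<^sup>+i. emeasure lebesgue (W i) \<partial>count_space C)"
        by (intro emeasure_UN_countable ms C dis) 
      also have "\<dots> \<le> (\<integral>\<^sup>+i. ennreal (1 - k) * emeasure lebesgue (b i) \<partial>count_space C)"
        by (intro nn_integral_mono) (auto intro: Wi)
      also have "\<dots> = ennreal (1 - k) * (\<integral>\<^sup>+i. emeasure lebesgue (b i) \<partial>count_space C)"
        by (intro nn_integral_cmult) auto
      also have "(\<integral>\<^sup>+i. emeasure lebesgue (b i) \<partial>count_space C) = emeasure lebesgue (\<Union>i\<in>C. b i)"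
        by (intro emeasure_UN_countable[symmetric] ms C dis) 
      also have "\<dots> \<le> emeasure lebesgue U"
        using CK(1) U by (intro emeasure_mono) auto
      finally have le: "emeasure lebesgue (\<Union>i\<in>C. W i) \<le> ennreal (1 - k) * emeasure lebesgue U"
        by (simp add: mult_left_mono)
      have nl: "B - (\<Union>i\<in>C. b i) \<in> null_sets lebesgue"
        using neg by (simp add: negligible_iff_null_sets b_def)
      have WU: "(\<Union>i\<in>C. W i) \<in> sets lebesgue" using ms C(1) by (intro sets.countable_UN'') auto
      have eT: "emeasure lebesgue ?T = emeasure lebesgue (\<Union>i\<in>C. W i)"
        using emeasure_Un_null_set[OF WU nl] by (simp add: Un_commute)
      have fin: "emeasure lebesgue ?T < top"
      proof -
        have "ennreal (1 - k) * emeasure lebesgue U < top"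
          using U(2) ennreal_less_top[of "1 - k"] unfolding ennreal_mult_less_top fmeasurable_def infinity_ennreal_def by blast
        then show ?thesis using le eT by simp
      qed
      have T: "?T \<in> lmeasurable" using fin nl WU by (intro fmeasurableI) auto
      have "B \<subseteq> ?T" using CK(4) BA by (force simp: W_def)
      then have m: "m \<le> measure lebesgue ?T" using mle T by blast
      have "ennreal (measure lebesgue ?T) \<le> ennreal ((1 - k) * measure lebesgue U)"
        using le eT T U(2) k by (simp add: emeasure_eq_measure2 ennreal_mult)
      then show ?thesis using m k by (subst (asm) ennreal_le_iff) (auto intro: mult_nonneg_nonneg)
    qed
    have "m \<le> (1 - k) * (m + e)" if e: "0 < e" for e
    proof -
      have "Inf M < m + e / 2" using e by (simp add: m_def)
      then obtain U where U: "U \<in> lmeasurable" "B \<subseteq> U" "measure lebesgue U < m + e / 2"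
        using cInf_lessD[OF ne] by (auto simp: M_def)
      obtain T where T: "open T" "U \<subseteq> T" "T - U \<in> lmeasurable" "emeasure lebesgue (T - U) < ennreal (e / 2)"
        using sets_lebesgue_outer_open[of U "e / 2"] U e by auto
      have TU: "T = U \<union> (T - U)" using T by auto
      then have Tm: "T \<in> lmeasurable" using T(3) U(1) by (metis fmeasurable.Un)
      have "measure lebesgue T \<le> measure lebesgue U + measure lebesgue (T - U)"
        using TU T(3) U(1) by (metis fmeasurableD measure_Un_le)
      also have "measure lebesgue (T - U) < e / 2"
        using T(3,4) by (simp add: emeasure_eq_measure2 ennreal_less_iff)
      finally have "measure lebesgue T < m + e" using U(3) by simp
      moreover have "m \<le> (1 - k) * measure lebesgue T" using step[OF T(1) Tm] T(2) U(2) by auto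
      ultimately show ?thesis using k by (smt (verit) mult_left_mono)
    qed
    then have "m \<le> (1 - k) * m + e" if "0 < e" for e
      using that k m0 by (smt (verit) mult_le_cancel_right1 mult_left_le_one_le distrib_left)
    then have "m \<le> (1 - k) * m" by (rule field_le_epsilon)
    then have m: "m = 0" using k m0 by (simp add: algebra_simps mult_le_0_iff)
    show "negligible B" unfolding negligible_outer
    proof (intro allI impI)
      fix e :: real assume "0 < e"
      then have "Inf M < e" using m m_def by simp
      then show "\<exists>T. B \<subseteq> T \<and> T \<in> lmeasurable \<and> measure lebesgue T < e"
        using cInf_lessD[OF ne] by (auto simp: M_def)
    qed
  qed
  have "negligible (\<Union>n. A \<inter> ball 0 (real n))"
    by (intro negligible_countable_Union) (auto intro: main)
  moreover have "(\<Union>n. A \<inter> ball 0 (real n)) = A"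
    by (auto simp: reals_Archimedean2)
  ultimately show ?thesis by simp
qed

text \<open>
  Density zero is a limit; fixing the tolerance \<open>\<eta>\<close> and the threshold \<open>\<delta>\<close> on the scale turns it into
  closed sets, to which Baire's theorem applies.
\<close>
definition thin_points :: "'a::euclidean_space set \<Rightarrow> real \<Rightarrow> real \<Rightarrow> 'a set" where
  "thin_points U \<eta> \<delta> =
     {x. \<forall>r. 0 < r \<and> r < \<delta> \<longrightarrow> measure lebesgue (U \<inter> ball x r) \<le> \<eta> * measure lebesgue (ball x r)}"

lemma lmeasurable_Int_ball: "U \<in> sets lebesgue \<Longrightarrow> U \<inter> ball x r \<in> lmeasurable"
  by (rule fmeasurable_Int_fmeasurable[of "ball x r" lebesgue U, THEN subst[of _ _ "\<lambda>A. A \<in> lmeasurable", OF Int_commute]]) auto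

text \<open>
  For open balls, \<open>x \<mapsto> |U \<inter> ball x r|\<close> is lower semicontinuous: a slightly smaller ball about \<open>x\<close> already
  captures almost the same mass, and it lies in the ball of radius \<open>r\<close> about every nearby point.
\<close>
lemma closed_thin_points:
  assumes U: "U \<in> sets lebesgue"
  shows "closed (thin_points U \<eta> \<delta>)"
proof -
  have op: "open {x. c < measure lebesgue (U \<inter> ball x r)}" for c r
  proof (rule openI)
    fix x assume "x \<in> {x. c < measure lebesgue (U \<inter> ball x r)}"
    then have x: "c < measure lebesgue (U \<inter> ball x r)" by simp
    have lim: "(\<lambda>n. measure lebesgue (U \<inter> ball x (r - 1 / Suc n))) \<longlonglongrightarrow> measure lebesgue (\<Union>n. U \<inter> ball x (r - 1 / Suc n))"
    proof (rule Lim_measure_incseq)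
      show "range (\<lambda>n. U \<inter> ball x (r - 1 / Suc n)) \<subseteq> sets lebesgue" using U by auto
      show "incseq (\<lambda>n. U \<inter> ball x (r - 1 / Suc n))"
      proof (rule incseq_SucI)
        fix n :: nat
        have "1 / real (Suc (Suc n)) \<le> 1 / real (Suc n)" by (simp add: frac_le)
        then show "U \<inter> ball x (r - 1 / real (Suc n)) \<subseteq> U \<inter> ball x (r - 1 / real (Suc (Suc n)))"
          by auto
      qed
      have "emeasure lebesgue (\<Union>n. U \<inter> ball x (r - 1 / Suc n)) \<le> emeasure lebesgue (ball x r)"
        using U by (intro emeasure_mono) (auto elim!: less_le_trans)
      then show "emeasure lebesgue (\<Union>n. U \<inter> ball x (r - 1 / Suc n)) \<noteq> \<infinity>"
        using emeasure_lborel_ball_finite[of x r] by (auto simp: top_unique)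
    qed
    have "(\<Union>n. U \<inter> ball x (r - 1 / Suc n)) = U \<inter> ball x r"
    proof (intro equalityI subsetI)
      fix y assume y: "y \<in> U \<inter> ball x r"
      then obtain n where "1 / real (Suc n) < r - dist x y" using nat_approx_posE[of "r - dist x y"] by auto
      then show "y \<in> (\<Union>n. U \<inter> ball x (r - 1 / Suc n))" using y by (auto intro!: exI[of _ n])
    qed (auto elim!: less_le_trans)
    then have "eventually (\<lambda>n. c < measure lebesgue (U \<inter> ball x (r - 1 / Suc n))) sequentially"
      using order_tendstoD(1)[OF lim] x by simp
    then obtain n where n: "c < measure lebesgue (U \<inter> ball x (r - 1 / Suc n))"
      using eventually_happens' sequentially_bot by blast
    show "\<exists>e>0. ball x e \<subseteq> {x. c < measure lebesgue (U \<inter> ball x r)}"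
    proof (intro exI conjI subsetI CollectI)
      show "0 < 1 / real (Suc n)" by simp
      fix y assume y: "y \<in> ball x (1 / real (Suc n))"
      have "ball x (r - 1 / Suc n) \<subseteq> ball y r"
      proof
        fix z assume "z \<in> ball x (r - 1 / Suc n)"
        then show "z \<in> ball y r" using y dist_triangle[of y z x] by (auto simp: dist_commute)
      qed
      then have "measure lebesgue (U \<inter> ball x (r - 1 / Suc n)) \<le> measure lebesgue (U \<inter> ball y r)"
        using U by (intro measure_mono_fmeasurable lmeasurable_Int_ball) auto
      then show "c < measure lebesgue (U \<inter> ball y r)" using n by simp
    qed
  qed
  have "closed {x. measure lebesgue (U \<inter> ball x r) \<le> \<eta> * measure lebesgue (ball x r)}" if "0 < r" for r
  proof -
    have "{x. measure lebesgue (U \<inter> ball x r) \<le> \<eta> * measure lebesgue (ball x r)} = - {x. \<eta> * (unit_ball_vol (real DIM('a)) * r ^ DIM('a)) < measure lebesgue (U \<inter> ball x r)}"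
      using that by (auto simp: content_ball)
    then show ?thesis using op by (simp add: closed_def)
  qed
  moreover have "thin_points U \<eta> \<delta> = (\<Inter>r\<in>{0<..<\<delta>}. {x. measure lebesgue (U \<inter> ball x r) \<le> \<eta> * measure lebesgue (ball x r)})"
    by (auto simp: thin_points_def)
  ultimately show ?thesis by auto
qed

lemma density_0_iff:
  "has_lebesgue_density_at U 0 x \<longleftrightarrow> (\<forall>j. \<exists>k. x \<in> thin_points U (1 / Suc j) (1 / Suc k))"
proof
  assume L: "has_lebesgue_density_at U 0 x"
  show "\<forall>j. \<exists>k. x \<in> thin_points U (1 / Suc j) (1 / Suc k)"
  proof
    fix j :: nat
    have "eventually (\<lambda>r. measure lebesgue (U \<inter> ball x r) / measure lebesgue (ball x r) < 1 / Suc j) (at_right 0)"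
      using L unfolding has_lebesgue_density_at_def by (intro order_tendstoD(2)) auto
    then obtain b where b: "0 < b" "\<And>r. 0 < r \<Longrightarrow> r < b \<Longrightarrow> measure lebesgue (U \<inter> ball x r) / measure lebesgue (ball x r) < 1 / Suc j"
      by (auto simp: eventually_at_right_field)
    obtain k where k: "1 / real (Suc k) < b" using nat_approx_posE[OF b(1)] by auto
    have "x \<in> thin_points U (1 / Suc j) (1 / Suc k)"
      unfolding thin_points_def
    proof (intro CollectI allI impI)
      fix r assume r: "0 < r \<and> r < 1 / real (Suc k)"
      then have "measure lebesgue (U \<inter> ball x r) / measure lebesgue (ball x r) < 1 / Suc j" using b k by auto
      moreover have "0 < measure lebesgue (ball x r)" using r by simp
      ultimately show "measure lebesgue (U \<inter> ball x r) \<le> 1 / Suc j * measure lebesgue (ball x r)"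
        by (subst (asm) pos_divide_less_eq) auto
    qed
    then show "\<exists>k. x \<in> thin_points U (1 / Suc j) (1 / Suc k)" ..
  qed
next
  assume R: "\<forall>j. \<exists>k. x \<in> thin_points U (1 / Suc j) (1 / Suc k)"
  show "has_lebesgue_density_at U 0 x" unfolding has_lebesgue_density_at_def
  proof (rule order_tendstoI)
    fix a :: real assume "a < 0"
    then show "eventually (\<lambda>r. a < measure lebesgue (U \<inter> ball x r) / measure lebesgue (ball x r)) (at_right 0)"
      by (auto intro!: always_eventually less_le_trans[of a 0])
  next
    fix a :: real assume "0 < a"
    then obtain j where j: "1 / real (Suc j) < a" using nat_approx_posE by blast
    obtain k where k: "x \<in> thin_points U (1 / Suc j) (1 / Suc k)" using R by blast
    have "measure lebesgue (U \<inter> ball x r) / measure lebesgue (ball x r) < a" if "0 < r" "r < 1 / Suc k" for r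
    proof -
      have "measure lebesgue (U \<inter> ball x r) \<le> 1 / Suc j * measure lebesgue (ball x r)"
        using k that by (simp add: thin_points_def)
      moreover have "0 < measure lebesgue (ball x r)" using that by simp
      ultimately have "measure lebesgue (U \<inter> ball x r) / measure lebesgue (ball x r) \<le> 1 / Suc j"
        by (subst pos_divide_le_eq) auto
      then show ?thesis using j by simp
    qed
    then show "eventually (\<lambda>r. measure lebesgue (U \<inter> ball x r) / measure lebesgue (ball x r) < a) (at_right 0)"
      unfolding eventually_at_right_field by (intro exI[of _ "1 / real (Suc k)"]) auto
  qed
qed

lemma density_1_iff_compl:
  assumes U: "U \<in> sets lebesgue"
  shows "has_lebesgue_density_at U 1 x \<longleftrightarrow> has_lebesgue_density_at (- U) 0 x"
proof -
  have eq: "measure lebesgue (- U \<inter> ball x r) / measure lebesgue (ball x r) =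
        1 - measure lebesgue (U \<inter> ball x r) / measure lebesgue (ball x r)" if r: "0 < r" for r
  proof -
    have "measure lebesgue (ball x r - U \<inter> ball x r) = measure lebesgue (ball x r) - measure lebesgue (U \<inter> ball x r)"
      using U by (intro measurable_measure_Diff lmeasurable_Int_ball) (auto simp: lmeasurable_Int_ball)
    moreover have "ball x r - U \<inter> ball x r = - U \<inter> ball x r" by auto
    moreover have "measure lebesgue (ball x r) \<noteq> 0" using r by simp
    ultimately show ?thesis by (simp add: diff_divide_distrib)
  qed
  have "has_lebesgue_density_at (- U) 0 x \<longleftrightarrow>
     ((\<lambda>r. 1 - measure lebesgue (U \<inter> ball x r) / measure lebesgue (ball x r)) \<longlongrightarrow> 0) (at_right 0)"
    unfolding has_lebesgue_density_at_def
    by (rule tendsto_cong, unfold eventually_at_right_field, intro exI[of _ 1] conjI allI impI eq) auto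
  also have "\<dots> \<longleftrightarrow> has_lebesgue_density_at U 1 x"
    unfolding has_lebesgue_density_at_def
  proof
    assume "((\<lambda>r. 1 - measure lebesgue (U \<inter> ball x r) / measure lebesgue (ball x r)) \<longlongrightarrow> 0) (at_right 0)"
    from tendsto_diff[OF tendsto_const[of 1] this]
    show "((\<lambda>r. measure lebesgue (U \<inter> ball x r) / measure lebesgue (ball x r)) \<longlongrightarrow> 1) (at_right 0)" by simp
  next
    assume "((\<lambda>r. measure lebesgue (U \<inter> ball x r) / measure lebesgue (ball x r)) \<longlongrightarrow> 1) (at_right 0)"
    from tendsto_diff[OF tendsto_const[of 1] this]
    show "((\<lambda>r. 1 - measure lebesgue (U \<inter> ball x r) / measure lebesgue (ball x r)) \<longlongrightarrow> 0) (at_right 0)" by simp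
  qed
  finally show ?thesis ..
qed

lemma borel_density_0:
  assumes "U \<in> sets lebesgue"
  shows "{x. has_lebesgue_density_at U 0 x} \<in> sets borel"
proof -
  have "{x. has_lebesgue_density_at U 0 x} = (\<Inter>j. \<Union>k. thin_points U (1 / Suc j) (1 / Suc k))"
    by (auto simp: density_0_iff)
  also have "\<dots> \<in> sets borel"
    by (intro sets.countable_INT'' sets.countable_UN'' borel_closed closed_thin_points assms) auto
  finally show ?thesis .
qed

text \<open>
  One half of Lebesgue's density theorem. The points outside \<open>U\<close> near which \<open>U\<close> keeps a fixed proportion
  of arbitrarily small balls form a porous set: the hole is the part of \<open>U\<close> in the ball.
\<close>
lemma negligible_not_density_0:
  assumes U: "U \<in> sets lebesgue"
  shows "negligible {x. x \<notin> U \<and> \<not> has_lebesgue_density_at U 0 x}"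
proof -
  have "negligible (- U - (\<Union>k. thin_points U (1 / Suc j) (1 / Suc k)))" for j :: nat
  proof (rule negligible_if_porous)
    show "0 < 1 / real (Suc j)" "1 / real (Suc j) \<le> 1" by simp_all
    fix x and e :: real assume x: "x \<in> - U - (\<Union>k. thin_points U (1 / Suc j) (1 / Suc k))" and "0 < e"
    then obtain k where k: "1 / real (Suc k) < e" using nat_approx_posE by blast
    from x have "x \<notin> thin_points U (1 / Suc j) (1 / Suc k)" by blast
    then obtain r where "0 < r" "r < 1 / Suc k" "1 / Suc j * measure lebesgue (ball x r) \<le> measure lebesgue (U \<inter> ball x r)"
      by (auto simp: thin_points_def)
    then show "\<exists>r Z. 0 < r \<and> r < e \<and> Z \<in> sets lebesgue \<and> Z \<subseteq> ball x r \<and>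
       Z \<inter> (- U - (\<Union>k. thin_points U (1 / Suc j) (1 / Suc k))) = {} \<and>
       1 / Suc j * measure lebesgue (ball x r) \<le> measure lebesgue Z"
      using U k by (intro exI[of _ r] exI[of _ "U \<inter> ball x r"]) auto
  qed
  then have "negligible (\<Union>j. - U - (\<Union>k. thin_points U (1 / Suc j) (1 / Suc k)))"
    by (intro negligible_countable_Union) auto
  moreover have "(\<Union>j. - U - (\<Union>k. thin_points U (1 / Suc j) (1 / Suc k))) = {x. x \<notin> U \<and> \<not> has_lebesgue_density_at U 0 x}"
    by (auto simp: density_0_iff)
  ultimately show ?thesis by simp
qed


section \<open>Rays through one-sided contact points\<close>

lemma norm_unit_diff_le:
  fixes w u :: "'a::real_normed_vector"
  assumes u: "norm u = 1" and c: "0 < c" and w: "w \<noteq> 0"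
  shows "norm (w /\<^sub>R norm w - u) \<le> 2 * norm (w - c *\<^sub>R u) / c"
proof -
  have "c *\<^sub>R (w /\<^sub>R norm w - u) = (w - c *\<^sub>R u) - ((norm w - c) / norm w) *\<^sub>R w"
    using w by (simp add: algebra_simps diff_divide_distrib divide_inverse)
  then have "c * norm (w /\<^sub>R norm w - u) \<le> norm (w - c *\<^sub>R u) + norm (((norm w - c) / norm w) *\<^sub>R w)"
    using norm_triangle_ineq4[of "w - c *\<^sub>R u" "((norm w - c) / norm w) *\<^sub>R w"] c
      norm_scaleR[of c "w /\<^sub>R norm w - u"] by simp
  also have "norm (((norm w - c) / norm w) *\<^sub>R w) = \<bar>norm w - norm (c *\<^sub>R u)\<bar>"
    using w u c by simp
  also have "\<dots> \<le> norm (w - c *\<^sub>R u)" by (rule norm_triangle_ineq3)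
  finally show ?thesis using c by (simp add: field_simps)
qed

text \<open>
  The sign \<open>e\<close> selects the outer or the inner side of a point on its ray. The numbers \<open>w\<close>, \<open>y\<close>, \<open>N\<close> are
  distances to the origin, and \<open>w\<close> is close to \<open>N + 2 e X\<close>.
\<close>
lemma radial_offset_bounds:
  fixes e w N X y A :: real
  assumes e: "e = 1 \<or> e = -1" and w: "w - N - 2 * e * X < X / 2" "- (X / 2) < w - N - 2 * e * X"
  shows "e * y \<le> e * N + A \<Longrightarrow> 0 < X \<Longrightarrow> A \<le> X \<Longrightarrow> 0 < e * (w - y)"
    and "y - N < B / 4 \<Longrightarrow> - (B / 4) < y - N \<Longrightarrow> e * (w - y) < 5 / 2 * X + B / 4"
  using e w by auto

lemma measure_scaleR_image:
  fixes S :: "'a::euclidean_space set"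
  assumes "0 < t"
  shows "measure lebesgue ((\<lambda>x. t *\<^sub>R x) ` S) = t ^ DIM('a) * measure lebesgue S"
  using assms measure_lebesgue_affine[of t 0 S] by (simp del: measure_completion)

text \<open>
  At such a point \<open>y\<close> the set \<open>U\<close> is thin, yet it contains a whole piece of the ray through \<open>y\<close> that ends at
  \<open>y\<close>. Both properties hold at scale \<open>\<delta>\<close>.
\<close>
definition contact_points :: "'a::euclidean_space set \<Rightarrow> real \<Rightarrow> real \<Rightarrow> real \<Rightarrow> 'a set" where
  "contact_points U e \<eta> \<delta> =
     {y \<in> thin_points U \<eta> \<delta>. \<forall>s. 0 < s \<and> s < \<delta> \<longrightarrow> (1 + e * s) *\<^sub>R y \<in> U}"

text \<open>
  The cone over \<open>F\<close> is porous. Given \<open>x\<close> in it, consider the points of \<open>F\<close> whose direction is within \<open>2 r\<close>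
  of that of \<open>x\<close>, and let \<open>y\<close> be one for which \<open>e * norm y\<close> is almost largest. All of these points lie in
  one thin shell, so the pieces of \<open>U\<close> attached to them reach past \<open>y\<close>. Hence a ball \<open>Q\<close> just past \<open>y\<close>
  meets the cone only inside \<open>U\<close>. Since \<open>U\<close> is thin at \<open>y\<close>, it fills at most half of \<open>Q\<close>; the other half
  misses the cone and is moved to \<open>x\<close> by a dilation, which preserves the cone.
  
  Choosing \<open>y\<close> almost extremal is essential: it allows the distances of the points of \<open>F\<close> from the origin
  to depend on the direction in an arbitrary way. The tolerance \<open>\<eta>\<close> compares \<open>Q\<close>, of radius \<open>r N / 2\<close>,
  with the ball of radius \<open>5 r N\<close> about \<open>y\<close> that contains it.
\<close>
lemma negligible_cone_contact_aux:
  fixes U :: "'a::euclidean_space set"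
  assumes U: "U \<in> sets lebesgue" and e: "e = 1 \<or> e = -1" and \<eta>: "\<eta> = 1 / (2 * 10 ^ DIM('a))"
    and F: "F \<subseteq> contact_points U e \<eta> \<delta>" "\<And>y. y \<in> F \<Longrightarrow> a \<le> norm y \<and> norm y < a * (1 + \<delta> / 4)"
    and a: "0 < a" and \<delta>: "0 < \<delta>" "\<delta> \<le> 1"
  shows "negligible {x. \<exists>l>0. l *\<^sub>R x \<in> F}"
proof (rule negligible_if_porous[of "1/2"])
  fix x :: 'a and d :: real
  assume x: "x \<in> {x. \<exists>l>0. l *\<^sub>R x \<in> F}" and d: "0 < d"
  then obtain l where l: "0 < l" "l *\<^sub>R x \<in> F" by auto
  have x0: "x \<noteq> 0" using F(2)[OF l(2)] a by auto
  define u where "u = x /\<^sub>R norm x"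
  have u: "norm u = 1" using x0 by (simp add: u_def)
  define r where "r = min (1 / 8) (min (\<delta> / 32) (min (\<delta> / (10 * a * (1 + \<delta>/4))) (d / norm x)))"
  have "0 < \<delta> / (10 * a * (1 + \<delta>/4))" "0 < d / norm x" using a \<delta> d x0 by simp_all
  then have r: "0 < r" "r \<le> 1 / 8" "r \<le> \<delta> / 32" "r \<le> \<delta> / (10 * a * (1 + \<delta>/4))" "r \<le> d / norm x"
    using \<delta> unfolding r_def by linarith+
  define Fr where "Fr = {y \<in> F. norm (y /\<^sub>R norm y - u) < 2 * r}"
  have lx: "l *\<^sub>R x \<in> Fr" using l x0 r(1) by (simp add: Fr_def u_def field_simps)
  have Fb: "a \<le> norm y" "norm y < a * (1 + \<delta> / 4)" "y \<in> F" if "y \<in> Fr" for y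
    using that F(2) by (auto simp: Fr_def)
  obtain y where y: "y \<in> Fr" "\<And>y'. y' \<in> Fr \<Longrightarrow> e * norm y' \<le> e * norm y + r * a"
  proof -
    have bd: "bdd_above ((\<lambda>y. e * norm y) ` Fr)"
    proof (rule bdd_aboveI2)
      fix y assume "y \<in> Fr"
      moreover have "e * norm y \<le> norm y" using e by auto
      ultimately show "e * norm y \<le> a * (1 + \<delta> / 4)" using Fb[of y] by linarith
    qed
    have "(SUP y\<in>Fr. e * norm y) - r * a < (SUP y\<in>Fr. e * norm y)" using r a by simp
    then obtain y where y: "y \<in> Fr" "(SUP y\<in>Fr. e * norm y) - r * a < e * norm y"
      using less_cSUP_iff[OF _ bd, of "(SUP y\<in>Fr. e * norm y) - r * a"] lx by blast
    show ?thesis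
    proof (rule that[OF y(1)])
      fix y' assume "y' \<in> Fr"
      then have "e * norm y' \<le> (SUP y\<in>Fr. e * norm y)" by (intro cSUP_upper bd)
      then show "e * norm y' \<le> e * norm y + r * a" using y(2) by simp
    qed
  qed
  define N where "N = norm y"
  have N: "a \<le> N" "N < a * (1 + \<delta> / 4)" "0 < N" using Fb[OF y(1)] a by (auto simp: N_def)
  have dN: "r * a \<le> r * N" using N r by simp
  define k where "k = 1 + 2 * e * r"
  have k: "3 / 4 \<le> k" "k \<le> 5 / 4" using e r by (auto simp: k_def)
  define c where "c = (k * N) *\<^sub>R u"
  \<comment> \<open>The centre lies at distance 2 r N past y on the ray through x, so that Q stays past all points of Fr.\<close>
  define Q where "Q = ball c (r * N / 2)"
  have cone: "w \<in> U" if w: "w \<in> Q" "\<exists>l>0. l *\<^sub>R w \<in> F" for w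
  proof -
    from w(2) obtain m where m: "0 < m" "m *\<^sub>R w \<in> F" by auto
    have w0: "w \<noteq> 0" using F(2)[OF m(2)] a by auto
    have wc: "norm (w - c) < r * N / 2" using w(1) by (simp add: Q_def dist_norm norm_minus_commute)
    have "norm (w /\<^sub>R norm w - u) \<le> 2 * norm (w - c) / (k * N)"
      unfolding c_def using norm_unit_diff_le[OF u _ w0, of "k * N"] k N by simp
    also have "\<dots> < 2 * r"
    proof -
      have "norm (w - c) < r * (k * N)"
      proof -
        have "r * N * (1 / 2) < r * N * k" using k(1) r(1) N(3) by (intro mult_strict_left_mono) auto
        then show ?thesis using wc by (simp add: mult_ac)
      qed
      then show ?thesis using k N by (simp add: field_simps)
    qed
    finally have "m *\<^sub>R w \<in> Fr" using m w0 by (simp add: Fr_def field_simps)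
    define y' where "y' = m *\<^sub>R w"
    have y': "y' \<in> Fr" using \<open>m *\<^sub>R w \<in> Fr\<close> by (simp add: y'_def)
    note B = Fb[OF y'] y(2)[OF y']
    have nc: "norm c = k * N" using u k N by (simp add: c_def)
    have nw: "\<bar>norm w - k * N\<bar> < r * N / 2" using norm_triangle_ineq3[of w c] wc nc by simp
    have kN: "k * N = N + 2 * e * (r * N)" by (simp add: k_def algebra_simps)
    define s where "s = e * (norm w / norm y' - 1)"
    have y'0: "0 < norm y'" using B a by linarith
    have ey: "e * (norm w - norm y') = s * norm y'" using y'0 by (simp add: s_def field_simps)
    have lo: "0 < e * (norm w - norm y')"
    proof -
      have rN: "0 < r * N" using r N by simp
      have d: "norm w - N - 2 * e * (r * N) < r * N / 2" "- (r * N / 2) < norm w - N - 2 * e * (r * N)"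
        using nw unfolding kN by linarith+
      have d': "e * norm y' \<le> e * N + r * a" using B(4) by (simp add: N_def)
      show ?thesis using radial_offset_bounds(1)[OF e d d' rN dN] .
    qed
    have up: "e * (norm w - norm y') < \<delta> * norm y'"
    proof -
      have 1: "e * (norm w - norm y') < 5 / 2 * (r * N) + a * \<delta> / 4"
      proof -
        have d: "norm w - N - 2 * e * (r * N) < r * N / 2" "- (r * N / 2) < norm w - N - 2 * e * (r * N)"
          using nw unfolding kN by linarith+
        have d': "norm y' - N < a * \<delta> / 4" "- (a * \<delta> / 4) < norm y' - N" using B(1,2) N by (simp_all add: algebra_simps)
        show ?thesis using radial_offset_bounds(2)[OF e d d'] .
      qed
      have "r * N \<le> \<delta> / 32 * (a * (1 + \<delta> / 4))"
        using r N \<delta> a by (intro mult_mono) auto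
      also have "\<dots> \<le> \<delta> / 32 * (a * 2)" using \<delta> a by (intro mult_left_mono) auto
      finally have "e * (norm w - norm y') < \<delta> * a" using 1 mult_pos_pos[OF \<delta>(1) a] by (simp add: mult.commute)
      also have "\<dots> \<le> \<delta> * norm y'" using B \<delta> by simp
      finally show ?thesis .
    qed
    have s: "0 < s" "s < \<delta>" using lo up y'0 unfolding ey by (auto simp: zero_less_mult_iff)
    have "1 + e * s = norm w / norm y'" using e by (auto simp: s_def)
    moreover have "(norm w / norm y') *\<^sub>R y' = w" using w0 m by (simp add: y'_def)
    ultimately have "(1 + e * s) *\<^sub>R y' = w" by simp
    moreover have "(1 + e * s) *\<^sub>R y' \<in> U" using B(3) F(1) s by (auto simp: contact_points_def)
    ultimately show ?thesis by simp
  qed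
  have Qb: "Q \<subseteq> ball y (5 * (r * N))"
  proof
    fix w assume "w \<in> Q"
    then have "norm (w - c) < r * N / 2" by (simp add: Q_def dist_norm norm_minus_commute)
    moreover have "norm (c - N *\<^sub>R u) = 2 * (r * N)"
    proof -
      have "c - N *\<^sub>R u = (2 * e * r * N) *\<^sub>R u" by (simp add: c_def k_def algebra_simps)
      then show ?thesis using e r N u by auto
    qed
    moreover have "norm (N *\<^sub>R u - y) < 2 * (r * N)"
    proof -
      have "N *\<^sub>R (y /\<^sub>R norm y - u) = y - N *\<^sub>R u" using N(3) by (simp add: N_def algebra_simps)
      then have "norm (N *\<^sub>R u - y) = N * norm (y /\<^sub>R norm y - u)"
        using N(3) norm_scaleR[of N "y /\<^sub>R norm y - u"] by (simp add: norm_minus_commute)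
      also have "\<dots> < N * (2 * r)" using y(1) N(3) by (simp add: Fr_def)
      finally show ?thesis by (simp add: algebra_simps)
    qed
    moreover have "norm (w - y) \<le> norm (w - c) + norm (c - N *\<^sub>R u) + norm (N *\<^sub>R u - y)"
    proof -
      have "w - y = (w - c) + (c - N *\<^sub>R u) + (N *\<^sub>R u - y)" by simp
      then show ?thesis using norm_triangle_ineq[of "(w - c) + (c - N *\<^sub>R u)" "N *\<^sub>R u - y"]
          norm_triangle_ineq[of "w - c" "c - N *\<^sub>R u"] by simp
    qed
    moreover have "0 < r * N" using r N by simp
    ultimately have "norm (w - y) < 5 * (r * N)" by linarith
    then show "w \<in> ball y (5 * (r * N))" by (simp add: dist_norm norm_minus_commute)
  qed
  have mQ: "measure lebesgue (U \<inter> Q) \<le> 1 / 2 * measure lebesgue Q"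
  proof -
    have "5 * (r * N) < \<delta>"
    proof -
      have "r * N \<le> (\<delta> / (10 * a * (1 + \<delta>/4))) * (a * (1 + \<delta> / 4))"
        using r N \<delta> a by (intro mult_mono) auto
      also have "\<dots> = \<delta> / 10"
      proof -
        have "\<delta> / (10 * a * z) * (a * z) = \<delta> / 10" if "z \<noteq> 0" for z using a that by simp
        then show ?thesis using \<delta> by simp
      qed
      finally show ?thesis using \<delta> by simp
    qed
    moreover have "y \<in> thin_points U \<eta> \<delta>" using Fb(3)[OF y(1)] F(1) by (auto simp: contact_points_def)
    moreover have "0 < r * N" using r N by simp
    ultimately have "measure lebesgue (U \<inter> ball y (5 * (r * N))) \<le> \<eta> * measure lebesgue (ball y (5 * (r * N)))"
      by (simp add: thin_points_def)
    moreover have "measure lebesgue (U \<inter> Q) \<le> measure lebesgue (U \<inter> ball y (5 * (r * N)))"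
    proof (rule measure_mono_fmeasurable)
      show "U \<inter> Q \<in> sets lebesgue" using U unfolding Q_def by (intro sets.Int) auto
    qed (use U Qb in \<open>auto intro: lmeasurable_Int_ball\<close>)
    moreover have "\<eta> * measure lebesgue (ball y (5 * (r * N))) = 1 / 2 * measure lebesgue Q"
    proof -
      have eq: "(5 * (r * N)) ^ DIM('a) = 10 ^ DIM('a) * (r * N / 2) ^ DIM('a)"
        unfolding power_mult_distrib[of 10 "r * N / 2", symmetric] by (simp add: mult.commute)
      have ge: "0 \<le> 5 * (r * N)" "0 \<le> r * N / 2" using r N by simp_all
      have "measure lebesgue (ball y (5 * (r * N))) = unit_ball_vol (real DIM('a)) * (10 ^ DIM('a) * (r * N / 2) ^ DIM('a))"
        using content_ball[OF ge(1), of y] unfolding eq by simp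
      moreover have "measure lebesgue Q = unit_ball_vol (real DIM('a)) * (r * N / 2) ^ DIM('a)"
        using content_ball[OF ge(2), of c] unfolding Q_def by simp
      ultimately show ?thesis unfolding \<eta> by simp
    qed
    ultimately show ?thesis by simp
  qed
  \<comment> \<open>The dilation that takes the centre of Q to x.\<close>
  define t where "t = norm x / (k * N)"
  have t: "0 < t" using x0 k N by (simp add: t_def)
  define Z where "Z = (\<lambda>w. t *\<^sub>R w) ` (Q - U)"
  have tc: "t *\<^sub>R c = x" using k N x0 by (simp add: t_def c_def u_def)
  have tQ: "(\<lambda>w. t *\<^sub>R w) ` Q = ball x (t * (r * N / 2))"
    unfolding Q_def using ball_scale[of t c "r * N / 2"] t tc by simp
  have QU: "Q - U \<in> sets lebesgue" using U by (auto simp: Q_def)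
  have mQU: "1 / 2 * measure lebesgue Q \<le> measure lebesgue (Q - U)"
  proof -
    have "measure lebesgue (Q - U \<inter> Q) = measure lebesgue Q - measure lebesgue (U \<inter> Q)"
      using U by (intro measurable_measure_Diff) (auto simp: Q_def lmeasurable_Int_ball)
    moreover have "Q - U \<inter> Q = Q - U" by auto
    ultimately show ?thesis using mQ by simp
  qed
  show "\<exists>ra Z. 0 < ra \<and> ra < d \<and> Z \<in> sets lebesgue \<and> Z \<subseteq> ball x ra \<and> Z \<inter> {x. \<exists>l>0. l *\<^sub>R x \<in> F} = {} \<and>
            1 / 2 * measure lebesgue (ball x ra) \<le> measure lebesgue Z"
  proof (intro exI conjI)
    show "0 < t * (r * N / 2)" using t r N by simp
    have "t * (r * N / 2) = norm x * r / (2 * k)" using N by (simp add: t_def field_simps)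
    also have "\<dots> < norm x * r" using k x0 r by (simp add: divide_less_eq)
    also have "\<dots> \<le> d" using r(5) x0 by (simp add: field_simps)
    finally show "t * (r * N / 2) < d" .
    show "Z \<in> sets lebesgue" unfolding Z_def
      using QU by (intro differentiable_image_in_sets_lebesgue) (auto intro!: derivative_intros)
    show "Z \<subseteq> ball x (t * (r * N / 2))" unfolding tQ[symmetric] Z_def by auto
    show "Z \<inter> {x. \<exists>l>0. l *\<^sub>R x \<in> F} = {}"
    proof -
      have "z \<notin> {x. \<exists>l>0. l *\<^sub>R x \<in> F}" if z: "z \<in> Z" for z
      proof
        assume "z \<in> {x. \<exists>l>0. l *\<^sub>R x \<in> F}"
        then obtain l where l: "0 < l" "l *\<^sub>R z \<in> F" by auto
        obtain w where w: "w \<in> Q" "w \<notin> U" "z = t *\<^sub>R w" using z by (auto simp: Z_def)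
        have "0 < l * t" "(l * t) *\<^sub>R w \<in> F" using l w t by auto
        then show False using cone[OF w(1)] w(2) by blast
      qed
      then show ?thesis unfolding disjoint_iff by blast
    qed
    have "measure lebesgue (ball x (t * (r * N / 2))) = t ^ DIM('a) * measure lebesgue Q"
      unfolding tQ[symmetric] by (rule measure_scaleR_image[OF t])
    moreover have "measure lebesgue Z = t ^ DIM('a) * measure lebesgue (Q - U)"
      unfolding Z_def by (rule measure_scaleR_image[OF t])
    ultimately show "1 / 2 * measure lebesgue (ball x (t * (r * N / 2))) \<le> measure lebesgue Z"
      using mQU t by (simp add: mult.left_commute)
  qed
qed auto

lemma negligible_cone_contact:
  fixes U :: "'a::euclidean_space set"
  assumes U: "U \<in> sets lebesgue" and e: "e = 1 \<or> e = -1" and \<eta>: "\<eta> = 1 / (2 * 10 ^ DIM('a))"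
    and \<delta>: "0 < \<delta>" "\<delta> \<le> 1"
  shows "negligible {x. x \<noteq> 0 \<and> (\<exists>l>0. l *\<^sub>R x \<in> contact_points U e \<eta> \<delta>)}"
proof -
  \<comment> \<open>Cut the contact points into shells thin enough for the previous lemma.\<close>
  define q where "q = 1 + \<delta> / 4"
  have q: "1 < q" using \<delta> by (simp add: q_def)
  define F where "F i = {y \<in> contact_points U e \<eta> \<delta>. q powi i \<le> norm y \<and> norm y < q powi i * q}" for i :: int
  have "negligible (\<Union>i. {x. \<exists>l>0. l *\<^sub>R x \<in> F i})"
  proof (intro negligible_countable_Union)
    fix S assume "S \<in> range (\<lambda>i. {x. \<exists>l>0. l *\<^sub>R x \<in> F i})"
    then obtain i where S: "S = {x. \<exists>l>0. l *\<^sub>R x \<in> F i}" by auto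
    show "negligible S" unfolding S
      by (rule negligible_cone_contact_aux[OF U e \<eta>, where a = "q powi i"]) (use q \<delta> in \<open>auto simp: F_def q_def\<close>)
  qed auto
  moreover have "{x. x \<noteq> 0 \<and> (\<exists>l>0. l *\<^sub>R x \<in> contact_points U e \<eta> \<delta>)} \<subseteq> (\<Union>i. {x. \<exists>l>0. l *\<^sub>R x \<in> F i})"
  proof clarsimp
    fix x :: 'a and l :: real assume *: "x \<noteq> 0" "0 < l" "l *\<^sub>R x \<in> contact_points U e \<eta> \<delta>"
    define y where "y = l *\<^sub>R x"
    have y: "0 < norm y" using * by (simp add: y_def)
    define i where "i = \<lfloor>log q (norm y)\<rfloor>"
    have "q powr real_of_int i \<le> norm y" "norm y < q powr (real_of_int i + 1)"
      using y q by (simp_all add: i_def le_log_iff[symmetric] log_less_iff[symmetric])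
    then have "y \<in> F i" using * q by (auto simp: F_def y_def powr_add powr_real_of_int' )
    then show "\<exists>i l. 0 < l \<and> l *\<^sub>R x \<in> F i" using * y_def by auto
  qed
  ultimately show ?thesis by (rule negligible_subset)
qed


section \<open>Crossings on a line\<close>

text \<open>
  The complements in \<open>T\<close> of the covering sets have empty intersection; by Baire's theorem one of
  them is not dense in \<open>T\<close>.
\<close>
lemma Baire_closed_cover:
  fixes T :: "real set" and \<F> :: "real set set"
  assumes "closed T" "T \<noteq> {}" "countable \<F>" "\<And>C. C \<in> \<F> \<Longrightarrow> closed C" "T \<subseteq> \<Union>\<F>"
  obtains C W where "C \<in> \<F>" "open W" "T \<inter> W \<noteq> {}" "T \<inter> W \<subseteq> C"
proof (rule ccontr)
  note * = that
  assume "\<not> thesis"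
  then have no: "\<not> T \<inter> W \<subseteq> C" if "C \<in> \<F>" "open W" "T \<inter> W \<noteq> {}" for C W
    using * that by metis
  have "T \<subseteq> closure (\<Inter>((\<lambda>C. T - C) ` \<F>))"
  proof (rule Baire[OF assms(1)])
    show "countable ((\<lambda>C. T - C) ` \<F>)" using assms(3) by simp
    fix D assume "D \<in> (\<lambda>C. T - C) ` \<F>"
    then obtain C where C: "C \<in> \<F>" "D = T - C" by auto
    have "openin (top_of_set T) (T \<inter> (- C))" using assms(4)[OF C(1)] by (auto intro!: openin_open_Int)
    moreover have "T \<subseteq> closure D"
    proof
      fix x assume x: "x \<in> T"
      show "x \<in> closure D" unfolding closure_iff_nhds_not_empty
      proof (intro allI impI)
        fix A V assume "V \<subseteq> A" "open V" "x \<in> V"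
        then show "D \<inter> A \<noteq> {}" using no[OF C(1), of V] x C(2) by blast
      qed
    qed
    ultimately show "openin (top_of_set T) D \<and> T \<subseteq> closure D" using C by (simp add: Diff_eq)
  qed
  moreover have "\<Inter>((\<lambda>C. T - C) ` \<F>) = {}"
  proof -
    have "\<F> \<noteq> {}" using assms(2,5) by auto
    then show ?thesis using assms(5) by blast
  qed
  ultimately show False using assms(2) by simp
qed

definition one_sided_contact :: "real set \<Rightarrow> real set \<Rightarrow> real \<Rightarrow> bool" where
  "one_sided_contact P Q t \<longleftrightarrow> t \<in> P \<and> (\<exists>\<delta>>0. {t<..<t+\<delta>} \<subseteq> Q \<or> {t-\<delta><..<t} \<subseteq> Q)"

text \<open>
  Move from a point \<open>\<tau>\<close> of \<open>T\<close> inside \<open>W\<close> to a nearby point \<open>q\<close> of \<open>Q\<close>, and stop at the last point of the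
  closure of \<open>P\<close>. From there to \<open>q\<close> everything lies in \<open>Q\<close>, so the stopping point is in \<open>T\<close>, hence in \<open>P\<close>.
\<close>
lemma one_sided_contact_near:
  fixes P Q :: "real set"
  assumes PQ: "{a..b} = P \<union> Q" "P \<inter> Q = {}"
    and T: "T = closure P \<inter> closure Q" and W: "open W" "T \<inter> W \<noteq> {}" "T \<inter> W \<subseteq> P"
  obtains t where "one_sided_contact P Q t"
proof -
  obtain \<tau> where \<tau>: "\<tau> \<in> T" "\<tau> \<in> W" using W by auto
  obtain e where e: "0 < e" "ball \<tau> e \<subseteq> W" using W(1) \<tau>(2) by (meson openE)
  have "\<tau> \<in> closure Q" using \<tau> T by auto
  then obtain q where q: "q \<in> Q" "dist q \<tau> < e" using closure_approachable e(1) by blast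
  have seg: "x \<in> W" if "min \<tau> q \<le> x" "x \<le> max \<tau> q" for x
    using that q(2) e(2) by (auto simp: dist_real_def subset_iff)
  have qW: "q \<in> W" by (rule seg) auto
  have qP: "q \<notin> closure P"
    using W(3) qW q(1) PQ(2) T closure_subset[of Q] by blast
  have clP: "\<tau> \<in> closure P" using \<tau> T by auto
  have "P \<subseteq> {a..b}" "Q \<subseteq> {a..b}" unfolding PQ(1) by blast+
  then have sub: "closure P \<subseteq> {a..b}" "closure Q \<subseteq> {a..b}" using closure_minimal closed_atLeastAtMost by blast+
  have q': "q \<in> {a..b}" "\<tau> \<in> {a..b}" using q PQ sub clP by auto
  have inQ: "x \<in> Q" if "a \<le> x" "x \<le> b" "x \<notin> P" for x
  proof -
    have "x \<in> P \<union> Q" unfolding PQ(1)[symmetric] using that by simp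
    then show ?thesis using that by blast
  qed
  show ?thesis
  proof (cases "\<tau> < q")
    case True
    let ?C = "closure P \<inter> {\<tau>..q}"
    define t where "t = Sup ?C"
    have C: "compact ?C" "?C \<noteq> {}" using True clP by (auto intro: closed_Int_compact)
    have t: "t \<in> ?C" unfolding t_def using C compact_imp_closed compact_imp_bounded
      by (intro closed_contains_Sup) (auto intro: bounded_imp_bdd_above)
    have tq: "t < q" using t qP by (cases "t = q") auto
    have sQ: "{t<..<q} \<subseteq> Q"
    proof
      fix x assume x: "x \<in> {t<..<q}"
      have "x \<notin> ?C"
      proof
        assume "x \<in> ?C"
        then have "x \<le> t" unfolding t_def by (intro cSup_upper) (auto simp: C compact_imp_bounded bounded_imp_bdd_above)
        then show False using x by simp
      qed
      then have "x \<notin> P" using x t closure_subset[of P] by auto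
      then show "x \<in> Q" using x q' t by (intro inQ) auto
    qed
    have "t \<in> closure Q"
    proof -
      have "closure {t<..<q} \<subseteq> closure Q" by (rule closure_mono[OF sQ])
      then show ?thesis using tq by auto
    qed
    then have "t \<in> P" using W(3) t seg[of t] T True by auto
    then show ?thesis using sQ tq by (intro that[of t]) (auto simp: one_sided_contact_def intro!: exI[of _ "q - t"])
  next
    case False
    then have True: "q < \<tau>" using qP clP by (cases "q = \<tau>") auto
    let ?C = "closure P \<inter> {q..\<tau>}"
    define t where "t = Inf ?C"
    have C: "compact ?C" "?C \<noteq> {}" using True clP by (auto intro: closed_Int_compact)
    have t: "t \<in> ?C" unfolding t_def using C compact_imp_closed compact_imp_bounded
      by (intro closed_contains_Inf) (auto intro: bounded_imp_bdd_below)
    have tq: "q < t" using t qP by (cases "t = q") auto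
    have sQ: "{q<..<t} \<subseteq> Q"
    proof
      fix x assume x: "x \<in> {q<..<t}"
      have "x \<notin> ?C"
      proof
        assume "x \<in> ?C"
        then have "t \<le> x" unfolding t_def by (intro cInf_lower) (auto simp: C compact_imp_bounded bounded_imp_bdd_below)
        then show False using x by simp
      qed
      then have "x \<notin> P" using x t closure_subset[of P] by auto
      then show "x \<in> Q" using x q' t by (intro inQ) auto
    qed
    have "t \<in> closure Q"
    proof -
      have "closure {q<..<t} \<subseteq> closure Q" by (rule closure_mono[OF sQ])
      then show ?thesis using tq by auto
    qed
    then have "t \<in> P" using W(3) t seg[of t] T True by auto
    then show ?thesis using sQ tq by (intro that[of t]) (auto simp: one_sided_contact_def intro!: exI[of _ "t - q"])
  qed
qed

text \<open>
  The common boundary \<open>T\<close> of \<open>P\<close> and \<open>Q\<close> is nonempty because the interval is connected. By Baire's theorem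
  some nonempty relatively open part of \<open>T\<close> lies in a single one of the closed sets, hence entirely in
  \<open>P\<close> or entirely in \<open>Q\<close>. Merely covering by \<open>P\<close> and \<open>Q\<close> would not do: without the closed pieces both sets
  could be dense.
\<close>
lemma exists_one_sided_contact:
  fixes P Q :: "real set"
  assumes ab: "a \<le> b" and PQ: "{a..b} = P \<union> Q" "P \<inter> Q = {}" "P \<noteq> {}" "Q \<noteq> {}"
    and P: "P = (\<Union>k::nat. Pk k)" "\<And>k. closed (Pk k)"
    and Q: "Q = (\<Union>k::nat. Qk k)" "\<And>k. closed (Qk k)"
  obtains t where "one_sided_contact P Q t \<or> one_sided_contact Q P t"
proof -
  define T where "T = closure P \<inter> closure Q"
  have "T \<noteq> {}"
  proof
    assume "T = {}"
    moreover have "closure P \<union> closure Q = {a..b}" using PQ(1) by (metis closure_Un closure_closed closed_atLeastAtMost)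
    ultimately have "closure P \<inter> {a..b} = {} \<or> closure Q \<inter> {a..b} = {}"
      by (intro connected_closedD[of "{a..b}"]) (auto simp: T_def)
    then show False using PQ closure_subset[of P] closure_subset[of Q] by auto
  qed
  moreover have "T \<subseteq> \<Union>(range Pk \<union> range Qk)"
  proof -
    have "P \<subseteq> {a..b}" unfolding PQ(1) by blast
    then have "T \<subseteq> {a..b}" unfolding T_def using closure_minimal closed_atLeastAtMost by blast
    then show ?thesis using PQ(1) P(1) Q(1) by auto
  qed
  moreover have "closed T" by (simp add: T_def closed_Int)
  moreover have "countable (range Pk \<union> range Qk)" by simp
  moreover have "closed C" if "C \<in> range Pk \<union> range Qk" for C using that P(2) Q(2) by auto
  ultimately obtain C W where *: "C \<in> range Pk \<union> range Qk" "open W" "T \<inter> W \<noteq> {}" "T \<inter> W \<subseteq> C"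
    using Baire_closed_cover[of T "range Pk \<union> range Qk"] by metis
  show ?thesis
  proof (cases "C \<in> range Pk")
    case True
    then have "T \<inter> W \<subseteq> P" using * P(1) by auto
    then obtain t where "one_sided_contact P Q t"
      using one_sided_contact_near[OF PQ(1,2) T_def *(2,3)] by metis
    then show ?thesis by (intro that[of t] disjI1)
  next
    case False
    then have TQ: "T \<inter> W \<subseteq> Q" using * Q(1) by auto
    have eq: "{a..b} = Q \<union> P" "Q \<inter> P = {}" "T = closure Q \<inter> closure P"
      using PQ(1,2) T_def by (simp_all add: Un_commute Int_commute)
    obtain t where "one_sided_contact Q P t"
      using one_sided_contact_near[OF eq *(2,3) TQ] by metis
    then show ?thesis by (intro that[of t] disjI2)
  qed
qed


section \<open>Almost every ray meets the essential boundary\<close>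

abbreviation dens0 :: "'a::euclidean_space set \<Rightarrow> 'a set" where
  "dens0 E \<equiv> {x. has_lebesgue_density_at E 0 x}"

text \<open>
  The tolerance for which rays through contact points are negligible.
\<close>
abbreviation (input) contact_tol :: "'a::euclidean_space itself \<Rightarrow> real" where
  "contact_tol T \<equiv> 1 / (2 * 10 ^ DIM('a))"

lemma thin_points_mono: "\<eta> \<le> \<eta>' \<Longrightarrow> \<delta>' \<le> \<delta> \<Longrightarrow> thin_points U \<eta> \<delta> \<subseteq> thin_points U \<eta>' \<delta>'"
proof
  fix x assume *: "\<eta> \<le> \<eta>'" "\<delta>' \<le> \<delta>" and x: "x \<in> thin_points U \<eta> \<delta>"
  have "measure lebesgue (U \<inter> ball x r) \<le> \<eta>' * measure lebesgue (ball x r)" if r: "0 < r" "r < \<delta>'" for r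
  proof -
    have "measure lebesgue (U \<inter> ball x r) \<le> \<eta> * measure lebesgue (ball x r)" using x r * by (simp add: thin_points_def)
    also have "\<dots> \<le> \<eta>' * measure lebesgue (ball x r)" using * by (intro mult_right_mono) auto
    finally show ?thesis .
  qed
  then show "x \<in> thin_points U \<eta>' \<delta>'" by (simp add: thin_points_def)
qed

lemma compl_sets_lebesgue: "E \<in> sets lebesgue \<Longrightarrow> - E \<in> sets lebesgue"
  using sets.compl_sets[of E lebesgue] by (simp add: Compl_eq_Diff_UNIV)

lemma essential_boundary_eq:
  assumes "E \<in> sets lebesgue"
  shows "essential_boundary E = - (dens0 E \<union> dens0 (- E))"
  by (auto simp: essential_boundary_def density_1_iff_compl[OF assms])

lemma dens0_disjoint: "E \<in> sets lebesgue \<Longrightarrow> dens0 E \<inter> dens0 (- E) = {}"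
proof -
  assume E: "E \<in> sets lebesgue"
  { fix x assume "has_lebesgue_density_at E 0 x" "has_lebesgue_density_at (- E) 0 x"
    then have "has_lebesgue_density_at E 0 x" "has_lebesgue_density_at E 1 x"
      using density_1_iff_compl[OF E] by auto
    then have "(0::real) = 1" unfolding has_lebesgue_density_at_def
      by (rule tendsto_unique[OF trivial_limit_at_right_real])
    then have False by simp }
  then show ?thesis by auto
qed

lemma dens0_compl_AE:
  assumes E: "E \<in> sets lebesgue"
  shows "negligible (dens0 E - (- E))" "negligible (- E - dens0 E)"
proof -
  show "negligible (- E - dens0 E)"
    using negligible_not_density_0[OF E] by (rule negligible_subset) auto
  have "negligible {x. x \<notin> - E \<and> \<not> has_lebesgue_density_at (- E) 0 x}"
    by (intro negligible_not_density_0 compl_sets_lebesgue E)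
  then show "negligible (dens0 E - (- E))"
    by (rule negligible_subset) (use dens0_disjoint[OF E] in auto)
qed

text \<open>
  Up to a null set, the points of density \<open>0\<close> of \<open>E\<close> are the complement of \<open>E\<close>.
\<close>
lemma thin_points_dens0:
  assumes E: "E \<in> sets lebesgue"
  shows "thin_points (dens0 E) \<eta> \<delta> = thin_points (- E) \<eta> \<delta>"
proof -
  have "measure lebesgue (dens0 E \<inter> ball x r) = measure lebesgue (- E \<inter> ball x r)" for x r
  proof (rule measure_negligible_symdiff)
    show "- E \<inter> ball x r \<in> lmeasurable" by (intro lmeasurable_Int_ball compl_sets_lebesgue E)
    show "negligible (- E \<inter> ball x r - dens0 E \<inter> ball x r \<union> (dens0 E \<inter> ball x r - - E \<inter> ball x r))"
      by (rule negligible_subset[OF negligible_Un[OF dens0_compl_AE[OF E]]]) auto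
  qed
  then show ?thesis by (simp add: thin_points_def)
qed

lemma dens0_imp_thin:
  assumes "x \<in> dens0 E" "0 < \<eta>"
  shows "\<exists>k. x \<in> thin_points E \<eta> (1 / real (Suc k))"
proof -
  obtain j where j: "1 / real (Suc j) < \<eta>" using nat_approx_posE[OF assms(2)] by blast
  have "\<exists>k. x \<in> thin_points E (1 / Suc j) (1 / Suc k)" using assms(1) density_0_iff by auto
  then show ?thesis using thin_points_mono[OF less_imp_le[OF j] order_refl] by blast
qed

lemma dens0_compl_not_thin:
  assumes E: "E \<in> sets lebesgue" and x: "x \<in> dens0 (- E)" and \<eta>: "\<eta> < 1 / 2" and \<delta>: "0 < \<delta>"
  shows "x \<notin> thin_points E \<eta> \<delta>"
proof
  assume thin: "x \<in> thin_points E \<eta> \<delta>"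
  obtain k where k: "x \<in> thin_points (- E) (1/2) (1 / real (Suc k))"
    using dens0_imp_thin[OF x, of "1/2"] by auto
  obtain r where r: "0 < r" "r < \<delta>" "r < 1 / real (Suc k)"
    using dense[of 0 "min \<delta> (1 / real (Suc k))"] \<delta> by auto
  have "measure lebesgue (ball x r - E \<inter> ball x r) = measure lebesgue (ball x r) - measure lebesgue (E \<inter> ball x r)"
    using E by (intro measurable_measure_Diff) (auto simp: lmeasurable_Int_ball)
  moreover have "ball x r - E \<inter> ball x r = - E \<inter> ball x r" by auto
  moreover have "measure lebesgue (E \<inter> ball x r) \<le> \<eta> * measure lebesgue (ball x r)"
    using thin r by (simp add: thin_points_def)
  moreover have "measure lebesgue (- E \<inter> ball x r) \<le> 1/2 * measure lebesgue (ball x r)"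
    using k r by (simp add: thin_points_def)
  ultimately have "measure lebesgue (ball x r) * 1 \<le> measure lebesgue (ball x r) * (\<eta> + 1/2)"
    by (simp add: algebra_simps)
  moreover have "0 < measure lebesgue (ball x r)" using r by simp
  ultimately have "1 \<le> \<eta> + 1 / 2" by (subst (asm) mult_le_cancel_left_pos)
  then show False using \<eta> by simp
qed

lemma contact_tol: "0 < contact_tol TYPE('a::euclidean_space)" "contact_tol TYPE('a) < 1 / 2"
proof -
  have "(10::real) ^ 0 < 10 ^ DIM('a)" by (rule power_strict_increasing) auto
  then show "0 < contact_tol TYPE('a)" "contact_tol TYPE('a) < 1 / 2" by (auto simp: field_simps)
qed

lemma one_sided_contact_imp_contact_points:
  fixes E :: "'a::euclidean_space set"
  assumes E: "E \<in> sets lebesgue" and a: "0 < a"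
    and PQ: "one_sided_contact {t \<in> {a..b}. t *\<^sub>R x \<in> dens0 E} {t \<in> {a..b}. t *\<^sub>R x \<in> dens0 (- E)} t"
  shows "\<exists>l>0. \<exists>k. \<exists>e\<in>{1, -1}. l *\<^sub>R x \<in> contact_points (dens0 (- E)) e (contact_tol TYPE('a)) (1 / real (Suc k))"
proof -
  define y where "y = t *\<^sub>R x"
  have t: "0 < t" using PQ a by (auto simp: one_sided_contact_def)
  have y: "y \<in> dens0 E" using PQ by (auto simp: one_sided_contact_def y_def)
  obtain \<delta> where \<delta>: "0 < \<delta>" "{t<..<t+\<delta>} \<subseteq> {t. t *\<^sub>R x \<in> dens0 (- E)} \<or> {t-\<delta><..<t} \<subseteq> {t. t *\<^sub>R x \<in> dens0 (- E)}"
    using PQ unfolding one_sided_contact_def by blast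
  then obtain e :: real where e: "e = 1 \<or> e = -1" and eq: "\<And>s. 0 < s \<Longrightarrow> s < \<delta> \<Longrightarrow> (t + e * s) *\<^sub>R x \<in> dens0 (- E)"
  proof (elim conjE disjE, goal_cases)
    case 1
    show ?thesis by (rule 1(1)[of 1]) (use 1(3) in \<open>auto simp: subset_iff\<close>)
  next
    case 2
    show ?thesis by (rule 2(1)[of "-1"]) (use 2(3) in \<open>auto simp: subset_iff\<close>)
  qed
  obtain k0 where k0: "y \<in> thin_points E (contact_tol TYPE('a)) (1 / real (Suc k0))"
    using dens0_imp_thin[OF y contact_tol(1)] by auto
  obtain k1 where k1: "1 / real (Suc k1) < \<delta> / t" using nat_approx_posE[of "\<delta> / t"] \<delta> t by auto
  define k where "k = max k0 k1"
  have k: "1 / real (Suc k) \<le> 1 / real (Suc k0)" "1 / real (Suc k) \<le> 1 / real (Suc k1)"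
    by (auto simp: k_def intro!: divide_left_mono)
  have "y \<in> thin_points E (contact_tol TYPE('a)) (1 / real (Suc k))"
    using k0 k(1) thin_points_mono[OF order_refl k(1)] by auto
  moreover have "thin_points (dens0 (- E)) (contact_tol TYPE('a)) (1 / real (Suc k)) = thin_points E (contact_tol TYPE('a)) (1 / real (Suc k))"
    using thin_points_dens0[OF compl_sets_lebesgue[OF E]] by simp
  moreover have "(1 + e * s) *\<^sub>R y \<in> dens0 (- E)" if s: "0 < s" "s < 1 / real (Suc k)" for s
  proof -
    have "s < \<delta> / t" using s k k1 by linarith
    then have "s * t < \<delta>" using t by (simp add: field_simps)
    moreover have "(1 + e * s) *\<^sub>R y = (t + e * (s * t)) *\<^sub>R x" by (simp add: y_def algebra_simps)
    moreover have "0 < s * t" using s t by simp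
    ultimately show ?thesis using eq[of "s * t"] by simp
  qed
  ultimately have "y \<in> contact_points (dens0 (- E)) e (contact_tol TYPE('a)) (1 / real (Suc k))"
    by (simp add: contact_points_def)
  then show ?thesis using t e y_def by blast
qed

text \<open>
  Along the ray, the points of density \<open>0\<close> are exactly the points where \<open>E\<close> is thin at some scale, because a
  point of density \<open>1\<close> is never thin; likewise for the complement. So both parts of the segment are
  countable unions of closed sets, and the one-sided contact between them puts \<open>x\<close> into one of countably
  many negligible cones.
\<close>
lemma negligible_rays_mixed:
  fixes E :: "'a::euclidean_space set"
  assumes E: "E \<in> sets lebesgue"
  shows "negligible {x. (\<forall>t. 0 < t \<and> t \<le> 1 \<longrightarrow> t *\<^sub>R x \<in> dens0 E \<union> dens0 (- E)) \<and>
     (\<exists>t. 0 < t \<and> t \<le> 1 \<and> t *\<^sub>R x \<in> dens0 E) \<and> (\<exists>t. 0 < t \<and> t \<le> 1 \<and> t *\<^sub>R x \<in> dens0 (- E))}" (is "negligible ?B")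
proof -
  let ?\<eta> = "contact_tol TYPE('a)"
  define N where "N D e k = {x::'a. x \<noteq> 0 \<and> (\<exists>l>0. l *\<^sub>R x \<in> contact_points (dens0 D) e ?\<eta> (1 / real (Suc k)))}" for D e k
  have mE: "- E \<in> sets lebesgue" by (rule compl_sets_lebesgue[OF E])
  have neg: "negligible (N D e k)" if "D = E \<or> D = - E" "e = 1 \<or> e = -1" for D e k
  proof -
    have "dens0 D \<in> sets lebesgue" using borel_density_0[of D] E mE that(1) by auto
    then show ?thesis unfolding N_def using that(2) by (intro negligible_cone_contact) auto
  qed
  have "negligible (\<Union>(D, e, k) \<in> {E, - E} \<times> {1, -1} \<times> UNIV. N D e k)"
    by (intro negligible_countable_Union) (auto intro!: countable_image neg)
  moreover have "?B \<subseteq> (\<Union>(D, e, k) \<in> {E, - E} \<times> {1, -1} \<times> UNIV. N D e k)"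
  proof
    fix x assume "x \<in> ?B"
    then obtain t0 t1 where x: "\<And>t. 0 < t \<Longrightarrow> t \<le> 1 \<Longrightarrow> t *\<^sub>R x \<in> dens0 E \<union> dens0 (- E)"
      and t0: "0 < t0" "t0 \<le> 1" "t0 *\<^sub>R x \<in> dens0 E" and t1: "0 < t1" "t1 \<le> 1" "t1 *\<^sub>R x \<in> dens0 (- E)" by blast
    have x0: "x \<noteq> 0" using t0(3) t1(3) dens0_disjoint[OF E] by auto
    define a b where "a = min t0 t1" and "b = max t0 t1"
    have ab: "0 < a" "a \<le> b" "b \<le> 1" using t0 t1 by (auto simp: a_def b_def)
    define P where "P D = {t \<in> {a..b}. t *\<^sub>R x \<in> dens0 D}" for D
    have cl: "closed ({t \<in> {a..b}. t *\<^sub>R x \<in> thin_points D ?\<eta> (1 / real (Suc k))})" if "D \<in> sets lebesgue" for D k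
    proof -
      have "closed ({a..b} \<inter> (\<lambda>t. t *\<^sub>R x) -` thin_points D ?\<eta> (1 / real (Suc k)))"
        by (intro closed_Int closed_vimage closed_thin_points that continuous_intros closed_atLeastAtMost)
      moreover have "{a..b} \<inter> (\<lambda>t. t *\<^sub>R x) -` thin_points D ?\<eta> (1 / real (Suc k)) =
         {t \<in> {a..b}. t *\<^sub>R x \<in> thin_points D ?\<eta> (1 / real (Suc k))}" by auto
      ultimately show ?thesis by simp
    qed
    have all: "t *\<^sub>R x \<in> dens0 E \<union> dens0 (- E)" if "t \<in> {a..b}" for t using x[of t] that ab by auto
    have PD: "P D = (\<Union>k. {t \<in> {a..b}. t *\<^sub>R x \<in> thin_points D ?\<eta> (1 / real (Suc k))})"
      if D: "D \<in> sets lebesgue" and allD: "\<And>t. t \<in> {a..b} \<Longrightarrow> t *\<^sub>R x \<in> dens0 D \<union> dens0 (- D)" for D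
    proof (intro equalityI subsetI)
      fix t assume t: "t \<in> P D"
      then have "t *\<^sub>R x \<in> dens0 D" by (simp add: P_def)
      then obtain k where "t *\<^sub>R x \<in> thin_points D ?\<eta> (1 / real (Suc k))"
        using dens0_imp_thin[OF _ contact_tol(1)] by blast
      then show "t \<in> (\<Union>k. {t \<in> {a..b}. t *\<^sub>R x \<in> thin_points D ?\<eta> (1 / real (Suc k))})"
        using t by (auto simp: P_def)
    next
      fix t assume "t \<in> (\<Union>k. {t \<in> {a..b}. t *\<^sub>R x \<in> thin_points D ?\<eta> (1 / real (Suc k))})"
      then obtain k where k: "t \<in> {a..b}" "t *\<^sub>R x \<in> thin_points D ?\<eta> (1 / real (Suc k))" by blast
      have "t *\<^sub>R x \<notin> dens0 (- D)"
        using dens0_compl_not_thin[OF D _ contact_tol(2), of "t *\<^sub>R x" "1 / real (Suc k)"] k(2) by auto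
      then show "t \<in> P D" using allD[OF k(1)] k(1) by (simp add: P_def)
    qed
    have un: "{a..b} = P E \<union> P (- E)"
    proof (intro equalityI subsetI)
      fix t assume "t \<in> {a..b}" then show "t \<in> P E \<union> P (- E)" using all[of t] by (simp add: P_def)
    qed (auto simp: P_def)
    have dis: "P E \<inter> P (- E) = {}" using dens0_disjoint[OF E] unfolding P_def by blast
    have "t0 \<in> P E" "t1 \<in> P (- E)" using t0 t1 by (auto simp: P_def a_def b_def)
    then have ne: "P E \<noteq> {}" "P (- E) \<noteq> {}" by blast+
    have PE': "P (- E) = (\<Union>k. {t \<in> {a..b}. t *\<^sub>R x \<in> thin_points (- E) ?\<eta> (1 / real (Suc k))})"
      by (rule PD[OF mE]) (use all in \<open>simp add: Un_commute disj_commute\<close>)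
    obtain t where "one_sided_contact (P E) (P (- E)) t \<or> one_sided_contact (P (- E)) (P E) t"
      by (rule exists_one_sided_contact[OF ab(2) un dis ne PD[OF E all] cl[OF E] PE' cl[OF mE]])
    then obtain D where D: "D = E \<or> D = - E" "one_sided_contact (P D) (P (- D)) t" by (metis double_complement)
    have "D \<in> sets lebesgue" using D(1) E mE by blast
    from one_sided_contact_imp_contact_points[OF this ab(1) D(2)[unfolded P_def]]
    obtain l k e where "0 < l" "e \<in> {1, -1}" "l *\<^sub>R x \<in> contact_points (dens0 (- D)) e ?\<eta> (1 / real (Suc k))" by blast
    then have "x \<in> N (- D) e k" "(- D, e, k) \<in> {E, - E} \<times> {1, -1} \<times> UNIV" using x0 D(1) unfolding N_def by auto
    then show "x \<in> (\<Union>(D, e, k) \<in> {E, - E} \<times> {1, -1} \<times> UNIV. N D e k)" by (intro UN_I[of "(- D, e, k)"]) auto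
  qed
  ultimately show ?thesis by (rule negligible_subset)
qed

text \<open>
  The same integral as \<^const>\<open>weighted_volume\<close>, taken against \<^const>\<open>lborel\<close>; the exponents
  \<open>p\<close> and \<open>p - 1\<close> are both used below.
\<close>
definition powvol :: "real \<Rightarrow> 'a::euclidean_space set \<Rightarrow> ennreal" where
  "powvol q B = (\<integral>\<^sup>+x\<in>B. ennreal (norm x powr q) \<partial>lborel)"

lemma powvol_scale:
  fixes B :: "'a::euclidean_space set"
  assumes B: "B \<in> sets borel" and t: "0 < t"
  shows "powvol q {x. x /\<^sub>R t \<in> B} = ennreal (t powr (real DIM('a) + q)) * powvol q B"
proof -
  have [measurable]: "{x. x /\<^sub>R t \<in> B} \<in> sets borel"
    using measurable_sets[of "\<lambda>x::'a. x /\<^sub>R t" borel borel B] B by (simp add: vimage_def)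
  note B[measurable]
  have "powvol q {x. x /\<^sub>R t \<in> B} =
     (\<integral>\<^sup>+x. ennreal (norm x powr q) * indicator {x. x /\<^sub>R t \<in> B} x \<partial>density (distr lborel borel (\<lambda>x. 0 + t *\<^sub>R x)) (\<lambda>_. ennreal (\<bar>t\<bar> ^ DIM('a))))"
    unfolding powvol_def using lborel_affine[of t "0::'a"] t by simp
  also have "\<dots> = (\<integral>\<^sup>+x. ennreal (t ^ DIM('a)) * (ennreal (norm (t *\<^sub>R x) powr q) * indicator {x. x /\<^sub>R t \<in> B} (t *\<^sub>R x)) \<partial>lborel)"
    using t by (simp add: nn_integral_density nn_integral_distr)
  also have "\<dots> = (\<integral>\<^sup>+x. ennreal (t powr (real DIM('a) + q)) * (ennreal (norm x powr q) * indicator B x) \<partial>lborel)"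
  proof (intro nn_integral_cong)
    fix x :: 'a
    have "ennreal (t ^ DIM('a)) * ennreal (norm (t *\<^sub>R x) powr q) = ennreal (t powr (real DIM('a) + q)) * ennreal (norm x powr q)"
      using t by (simp add: powr_mult powr_add powr_realpow ennreal_mult'[symmetric] mult_ac)
    moreover have "indicator {x. x /\<^sub>R t \<in> B} (t *\<^sub>R x) = (indicator B x :: ennreal)"
      using t by (simp add: indicator_def)
    ultimately show "ennreal (t ^ DIM('a)) * (ennreal (norm (t *\<^sub>R x) powr q) * indicator {x. x /\<^sub>R t \<in> B} (t *\<^sub>R x)) =
       ennreal (t powr (real DIM('a) + q)) * (ennreal (norm x powr q) * indicator B x)"
      by (simp add: mult.assoc[symmetric])
  qed
  also have "\<dots> = ennreal (t powr (real DIM('a) + q)) * powvol q B"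
    unfolding powvol_def by (intro nn_integral_cmult) measurable
  finally show ?thesis .
qed

lemma weighted_volume_eq_powvol: "weighted_volume p E = powvol p E"
  by (simp add: weighted_volume_def powvol_def nn_integral_completion)

lemma powvol_AE_cong:
  assumes "negligible (A - B)" "negligible (B - A)"
  shows "powvol q A = powvol q B"
proof -
  have "AE x in lebesgue. x \<notin> (A - B) \<union> (B - A)"
    using negligible_Un[OF assms] by (intro AE_not_in) (simp add: negligible_iff_null_sets)
  then have "AE x in lborel. x \<notin> (A - B) \<union> (B - A)" by (simp add: AE_completion_iff)
  then show ?thesis unfolding powvol_def
  proof (intro nn_integral_cong_AE, eventually_elim)
    fix x assume "x \<notin> (A - B) \<union> (B - A)"
    then show "ennreal (norm x powr q) * indicator A x = ennreal (norm x powr q) * indicator B x"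
      by (auto simp: indicator_def)
  qed
qed

lemma powvol_mono: "A \<subseteq> B \<Longrightarrow> powvol q A \<le> powvol q B"
  unfolding powvol_def by (intro nn_integral_mono) (auto simp: indicator_def)

lemma negligible_if_nn_integral_eq_0:
  assumes B: "B \<in> sets lebesgue" and f: "f \<in> borel_measurable lebesgue"
    and pos: "\<And>x. x \<in> B \<Longrightarrow> x \<noteq> 0 \<Longrightarrow> 0 < f x" and 0: "(\<integral>\<^sup>+x\<in>B. f x \<partial>lebesgue) = 0"
  shows "negligible (B :: 'a::euclidean_space set)"
proof -
  have "(\<lambda>x. f x * indicator B x) \<in> borel_measurable lebesgue"
    using f B by (intro borel_measurable_times_ennreal borel_measurable_indicator)
  then have "AE x in lebesgue. f x * indicator B x = 0"
    using 0 by (subst (asm) nn_integral_0_iff_AE)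
  moreover have "AE x in lebesgue. x \<noteq> (0::'a)"
    by (intro AE_completion AE_lborel_singleton)
  ultimately have "AE x in lebesgue. x \<notin> B"
  proof eventually_elim
    fix x assume *: "f x * indicator B x = 0" "x \<noteq> 0"
    show "x \<notin> B" using * pos[of x] by auto
  qed
  then have "B \<in> null_sets lebesgue" using B by (subst (asm) AE_iff_null_sets[symmetric])
  then show ?thesis by (simp add: negligible_iff_null_sets)
qed

lemma measurable_norm_powr: "(\<lambda>x::'a::euclidean_space. ennreal (norm x powr q)) \<in> borel_measurable lebesgue"
  by (rule measurable_completion) measurable

lemma borel_imp_lebesgue: "B \<in> sets borel \<Longrightarrow> B \<in> sets lebesgue"
  using sets_completionI_sets[of B lborel] by simp

lemma powvol_lebesgue: "powvol q B = (\<integral>\<^sup>+x\<in>B. ennreal (norm x powr q) \<partial>lebesgue)"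
  unfolding powvol_def nn_integral_completion ..

lemma powvol_eq_0_imp_negligible:
  assumes "B \<in> sets lebesgue" "powvol q B = 0"
  shows "negligible (B :: 'a::euclidean_space set)"
  by (rule negligible_if_nn_integral_eq_0[OF assms(1) measurable_norm_powr, of q])
     (use assms(2) in \<open>auto simp: powvol_lebesgue\<close>)

text \<open>
  A segment that avoids the boundary and has an end point of density \<open>1\<close> consists of points of density
  \<open>1\<close>, up to negligible exceptions. Let \<open>N\<close> be the set of end points of such segments. Then
  \<open>1/2 N \<subseteq> N\<close>, whereas the weighted volume of \<open>1/2 N\<close> is that of \<open>N\<close> times a factor greater than \<open>1\<close>, since
  \<open>p < - n\<close>. As \<open>N\<close> has finite weighted volume, that volume is \<open>0\<close>.
\<close>
lemma negligible_rays_missing_boundary: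
  fixes E :: "'a::euclidean_space set"
  assumes E: "E \<in> sets lebesgue" and p: "p < - real DIM('a)" and fin: "weighted_volume p E < \<infinity>"
  shows "negligible {x \<in> E. \<forall>t. 0 < t \<and> t \<le> 1 \<longrightarrow> t *\<^sub>R x \<notin> essential_boundary E}"
proof -
  \<comment> \<open>Rational multiples suffice and keep N a Borel set.\<close>
  define N where "N = (\<Inter>t\<in>{t. t \<in> \<rat> \<and> 0 < t \<and> t \<le> 1}. {x. t *\<^sub>R x \<in> dens0 (- E)})"
  have mE: "- E \<in> sets lebesgue" by (rule compl_sets_lebesgue[OF E])
  have N: "N \<in> sets borel" unfolding N_def
  proof (rule sets.countable_INT'')
    show "countable {t::real. t \<in> \<rat> \<and> 0 < t \<and> t \<le> 1}" by (rule countable_subset[OF _ countable_rat]) auto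
    fix t :: real
    show "{x. t *\<^sub>R x \<in> dens0 (- E)} \<in> sets borel"
      using measurable_sets[of "\<lambda>x::'a. t *\<^sub>R x" borel borel, OF _ borel_density_0[OF mE]] by (simp add: vimage_def)
  qed auto
  have "powvol p N \<le> powvol p (dens0 (- E))"
  proof (intro powvol_mono subsetI)
    fix x assume "x \<in> N"
    then have "x \<in> {x. 1 *\<^sub>R x \<in> dens0 (- E)}" unfolding N_def by (rule INT_D) simp
    then show "x \<in> dens0 (- E)" by simp
  qed
  also have "\<dots> = powvol p E" using dens0_compl_AE[OF mE] by (intro powvol_AE_cong) auto
  finally have Nfin: "powvol p N < \<infinity>" using fin by (simp add: weighted_volume_eq_powvol)
  have "{x. x /\<^sub>R (1/2) \<in> N} \<subseteq> N"
  proof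
    fix x :: 'a assume "x \<in> {x. x /\<^sub>R (1/2) \<in> N}"
    then have x: "t *\<^sub>R (2 *\<^sub>R x) \<in> dens0 (- E)" if "t \<in> \<rat>" "0 < t" "t \<le> 1" for t using that by (auto simp: N_def)
    have "t *\<^sub>R x \<in> dens0 (- E)" if "t \<in> \<rat>" "0 < t" "t \<le> 1" for t
      using x[of "t / 2"] that by simp
    then show "x \<in> N" by (auto simp: N_def)
  qed
  then have "powvol p {x. x /\<^sub>R (1/2) \<in> N} \<le> powvol p N" by (rule powvol_mono)
  then have le: "ennreal ((1/2) powr (real DIM('a) + p)) * powvol p N \<le> powvol p N"
    using powvol_scale[OF N, of "1/2" p] by simp
  have gt: "1 < (1/2) powr (real DIM('a) + p)"
    using p powr_less_mono'[of "1/2" "real DIM('a) + p" 0] by simp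
  have "powvol p N = 0"
  proof (rule ccontr)
    assume n0: "powvol p N \<noteq> 0"
    then obtain v where v: "powvol p N = ennreal v" "0 < v"
      using Nfin by (cases "powvol p N") (auto simp: less_le)
    have "ennreal ((1/2) powr (real DIM('a) + p) * v) \<le> ennreal v" using le v by (simp add: ennreal_mult')
    then have "(1/2) powr (real DIM('a) + p) * v \<le> 1 * v" using v by simp
    then show False using gt v by (subst (asm) mult_le_cancel_right_pos) auto
  qed
  then have N0: "negligible N" by (rule powvol_eq_0_imp_negligible[OF borel_imp_lebesgue[OF N]])
  define B where "B = {x. (\<forall>t. 0 < t \<and> t \<le> 1 \<longrightarrow> t *\<^sub>R x \<in> dens0 E \<union> dens0 (- E)) \<and>
     (\<exists>t. 0 < t \<and> t \<le> 1 \<and> t *\<^sub>R x \<in> dens0 E) \<and> (\<exists>t. 0 < t \<and> t \<le> 1 \<and> t *\<^sub>R x \<in> dens0 (- E))}"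
  have "negligible B" unfolding B_def by (rule negligible_rays_mixed[OF E])
  moreover have "negligible (E - dens0 (- E))" using dens0_compl_AE(2)[OF mE] by simp
  ultimately have "negligible (N \<union> (E - dens0 (- E)) \<union> B)" using N0 by (intro negligible_Un)
  moreover have "{x \<in> E. \<forall>t. 0 < t \<and> t \<le> 1 \<longrightarrow> t *\<^sub>R x \<notin> essential_boundary E} \<subseteq> N \<union> (E - dens0 (- E)) \<union> B"
  proof
    fix x assume x: "x \<in> {x \<in> E. \<forall>t. 0 < t \<and> t \<le> 1 \<longrightarrow> t *\<^sub>R x \<notin> essential_boundary E}"
    then have all: "t *\<^sub>R x \<in> dens0 E \<union> dens0 (- E)" if "0 < t" "t \<le> 1" for t
      using that unfolding essential_boundary_eq[OF E] by blast
    show "x \<in> N \<union> (E - dens0 (- E)) \<union> B"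
    proof (cases "x \<in> dens0 (- E) \<and> x \<notin> N")
      case False then show ?thesis using x by blast
    next
      case True
      then obtain t where t: "0 < t" "t \<le> 1" "t *\<^sub>R x \<notin> dens0 (- E)" unfolding N_def by blast
      then have "t *\<^sub>R x \<in> dens0 E" using all by blast
      moreover have "1 *\<^sub>R x \<in> dens0 (- E)" using True by simp
      ultimately have "\<exists>t. 0 < t \<and> t \<le> 1 \<and> t *\<^sub>R x \<in> dens0 E" "\<exists>t. 0 < t \<and> t \<le> 1 \<and> t *\<^sub>R x \<in> dens0 (- E)"
        using t zero_less_one order_refl by blast+
      then show ?thesis using all unfolding B_def by blast
    qed
  qed
  ultimately show ?thesis by (rule negligible_subset)
qed


section \<open>Uniformly distributed measures\<close>

lemma borel_eqI_open_finite:
  fixes M N :: "'a::metric_space measure"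
  assumes M: "sets M = sets borel" and N: "sets N = sets borel"
    and eq: "\<And>U. open U \<Longrightarrow> emeasure M U = emeasure N U"
    and fin: "\<And>U. open U \<Longrightarrow> bounded U \<Longrightarrow> emeasure M U < \<infinity>"
  shows "M = N"
proof (rule measure_eqI_generator_eq)
  define A where "A n = ball (undefined::'a) (real n)" for n :: nat
  let ?E = "{U::'a set. open U}"
  show "Int_stable ?E" by (auto simp: Int_stable_def)
  show "?E \<subseteq> Pow UNIV" by simp
  show "\<And>X. X \<in> ?E \<Longrightarrow> emeasure M X = emeasure N X" using eq by simp
  show "sets M = sigma_sets UNIV ?E" "sets N = sigma_sets UNIV ?E" using M N by (auto simp: sets_borel)
  show "range A \<subseteq> ?E" by (auto simp: A_def)
  show "(\<Union>i. A i) = UNIV" by (auto simp: A_def reals_Archimedean2)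
  show "emeasure M (A i) \<noteq> \<infinity>" for i using fin[of "A i"] by (auto simp: A_def)
qed

text \<open>
  For \<open>x \<in> U\<close> and small radii, \<open>\<nu> (U \<inter> ball x \<rho>) = h\<close>. Hence \<open>\<mu> U\<close> is at most the lower limit of the averages
  \<open>1 / h\<close> times the integral of \<open>\<nu> (U \<inter> ball x \<rho>)\<close> over \<open>\<mu>\<close>, by Fatou's lemma. Exchanging the order of
  integration turns each average into \<open>1 / h\<close> times the integral over \<open>U\<close> of \<open>\<mu> (ball y \<rho>)\<close> with respect
  to \<open>\<nu>\<close>, which the assumption bounds by \<open>c * \<nu> U\<close>.
\<close>
lemma uniformly_distributed_open_le:
  fixes \<mu> \<nu> :: "'a::{second_countable_topology, metric_space} measure"
  assumes sm: "sigma_finite_measure \<mu>" "sigma_finite_measure \<nu>"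
    and sets: "sets \<mu> = sets borel" "sets \<nu> = sets borel"
    and X: "X \<in> sets borel" "AE x in \<mu>. x \<in> X" "AE x in \<nu>. x \<in> X"
    and \<rho>: "\<rho> \<longlonglongrightarrow> (0::real)" and c: "0 \<le> c"
    and h: "\<And>x n. x \<in> X \<Longrightarrow> emeasure \<nu> (ball x (\<rho> n)) = ennreal (h n)" "\<And>n. 0 < h n"
    and g: "\<And>x n. x \<in> X \<Longrightarrow> emeasure \<mu> (ball x (\<rho> n)) \<le> ennreal (c * h n)"
    and U: "open U"
  shows "emeasure \<mu> U \<le> ennreal c * emeasure \<nu> U"
proof -
  interpret A: sigma_finite_measure \<mu> by fact
  interpret B: sigma_finite_measure \<nu> by fact
  interpret AB: pair_sigma_finite \<mu> \<nu> ..
  note sets[measurable_cong]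
  have [measurable]: "U \<in> sets borel" using U by simp
  have D: "{z::'a\<times>'a. dist (fst z) (snd z) < r} \<in> sets (borel \<Otimes>\<^sub>M borel)" for r
  proof -
    have "open {z::'a\<times>'a. dist (fst z) (snd z) < r}" by (intro open_Collect_less continuous_intros)
    then show ?thesis unfolding borel_prod by (rule borel_open)
  qed
  define b where "b n x y = (if dist x y < \<rho> n \<and> y \<in> U then 1 else 0 :: ennreal)" for n and x y :: 'a
  have b_m: "(\<lambda>z. b n (fst z) (snd z)) \<in> borel_measurable (borel \<Otimes>\<^sub>M borel)" for n
  proof -
    have "(\<lambda>z. b n (fst z) (snd z)) = (\<lambda>z. indicator {z::'a\<times>'a. dist (fst z) (snd z) < \<rho> n} z * indicator U (snd z))"
      by (auto simp: b_def indicator_def fun_eq_iff)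
    also have "\<dots> \<in> borel_measurable (borel \<Otimes>\<^sub>M borel)"
      using D by measurable
    finally show ?thesis .
  qed
  have b_m': "case_prod (b n) \<in> borel_measurable (\<mu> \<Otimes>\<^sub>M \<nu>)" for n
    using b_m[of n] sets by (simp add: case_prod_unfold measurable_cong_sets[OF sets_pair_measure_cong[OF sets] refl])
  have bx: "(\<integral>\<^sup>+y. b n x y \<partial>\<nu>) = emeasure \<nu> (ball x (\<rho> n) \<inter> U)" for n x
  proof -
    have "(\<integral>\<^sup>+y. b n x y \<partial>\<nu>) = (\<integral>\<^sup>+y. indicator (ball x (\<rho> n) \<inter> U) y \<partial>\<nu>)"
      by (intro nn_integral_cong) (auto simp: b_def indicator_def)
    then show ?thesis by simp
  qed
  have by': "(\<integral>\<^sup>+x. b n x y \<partial>\<mu>) = emeasure \<mu> (ball y (\<rho> n)) * indicator U y" for n y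
  proof -
    have "(\<integral>\<^sup>+x. b n x y \<partial>\<mu>) = (\<integral>\<^sup>+x. indicator U y * indicator (ball y (\<rho> n)) x \<partial>\<mu>)"
      by (intro nn_integral_cong) (auto simp: b_def indicator_def dist_commute)
    also have "\<dots> = indicator U y * emeasure \<mu> (ball y (\<rho> n))"
      using sets by (intro nn_integral_cmult_indicator) auto
    finally show ?thesis by (simp add: mult.commute)
  qed
  have lim: "1 \<le> liminf (\<lambda>n. ennreal (1 / h n) * (\<integral>\<^sup>+y. b n x y \<partial>\<nu>))" if x: "x \<in> U" "x \<in> X" for x
  proof (rule Liminf_bounded)
    obtain e where e: "0 < e" "ball x e \<subseteq> U" using U x by (meson openE)
    obtain N where N: "\<And>n. N \<le> n \<Longrightarrow> \<rho> n < e"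
      using order_tendstoD(2)[OF \<rho> e(1)] by (auto simp: eventually_sequentially)
    have "1 \<le> ennreal (1 / h n) * (\<integral>\<^sup>+y. b n x y \<partial>\<nu>)" if n: "N \<le> n" for n
    proof -
      have "ball x (\<rho> n) \<inter> U = ball x (\<rho> n)" using e N[OF n] by auto
      then have "(\<integral>\<^sup>+y. b n x y \<partial>\<nu>) = ennreal (h n)" using h(1)[OF x(2)] bx by simp
      then show ?thesis using h(2)[of n] by (simp add: ennreal_mult'[symmetric])
    qed
    then show "\<forall>\<^sub>F n in sequentially. 1 \<le> ennreal (1 / h n) * (\<integral>\<^sup>+y. b n x y \<partial>\<nu>)"
      by (auto simp: eventually_sequentially)
  qed
  have mx: "(\<lambda>x. \<integral>\<^sup>+y. b n x y \<partial>\<nu>) \<in> borel_measurable \<mu>" for n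
    using B.borel_measurable_nn_integral[OF b_m'[of n]] by simp
  have "emeasure \<mu> U = (\<integral>\<^sup>+x. indicator U x \<partial>\<mu>)" by simp
  also have "\<dots> \<le> (\<integral>\<^sup>+x. liminf (\<lambda>n. ennreal (1 / h n) * (\<integral>\<^sup>+y. b n x y \<partial>\<nu>)) \<partial>\<mu>)"
  proof (rule nn_integral_mono_AE)
    show "AE x in \<mu>. indicator U x \<le> liminf (\<lambda>n. ennreal (1 / h n) * (\<integral>\<^sup>+y. b n x y \<partial>\<nu>))"
      using X(2) by eventually_elim (use lim in \<open>auto simp: indicator_def\<close>)
  qed
  also have "\<dots> \<le> liminf (\<lambda>n. \<integral>\<^sup>+x. ennreal (1 / h n) * (\<integral>\<^sup>+y. b n x y \<partial>\<nu>) \<partial>\<mu>)"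
    by (intro nn_integral_liminf borel_measurable_times_ennreal mx) auto
  also have "\<dots> \<le> ennreal c * emeasure \<nu> U"
  proof (intro Liminf_le always_eventually allI)
    fix n
    have "(\<integral>\<^sup>+x. ennreal (1 / h n) * (\<integral>\<^sup>+y. b n x y \<partial>\<nu>) \<partial>\<mu>) = ennreal (1 / h n) * (\<integral>\<^sup>+x. (\<integral>\<^sup>+y. b n x y \<partial>\<nu>) \<partial>\<mu>)"
      by (intro nn_integral_cmult mx)
    also have "(\<integral>\<^sup>+x. (\<integral>\<^sup>+y. b n x y \<partial>\<nu>) \<partial>\<mu>) = (\<integral>\<^sup>+y. (\<integral>\<^sup>+x. b n x y \<partial>\<mu>) \<partial>\<nu>)"
      by (rule AB.Fubini'[OF b_m', symmetric])
    also have "\<dots> \<le> (\<integral>\<^sup>+y. ennreal (c * h n) * indicator U y \<partial>\<nu>)"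
    proof (rule nn_integral_mono_AE)
      show "AE y in \<nu>. (\<integral>\<^sup>+x. b n x y \<partial>\<mu>) \<le> ennreal (c * h n) * indicator U y"
        using X(3) by eventually_elim (simp add: by' g mult_right_mono)
    qed
    also have "\<dots> = ennreal (c * h n) * emeasure \<nu> U" using U sets by (intro nn_integral_cmult_indicator) auto
    finally have "(\<integral>\<^sup>+x. ennreal (1 / h n) * (\<integral>\<^sup>+y. b n x y \<partial>\<nu>) \<partial>\<mu>) \<le> ennreal (1 / h n) * (ennreal (c * h n) * emeasure \<nu> U)"
      by (simp add: mult_left_mono)
    also have "\<dots> = ennreal c * emeasure \<nu> U"
      using c h(2)[of n] by (simp add: mult.assoc[symmetric] ennreal_mult'[symmetric])
    finally show "(\<integral>\<^sup>+x. ennreal (1 / h n) * (\<integral>\<^sup>+y. b n x y \<partial>\<nu>) \<partial>\<mu>) \<le> ennreal c * emeasure \<nu> U" .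
  qed simp
  finally show ?thesis .
qed

lemma ennreal_pos_real: "0 < (x::ennreal) \<Longrightarrow> x \<noteq> top \<Longrightarrow> \<exists>v>0. x = ennreal v"
  by (cases x) auto

text \<open>
  If \<open>g \<le> d * h\<close> held along a sequence of radii, the previous lemma along that sequence would give
  \<open>\<mu> UNIV \<le> d * \<nu> UNIV\<close>, which contradicts \<open>d < c\<close>. Applied in both directions, this says that the ratio of the masses of
  small balls tends to the ratio of the total masses.
\<close>
lemma uniformly_distributed_ratio_lim:
  fixes \<mu> \<nu> :: "'a::{second_countable_topology, metric_space} measure"
  assumes fm: "finite_measure \<mu>" "finite_measure \<nu>"
    and sets: "sets \<mu> = sets borel" "sets \<nu> = sets borel"
    and X: "X \<in> sets borel" "AE x in \<mu>. x \<in> X" "AE x in \<nu>. x \<in> X"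
    and g: "\<And>x n. x \<in> X \<Longrightarrow> emeasure \<mu> (ball x (1 / real (Suc n))) = ennreal (g n)" "\<And>n. 0 < g n"
    and h: "\<And>x n. x \<in> X \<Longrightarrow> emeasure \<nu> (ball x (1 / real (Suc n))) = ennreal (h n)" "\<And>n. 0 < h n"
    and c: "emeasure \<mu> UNIV = ennreal c * emeasure \<nu> UNIV" and N: "emeasure \<nu> UNIV > 0" and d: "0 < d" "d < c"
  shows "eventually (\<lambda>n. d * h n < g n) sequentially"
proof (rule ccontr)
  assume "\<not> ?thesis"
  then have "\<exists>\<^sub>F n in sequentially. g n \<le> d * h n" by (simp add: frequently_def not_le not_less)
  then have inf: "infinite {n. g n \<le> d * h n}" by (simp add: frequently_cofinite[symmetric] cofinite_eq_sequentially)
  define s where "s = enumerate {n. g n \<le> d * h n}"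
  have s: "strict_mono s" "\<And>n. g (s n) \<le> d * h (s n)"
    using strict_mono_enumerate[OF inf] enumerate_in_set[OF inf] by (auto simp: s_def)
  have "emeasure \<mu> UNIV \<le> ennreal d * emeasure \<nu> UNIV"
  proof (rule uniformly_distributed_open_le[OF _ _ sets X, where \<rho> = "\<lambda>n. 1 / real (Suc (s n))" and h = "\<lambda>n. h (s n)"])
    show "sigma_finite_measure \<mu>" "sigma_finite_measure \<nu>"
      using fm by (auto intro: finite_measure.axioms)
    show "(\<lambda>n. 1 / real (Suc (s n))) \<longlonglongrightarrow> 0"
      using LIMSEQ_subseq_LIMSEQ[OF LIMSEQ_Suc[OF lim_1_over_n] s(1)] by (simp add: o_def)
    fix x n assume "x \<in> X"
    then show "emeasure \<mu> (ball x (1 / real (Suc (s n)))) \<le> ennreal (d * h (s n))"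
      using g(1)[of x "s n"] s(2)[of n] by (simp add: ennreal_leI del: of_nat_Suc)
  qed (use h d in \<open>auto simp del: of_nat_Suc\<close>)
  moreover obtain v where v: "emeasure \<nu> UNIV = ennreal v" "0 < v"
    using ennreal_pos_real[OF N] finite_measure.emeasure_finite[OF fm(2), of UNIV] by auto
  ultimately have "ennreal (c * v) \<le> ennreal (d * v)" using c d by (simp add: ennreal_mult')
  then have "c * v \<le> d * v" using d v by simp
  then show False using d v by simp
qed

lemma uniformly_distributed_proportional_le:
  fixes \<mu> \<nu> :: "'a::{second_countable_topology, metric_space} measure"
  assumes fm: "finite_measure \<mu>" "finite_measure \<nu>"
    and sets: "sets \<mu> = sets borel" "sets \<nu> = sets borel"
    and X: "X \<in> sets borel" "AE x in \<mu>. x \<in> X" "AE x in \<nu>. x \<in> X"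
    and g: "\<And>x n. x \<in> X \<Longrightarrow> emeasure \<mu> (ball x (1 / real (Suc n))) = ennreal (g n)" "\<And>n. 0 < g n"
    and h: "\<And>x n. x \<in> X \<Longrightarrow> emeasure \<nu> (ball x (1 / real (Suc n))) = ennreal (h n)" "\<And>n. 0 < h n"
    and c: "0 < c" "emeasure \<nu> UNIV = ennreal (1 / c) * emeasure \<mu> UNIV" and pos: "emeasure \<mu> UNIV > 0"
    and U: "open U"
  shows "emeasure \<mu> U \<le> ennreal c * emeasure \<nu> U"
proof -
  have sf: "sigma_finite_measure \<mu>" "sigma_finite_measure \<nu>"
    using fm by (auto intro: finite_measure.axioms)
  have lim0: "(\<lambda>n. 1 / real (Suc n)) \<longlonglongrightarrow> 0" by (rule LIMSEQ_Suc[OF lim_1_over_n])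
  have *: "emeasure \<mu> U \<le> ennreal d * emeasure \<nu> U" if d: "c < d" for d
  proof -
    have "eventually (\<lambda>n. (1 / d) * g n < h n) sequentially"
      by (rule uniformly_distributed_ratio_lim[OF fm(2,1) sets(2,1) X(1,3,2) h g c(2) pos])
         (use c d in \<open>auto simp: field_simps\<close>)
    then obtain N where N: "\<And>n. N \<le> n \<Longrightarrow> (1 / d) * g n < h n" by (auto simp: eventually_sequentially)
    show ?thesis
    proof (rule uniformly_distributed_open_le[OF sf sets X LIMSEQ_ignore_initial_segment[OF lim0, of N], where h = "\<lambda>n. h (n + N)"])
      fix x n assume "x \<in> X"
      moreover have "g (n + N) \<le> d * h (n + N)" using N[of "n + N"] d c by (simp add: field_simps)
      ultimately show "emeasure \<mu> (ball x (1 / real (Suc (n + N)))) \<le> ennreal (d * h (n + N))"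
        using g(1)[of x "n + N"] by (simp add: ennreal_leI del: of_nat_Suc)
    qed (use h d c U in \<open>auto simp del: of_nat_Suc\<close>)
  qed
  obtain w where w: "emeasure \<nu> U = ennreal w" "0 \<le> w"
    using finite_measure.emeasure_finite[OF fm(2), of U] by (cases "emeasure \<nu> U") auto
  obtain z where z: "emeasure \<mu> U = ennreal z" "0 \<le> z"
    using finite_measure.emeasure_finite[OF fm(1), of U] by (cases "emeasure \<mu> U") auto
  have d: "z \<le> d * w" if d: "c < d" for d
    using *[OF d] w z d c by (simp add: ennreal_mult'[symmetric])
  have "z \<le> c * w"
  proof (rule tendsto_lowerbound)
    show "((\<lambda>d. d * w) \<longlongrightarrow> c * w) (at_right c)" by (intro tendsto_intros)
    show "eventually (\<lambda>d. z \<le> d * w) (at_right c)"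
      using d by (auto simp: eventually_at_right_field intro!: exI[of _ "c + 1"])
  qed simp
  then show ?thesis using w z c by (simp add: ennreal_mult'[symmetric] ennreal_leI)
qed

text \<open>
  Christensen's uniqueness theorem for measures that do not distinguish between balls of the same
  radius.
\<close>
lemma uniformly_distributed_proportional:
  fixes \<mu> \<nu> :: "'a::{second_countable_topology, metric_space} measure"
  assumes fm: "finite_measure \<mu>" "finite_measure \<nu>"
    and sets: "sets \<mu> = sets borel" "sets \<nu> = sets borel"
    and X: "X \<in> sets borel" "AE x in \<mu>. x \<in> X" "AE x in \<nu>. x \<in> X"
    and g: "\<And>x n. x \<in> X \<Longrightarrow> emeasure \<mu> (ball x (1 / real (Suc n))) = ennreal (g n)" "\<And>n. 0 < g n"
    and h: "\<And>x n. x \<in> X \<Longrightarrow> emeasure \<nu> (ball x (1 / real (Suc n))) = ennreal (h n)" "\<And>n. 0 < h n"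
    and pos: "emeasure \<mu> UNIV > 0" "emeasure \<nu> UNIV > 0"
  shows "\<exists>c>0. \<forall>A. emeasure \<mu> A = ennreal c * emeasure \<nu> A"
proof -
  obtain u where u: "emeasure \<mu> UNIV = ennreal u" "0 < u"
    using ennreal_pos_real[OF pos(1)] finite_measure.emeasure_finite[OF fm(1), of UNIV] by auto
  obtain v where v: "emeasure \<nu> UNIV = ennreal v" "0 < v"
    using ennreal_pos_real[OF pos(2)] finite_measure.emeasure_finite[OF fm(2), of UNIV] by auto
  define c where "c = u / v"
  have c: "0 < c" "emeasure \<mu> UNIV = ennreal (1 / (1 / c)) * emeasure \<nu> UNIV" "emeasure \<nu> UNIV = ennreal (1 / c) * emeasure \<mu> UNIV"
    using u v by (simp_all add: c_def ennreal_mult'[symmetric])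
  have le1: "emeasure \<mu> U \<le> ennreal c * emeasure \<nu> U" if "open U" for U
    by (rule uniformly_distributed_proportional_le[OF fm sets X g h c(1,3) pos(1) that])
  have le2: "emeasure \<nu> U \<le> ennreal (1 / c) * emeasure \<mu> U" if "open U" for U
    by (rule uniformly_distributed_proportional_le[OF fm(2,1) sets(2,1) X(1,3,2) h g _ c(2) pos(2) that]) (use c in auto)
  have "\<mu> = scale_measure (ennreal c) \<nu>"
  proof (rule borel_eqI_open_finite)
    fix U :: "'a set" assume U: "open U"
    have "ennreal c * emeasure \<nu> U \<le> ennreal c * (ennreal (1 / c) * emeasure \<mu> U)"
      using le2[OF U] by (rule mult_left_mono) simp
    also have "\<dots> = emeasure \<mu> U" using c(1) by (simp add: mult.assoc[symmetric] ennreal_mult'[symmetric])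
    finally show "emeasure \<mu> U = emeasure (scale_measure (ennreal c) \<nu>) U" using le1[OF U] by simp
    show "emeasure \<mu> U < \<infinity>" using finite_measure.emeasure_finite[OF fm(1), of U] by (simp add: top.not_eq_extremum)
  qed (use sets in auto)
  then have "emeasure \<mu> A = ennreal c * emeasure \<nu> A" for A by (metis emeasure_scale_measure)
  then show ?thesis using c(1) by blast
qed

text \<open>
  Lebesgue measure and its image under an isometry give the same mass to all balls of the same radius.
  It is enough to treat involutions, since reflections already act transitively on spheres.
\<close>
lemma linear_isometry_distr_lborel:
  fixes f :: "'a::euclidean_space \<Rightarrow> 'a"
  assumes f: "linear f" "\<And>x. norm (f x) = norm x" and inv: "\<And>x. f (f x) = x"
  shows "distr lborel borel f = lborel"
proof -
  have cont: "continuous_on UNIV f" using f(1) by (simp add: linear_continuous_on linear_conv_bounded_linear)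
  have m: "f \<in> borel_measurable borel" using cont by (rule borel_measurable_continuous_onI)
  have db: "dist (f x) (f y) = dist x y" for x y
    using f(2)[of "x - y"] linear_diff[OF f(1)] by (simp add: dist_norm)
  have ball: "f -` ball x r = ball (f x) r" for x r
    using db[of x "f y" for y] by (auto simp: inv) 
  have em: "emeasure (distr lborel borel f) (ball x r) = emeasure lborel (ball (f x) r)" for x r
    using m by (simp add: emeasure_distr ball)
  have em': "emeasure lborel (ball x (1 / real (Suc n))) = ennreal (unit_ball_vol (real DIM('a)) * (1 / real (Suc n)) ^ DIM('a))" for x :: 'a and n
    by (subst emeasure_ball) auto
  have pos: "0 < unit_ball_vol (real DIM('a)) * (1 / real (Suc n)) ^ DIM('a)" for n by simp
  have sf: "sigma_finite_measure (distr lborel borel f)"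
  proof
    show "\<exists>A::'a set set. countable A \<and> A \<subseteq> sets (distr lborel borel f) \<and> \<Union>A = space (distr lborel borel f) \<and> (\<forall>a\<in>A. emeasure (distr lborel borel f) a \<noteq> \<infinity>)"
    proof (intro exI[of _ "range (\<lambda>n. ball (0::'a) (real n))"] conjI)
      show "\<Union>(range (\<lambda>n. ball (0::'a) (real n))) = space (distr lborel borel f)" by (auto simp: reals_Archimedean2)
    qed (use em emeasure_lborel_ball_finite in \<open>auto simp: top.not_eq_extremum\<close>)
  qed
  have lim0: "(\<lambda>n. 1 / real (Suc n)) \<longlonglongrightarrow> 0" by (rule LIMSEQ_Suc[OF lim_1_over_n])
  show ?thesis
  proof (rule borel_eqI_open_finite)
    fix U :: "'a set" assume U: "open U"
    have "emeasure (distr lborel borel f) U \<le> ennreal 1 * emeasure lborel U"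
      by (rule uniformly_distributed_open_le[OF sf sigma_finite_lborel _ _ _ _ _ lim0 _ _ pos, where X = UNIV])
         (use U em em' in \<open>auto simp del: of_nat_Suc\<close>)
    moreover have "emeasure lborel U \<le> ennreal 1 * emeasure (distr lborel borel f) U"
      by (rule uniformly_distributed_open_le[OF sigma_finite_lborel sf _ _ _ _ _ lim0 _ _ pos, where X = UNIV])
         (use U em em' in \<open>auto simp del: of_nat_Suc\<close>)
    ultimately show "emeasure (distr lborel borel f) U = emeasure lborel U" by simp
    assume "bounded U"
    then obtain R where "U \<subseteq> ball 0 R" using bounded_subset_ballD by blast
    then have "emeasure (distr lborel borel f) U \<le> emeasure (distr lborel borel f) (ball 0 R)"
      by (intro emeasure_mono) auto
    also have "\<dots> < \<infinity>" using em emeasure_lborel_ball_finite by simp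
    finally show "emeasure (distr lborel borel f) U < \<infinity>" .
  qed auto
qed

text \<open>
  The reflection in the hyperplane orthogonal to \<open>x - y\<close>.
\<close>
lemma reflection_swapping:
  fixes x y :: "'a::euclidean_space"
  assumes "norm x = norm y"
  obtains f where "linear f" "\<And>z. norm (f z) = norm z" "\<And>z. f (f z) = z" "f x = y"
proof (cases "x = y")
  case True
  show ?thesis by (rule that[of id]) (use True in \<open>auto intro: linear_id\<close>)
next
  case False
  define w where "w = x - y"
  have w: "w \<bullet> w \<noteq> 0" using False by (simp add: w_def)
  define f where "f z = z - (2 * (z \<bullet> w) / (w \<bullet> w)) *\<^sub>R w" for z
  have "linear f" by (rule linearI) (simp_all add: f_def algebra_simps add_divide_distrib)
  moreover have n: "f z \<bullet> f z = z \<bullet> z" for z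
    using w by (simp add: f_def inner_diff_left inner_diff_right field_simps inner_commute power2_eq_square)
  moreover have "norm (f z) = norm z" for z using n[of z] by (simp add: norm_eq_sqrt_inner)
  moreover have "f (f z) = z" for z
  proof -
    have "f z \<bullet> w = - (z \<bullet> w)" using w by (simp add: f_def inner_diff_left)
    then have "f (f z) = f z + (2 * (z \<bullet> w) / (w \<bullet> w)) *\<^sub>R w" by (simp add: f_def[of "f z"])
    then show ?thesis by (simp add: f_def)
  qed
  moreover have "f x = y"
  proof -
    have "x \<bullet> x = y \<bullet> y" using assms by (simp add: norm_eq)
    then have "2 * (x \<bullet> w) = w \<bullet> w" by (simp add: w_def inner_diff_left inner_diff_right inner_commute)
    then show ?thesis using w by (simp add: f_def w_def)
  qed
  ultimately show ?thesis using that by blast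
qed


section \<open>Hausdorff measure of the unit sphere\<close>

lemma diameter_leI:
  fixes S :: "'a::real_normed_vector set"
  assumes "\<And>x y. x \<in> S \<Longrightarrow> y \<in> S \<Longrightarrow> dist x y \<le> d" "0 \<le> d"
  shows "bounded S" "diameter S \<le> d"
proof -
  show "diameter S \<le> d" using assms by (intro diameter_le) (auto simp: dist_norm)
  show "bounded S"
  proof (cases "S = {}")
    case False
    then obtain x where "x \<in> S" by auto
    then show ?thesis using assms by (auto simp: bounded_def intro!: exI[of _ x] exI[of _ d])
  qed simp
qed

lemma hausdorff_cost_le:
  assumes "diameter C \<le> D" "bounded C"
  shows "hausdorff_cost d C \<le> ennreal (unit_ball_vol (real d) * (D / 2) ^ d)"
  using assms diameter_ge_0[OF assms(2)]
  by (auto simp: hausdorff_cost_def intro!: ennreal_leI mult_left_mono power_mono)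

lemma hausdorff_pre_lipschitz_image:
  fixes f :: "'a::real_normed_vector \<Rightarrow> 'b::real_normed_vector"
  assumes f: "L-lipschitz_on A f" and L: "0 < L"
  shows "hausdorff_pre d (L * \<delta>) (f ` A) \<le> ennreal (L ^ d) * hausdorff_pre d \<delta> A"
proof -
  have "ennreal (1 / L ^ d) * hausdorff_pre d (L * \<delta>) (f ` A) \<le> (\<Sum>i. hausdorff_cost d (C i))"
    if C: "C \<in> hausdorff_covers \<delta> A" for C
  proof -
    define C' where "C' i = f ` (C i \<inter> A)" for i
    have Cb: "bounded (C i)" "diameter (C i) \<le> \<delta>" for i using C by (auto simp: hausdorff_covers_def)
    have dd: "dist x y \<le> L * diameter (C i)" if xy: "x \<in> C' i" "y \<in> C' i" for x y i
    proof -
      obtain u v where u: "u \<in> C i" "u \<in> A" "x = f u" and v: "v \<in> C i" "v \<in> A" "y = f v"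
        using xy unfolding C'_def by blast
      have "dist x y \<le> L * dist u v" using lipschitz_onD[OF f u(2) v(2)] u v by simp
      also have "dist u v \<le> diameter (C i)" using u v Cb by (intro diameter_bounded_bound)
      finally show ?thesis using L by simp
    qed
    have C'b: "bounded (C' i)" "diameter (C' i) \<le> L * diameter (C i)" for i
      using diameter_leI[OF dd[of _ i]] L diameter_ge_0[OF Cb(1)[of i]] by auto
    have C'd: "diameter (C' i) \<le> L * \<delta>" for i
      using C'b(2)[of i] Cb(2)[of i] L by (meson mult_left_mono order_trans less_imp_le)
    have cov: "f ` A \<subseteq> (\<Union>i. C' i)"
    proof
      fix y assume "y \<in> f ` A"
      then obtain x where x: "x \<in> A" "y = f x" by auto
      then obtain i where "x \<in> C i" using C unfolding hausdorff_covers_def by blast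
      then show "y \<in> (\<Union>i. C' i)" using x by (auto simp: C'_def)
    qed
    have cost: "hausdorff_cost d (C' i) \<le> ennreal (L ^ d) * hausdorff_cost d (C i)" for i
    proof (cases "C' i = {}")
      case False
      then have ne: "C i \<noteq> {}" by (auto simp: C'_def)
      have "hausdorff_cost d (C' i) \<le> ennreal (unit_ball_vol (real d) * ((L * diameter (C i)) / 2) ^ d)"
        by (rule hausdorff_cost_le[OF C'b(2,1)])
      also have "\<dots> = ennreal (L ^ d) * hausdorff_cost d (C i)"
        using ne L diameter_ge_0[OF Cb(1)[of i]]
        by (simp add: hausdorff_cost_def ennreal_mult'[symmetric] power_mult_distrib power_divide)
      finally show ?thesis .
    qed (simp add: hausdorff_cost_def)
    have "C' \<in> hausdorff_covers (L * \<delta>) (f ` A)" using cov C'b(1) C'd by (simp add: hausdorff_covers_def)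
    then have "hausdorff_pre d (L * \<delta>) (f ` A) \<le> (\<Sum>i. hausdorff_cost d (C' i))"
      unfolding hausdorff_pre_def by (rule INF_lower)
    also have "\<dots> \<le> (\<Sum>i. ennreal (L ^ d) * hausdorff_cost d (C i))" by (intro suminf_le cost summableI)
    also have "\<dots> = ennreal (L ^ d) * (\<Sum>i. hausdorff_cost d (C i))" by simp
    finally have "ennreal (1 / L ^ d) * hausdorff_pre d (L * \<delta>) (f ` A)
        \<le> ennreal (1 / L ^ d) * (ennreal (L ^ d) * (\<Sum>i. hausdorff_cost d (C i)))" by (rule mult_left_mono) simp
    also have "\<dots> = (\<Sum>i. hausdorff_cost d (C i))" using L by (simp add: mult.assoc[symmetric] ennreal_mult'[symmetric])
    finally show ?thesis .
  qed
  then have "ennreal (1 / L ^ d) * hausdorff_pre d (L * \<delta>) (f ` A) \<le> hausdorff_pre d \<delta> A"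
    unfolding hausdorff_pre_def[of d \<delta> A] by (rule INF_greatest)
  then have "ennreal (L ^ d) * (ennreal (1 / L ^ d) * hausdorff_pre d (L * \<delta>) (f ` A)) \<le> ennreal (L ^ d) * hausdorff_pre d \<delta> A"
    by (rule mult_left_mono) simp
  then show ?thesis using L by (simp add: mult.assoc[symmetric] ennreal_mult'[symmetric])
qed

lemma hausdorff_outer_lipschitz_image:
  fixes f :: "'a::real_normed_vector \<Rightarrow> 'b::real_normed_vector"
  assumes f: "L-lipschitz_on A f" and L: "0 < L"
  shows "hausdorff_outer d (f ` A) \<le> ennreal (L ^ d) * hausdorff_outer d A"
  unfolding hausdorff_outer_def[of d "f ` A"]
proof (rule SUP_least)
  fix \<delta> :: real assume "\<delta> \<in> {0<..}"
  then have \<delta>: "0 < \<delta>" by simp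
  have "hausdorff_pre d \<delta> (f ` A) = hausdorff_pre d (L * (\<delta> / L)) (f ` A)" using L by simp
  also have "\<dots> \<le> ennreal (L ^ d) * hausdorff_pre d (\<delta> / L) A" by (rule hausdorff_pre_lipschitz_image[OF f L])
  also have "hausdorff_pre d (\<delta> / L) A \<le> hausdorff_outer d A"
    unfolding hausdorff_outer_def using \<delta> L by (intro SUP_upper) simp
  finally show "hausdorff_pre d \<delta> (f ` A) \<le> ennreal (L ^ d) * hausdorff_outer d A" by (simp add: mult_left_mono)
qed

lemma hausdorff_pre_near_optimal:
  assumes "hausdorff_pre d \<delta> A < \<infinity>" "0 < e"
  obtains C where "C \<in> hausdorff_covers \<delta> A" "(\<Sum>i. hausdorff_cost d (C i)) < hausdorff_pre d \<delta> A + ennreal e"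
proof -
  have "hausdorff_pre d \<delta> A < hausdorff_pre d \<delta> A + ennreal e"
    using assms by (cases "hausdorff_pre d \<delta> A") (auto simp flip: ennreal_plus simp: ennreal_less_iff)
  then show ?thesis using that by (subst (asm) hausdorff_pre_def) (auto simp: INF_less_iff)
qed

text \<open>
  Passing from the sets of a cover to their closures does not change the diameters, so the intersection of
  nearly optimal closed covers has the same outer measure.
\<close>
lemma hausdorff_outer_borel_hull:
  fixes A :: "'a::metric_space set"
  obtains B where "B \<in> sets borel" "A \<subseteq> B" "hausdorff_outer d B = hausdorff_outer d A"
proof (cases "hausdorff_outer d A = \<infinity>")
  case True
  then show ?thesis using that[of UNIV] hausdorff_outer_mono[of A UNIV d] by (auto simp: top_unique)
next
  case False
  have pre_le: "hausdorff_pre d (1 / real (Suc m)) A \<le> hausdorff_outer d A" for m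
    unfolding hausdorff_outer_def by (intro SUP_upper) simp
  have "\<exists>C. C \<in> hausdorff_covers (1 / real (Suc m)) A \<and>
      (\<Sum>i. hausdorff_cost d (C i)) \<le> hausdorff_outer d A + ennreal (1 / real (Suc m))" for m
  proof -
    have "hausdorff_pre d (1 / real (Suc m)) A < \<infinity>"
      using pre_le[of m] False by (simp add: top.not_eq_extremum[symmetric] top_unique)
         (metis top_unique)
    then obtain C where "C \<in> hausdorff_covers (1 / real (Suc m)) A"
      "(\<Sum>i. hausdorff_cost d (C i)) < hausdorff_pre d (1 / real (Suc m)) A + ennreal (1 / real (Suc m))"
      using hausdorff_pre_near_optimal[of d "1 / real (Suc m)" A "1 / real (Suc m)"] by auto
    then show ?thesis using pre_le[of m] by (meson add_right_mono less_imp_le order_trans)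
  qed
  then obtain C where C: "\<And>m. C m \<in> hausdorff_covers (1 / real (Suc m)) A"
      "\<And>m. (\<Sum>i. hausdorff_cost d (C m i)) \<le> hausdorff_outer d A + ennreal (1 / real (Suc m))" by metis
  define B where "B = (\<Inter>m. \<Union>i. closure (C m i))"
  have B: "B \<in> sets borel" unfolding B_def by (intro sets.countable_INT'' sets.countable_UN'') auto
  have AB: "A \<subseteq> B"
  proof
    fix x assume x: "x \<in> A"
    have "x \<in> (\<Union>i. closure (C m i))" for m
    proof -
      obtain i where "x \<in> C m i" using C(1)[of m] x unfolding hausdorff_covers_def by blast
      then show ?thesis using closure_subset by blast
    qed
    then show "x \<in> B" by (simp add: B_def)
  qed
  have preB: "hausdorff_pre d (1 / real (Suc m)) B \<le> hausdorff_outer d A + ennreal (1 / real (Suc m))" for m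
  proof -
    have b: "bounded (C m i)" "diameter (C m i) \<le> 1 / real (Suc m)" for i
      using C(1)[of m] by (auto simp: hausdorff_covers_def)
    have "(\<lambda>i. closure (C m i)) \<in> hausdorff_covers (1 / real (Suc m)) B"
      using b by (auto simp: hausdorff_covers_def B_def diameter_closure)
    then have "hausdorff_pre d (1 / real (Suc m)) B \<le> (\<Sum>i. hausdorff_cost d (closure (C m i)))"
      unfolding hausdorff_pre_def by (rule INF_lower)
    also have "\<dots> = (\<Sum>i. hausdorff_cost d (C m i))"
      unfolding hausdorff_cost_def diameter_closure[OF b(1)] by simp
    finally show ?thesis using C(2)[of m] by simp
  qed
  have "hausdorff_outer d B \<le> hausdorff_outer d A"
    unfolding hausdorff_outer_def[of d B]
  proof (rule SUP_least, rule ennreal_le_epsilon)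
    fix \<delta> e :: real assume "\<delta> \<in> {0<..}" "0 < e"
    then have "0 < min \<delta> e" by simp
    then obtain m where m: "1 / real (Suc m) < min \<delta> e" by (rule nat_approx_posE)
    have "hausdorff_pre d \<delta> B \<le> hausdorff_pre d (1 / real (Suc m)) B"
      using m by (intro hausdorff_pre_antimono) simp
    also have "\<dots> \<le> hausdorff_outer d A + ennreal (1 / real (Suc m))" by (rule preB)
    also have "\<dots> \<le> hausdorff_outer d A + ennreal e" using m by (intro add_left_mono ennreal_leI) simp
    finally show "hausdorff_pre d \<delta> B \<le> hausdorff_outer d A + ennreal e" .
  qed
  then show ?thesis using that[OF B AB] hausdorff_outer_mono[OF AB, of d] by (simp add: order_antisym)
qed

lemma power_diff_le_2:
  fixes x y :: real
  assumes "0 \<le> y" "y \<le> x" "x \<le> 2"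
  shows "x ^ n - y ^ n \<le> real n * (x - y) * 2 ^ n"
proof (induction n)
  case (Suc n)
  have "x ^ Suc n - y ^ Suc n = x * (x ^ n - y ^ n) + (x - y) * y ^ n" by (simp add: algebra_simps)
  also have "\<dots> \<le> 2 * (real n * (x - y) * 2 ^ n) + (x - y) * 2 ^ n"
  proof (intro add_mono)
    have "0 \<le> x ^ n - y ^ n" using assms by (simp add: power_mono)
    then show "x * (x ^ n - y ^ n) \<le> 2 * (real n * (x - y) * 2 ^ n)"
      using assms Suc by (intro mult_mono) auto
    have "y ^ n \<le> 2 ^ n" using assms by (intro power_mono) auto
    then show "(x - y) * y ^ n \<le> (x - y) * 2 ^ n" using assms by (intro mult_left_mono) auto
  qed
  also have "\<dots> \<le> real (Suc n) * (x - y) * 2 ^ Suc n"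
    using assms by (simp add: algebra_simps mult_right_mono)
  finally show ?case .
qed simp

text \<open>
  The balls of radius \<open>h\<close> about separated points of the sphere are disjoint and fit into a shell of
  thickness \<open>2 h\<close>, whose volume is of order \<open>h\<close>.
\<close>
lemma card_separated_sphere_le:
  fixes T :: "'a::euclidean_space set"
  assumes T: "finite T" "T \<subseteq> sphere 0 1" and sep: "\<And>x y. x \<in> T \<Longrightarrow> y \<in> T \<Longrightarrow> x \<noteq> y \<Longrightarrow> 2 * h \<le> dist x y"
    and h: "0 < h" "h \<le> 1"
  shows "real (card T) * h ^ (DIM('a) - 1) \<le> real DIM('a) * 2 ^ (DIM('a) + 1)"
proof -
  let ?n = "DIM('a)"
  have dis: "disjoint_family_on (\<lambda>t. ball t h) T"
    unfolding disjoint_family_on_def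
  proof (intro ballI impI)
    fix x y assume xy: "x \<in> T" "y \<in> T" "x \<noteq> y"
    show "ball x h \<inter> ball y h = {}"
    proof (rule ccontr)
      assume "ball x h \<inter> ball y h \<noteq> {}"
      then obtain z where "dist x z < h" "dist y z < h" by auto
      then have "dist x y < 2 * h" using dist_triangle2[of x y z] by simp
      then show False using sep[OF xy] by simp
    qed
  qed
  have "(\<Sum>t\<in>T. measure lebesgue (ball t h)) = measure lebesgue (\<Union>t\<in>T. ball t h)"
    using T dis by (intro measure_UNION'[symmetric]) (auto simp: disjoint_family_on_def pairwise_def disjnt_def)
  also have "\<dots> \<le> measure lebesgue (ball (0::'a) (1 + h) - ball 0 (1 - h))"
  proof (rule measure_mono_fmeasurable)
    show "(\<Union>t\<in>T. ball t h) \<subseteq> ball (0::'a) (1 + h) - ball 0 (1 - h)"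
    proof
      fix z assume "z \<in> (\<Union>t\<in>T. ball t h)"
      then obtain t where t: "t \<in> T" "dist t z < h" by auto
      then have "norm t = 1" using T by auto
      moreover have "\<bar>norm t - norm z\<bar> \<le> dist t z" unfolding dist_norm by (rule norm_triangle_ineq3)
      ultimately show "z \<in> ball 0 (1 + h) - ball 0 (1 - h)" using t(2) by auto
    qed
  qed (use T in auto)
  also have "\<dots> = measure lebesgue (ball (0::'a) (1 + h)) - measure lebesgue (ball (0::'a) (1 - h))"
    using h by (intro measurable_measure_Diff) auto
  also have "\<dots> = unit_ball_vol (real ?n) * ((1 + h) ^ ?n - (1 - h) ^ ?n)"
    using h by (simp add: content_ball right_diff_distrib)
  also have "\<dots> \<le> unit_ball_vol (real ?n) * (real ?n * (2 * h) * 2 ^ ?n)"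
    using power_diff_le_2[of "1 - h" "1 + h" ?n] h by (intro mult_left_mono) auto
  finally have "real (card T) * (unit_ball_vol (real ?n) * h ^ ?n) \<le> unit_ball_vol (real ?n) * (real ?n * (2 * h) * 2 ^ ?n)"
    using h by (simp add: content_ball)
  then have "unit_ball_vol (real ?n) * (real (card T) * h ^ ?n) \<le> unit_ball_vol (real ?n) * (real ?n * (2 * h) * 2 ^ ?n)"
    by (simp add: mult_ac)
  then have "real (card T) * h ^ ?n \<le> real ?n * (2 * h) * 2 ^ ?n"
    by (subst (asm) mult_le_cancel_left_pos) auto
  moreover have "h ^ ?n = h * h ^ (?n - 1)" using DIM_positive[where 'a='a] by (simp add: power_eq_if)
  ultimately have "h * (real (card T) * h ^ (?n - 1)) \<le> h * (real ?n * 2 ^ (?n + 1))" by (simp add: mult_ac)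
  then show ?thesis using h by (subst (asm) mult_le_cancel_left_pos) auto
qed

lemma hausdorff_cover_finite_sum:
  fixes \<C> :: "'a::metric_space set set"
  assumes "finite \<C>" "A \<subseteq> \<Union>\<C>" "\<And>C. C \<in> \<C> \<Longrightarrow> bounded C \<and> diameter C \<le> \<delta>" "0 < \<delta>"
  shows "hausdorff_pre d \<delta> A \<le> (\<Sum>C\<in>\<C>. hausdorff_cost d C)"
proof -
  obtain f where f: "bij_betw f {0..<card \<C>} \<C>" using ex_bij_betw_nat_finite[OF assms(1)] by blast
  define D where "D i = (if i < card \<C> then f i else {})" for i
  have "D \<in> hausdorff_covers \<delta> A"
  proof -
    have "A \<subseteq> (\<Union>i. D i)"
    proof
      fix x assume "x \<in> A"
      then obtain C where "C \<in> \<C>" "x \<in> C" using assms(2) by blast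
      then obtain i where "i < card \<C>" "x \<in> f i" using f unfolding bij_betw_def by (metis atLeastLessThan_iff image_iff)
      then show "x \<in> (\<Union>i. D i)" by (auto simp: D_def intro!: exI[of _ i])
    qed
    moreover have "f i \<in> \<C>" if "i < card \<C>" for i using f that by (auto simp: bij_betw_def)
    ultimately show ?thesis using assms(3,4) by (auto simp: hausdorff_covers_def D_def)
  qed
  then have "hausdorff_pre d \<delta> A \<le> (\<Sum>i. hausdorff_cost d (D i))"
    unfolding hausdorff_pre_def by (rule INF_lower)
  also have "\<dots> = (\<Sum>i\<in>{0..<card \<C>}. hausdorff_cost d (D i))"
    by (intro suminf_finite) (auto simp: D_def hausdorff_cost_def)
  also have "\<dots> = (\<Sum>i\<in>{0..<card \<C>}. hausdorff_cost d (f i))"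
    by (intro sum.cong) (auto simp: D_def)
  also have "\<dots> = (\<Sum>C\<in>\<C>. hausdorff_cost d C)"
    using f by (rule sum.reindex_bij_betw)
  finally show ?thesis .
qed

text \<open>
  A maximal separated subset of the sphere provides a cover by balls, and packing bounds their number.
\<close>
lemma hausdorff_sphere_finite:
  "hausdorff_outer (DIM('a) - 1) (sphere (0::'a::euclidean_space) 1) < \<infinity>"
proof -
  let ?n = "DIM('a)"
  define K where "K = unit_ball_vol (real (?n - 1)) * 2 ^ (?n - 1) * (real ?n * 2 ^ (?n + 1))"
  have small: "hausdorff_pre (?n - 1) (4 * h) (sphere (0::'a) 1) \<le> ennreal K" if h: "0 < h" "h \<le> 1" for h
  proof -
    define P where "P T \<longleftrightarrow> finite T \<and> T \<subseteq> sphere (0::'a) 1 \<and> (\<forall>x\<in>T. \<forall>y\<in>T. x \<noteq> y \<longrightarrow> 2 * h \<le> dist x y)" for T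
    have bd: "card T \<le> nat \<lceil>real ?n * 2 ^ (?n + 1) / h ^ (?n - 1)\<rceil>" if "P T" for T
    proof -
      have "real (card T) * h ^ (?n - 1) \<le> real ?n * 2 ^ (?n + 1)"
        using that h by (intro card_separated_sphere_le) (auto simp: P_def)
      then have "real (card T) \<le> real ?n * 2 ^ (?n + 1) / h ^ (?n - 1)" using h by (simp add: pos_le_divide_eq)
      then show ?thesis by linarith
    qed
    have "P {}" by (simp add: P_def)
    then obtain T where T: "P T" "\<And>T'. P T' \<Longrightarrow> card T' \<le> card T"
      using ex_has_greatest_nat[of P "{}" card "Suc (nat \<lceil>real ?n * 2 ^ (?n + 1) / h ^ (?n - 1)\<rceil>)"] bd by (metis le_imp_less_Suc less_or_eq_imp_le)
    have cov: "sphere 0 1 \<subseteq> (\<Union>t\<in>T. ball t (2 * h))"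
    proof
      fix x :: 'a assume x: "x \<in> sphere 0 1"
      show "x \<in> (\<Union>t\<in>T. ball t (2 * h))"
      proof (rule ccontr)
        assume "x \<notin> (\<Union>t\<in>T. ball t (2 * h))"
        then have far: "2 * h \<le> dist t x" if "t \<in> T" for t using that by (auto simp: not_less)
        then have xT: "x \<notin> T" using h by force
        have "P (insert x T)" using T(1) x far by (auto simp: P_def dist_commute)
        then have "card (insert x T) \<le> card T" by (rule T(2))
        then show False using xT T(1) by (simp add: P_def)
      qed
    qed
    have "hausdorff_pre (?n - 1) (4 * h) (sphere (0::'a) 1) \<le> (\<Sum>C\<in>(\<lambda>t. ball t (2 * h)) ` T. hausdorff_cost (?n - 1) C)"
      using T(1) cov h by (intro hausdorff_cover_finite_sum) (auto simp: P_def diameter_ball)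
    also have "\<dots> \<le> (\<Sum>t\<in>T. hausdorff_cost (?n - 1) (ball t (2 * h)))"
      using sum_image_le[of T "hausdorff_cost (?n - 1)" "\<lambda>t. ball t (2 * h)"] T(1) by (simp add: P_def o_def)
    also have "\<dots> \<le> (\<Sum>t\<in>T. ennreal (unit_ball_vol (real (?n - 1)) * (4 * h / 2) ^ (?n - 1)))"
      using h by (intro sum_mono hausdorff_cost_le) (auto simp: diameter_ball)
    also have "\<dots> = ennreal (real (card T) * (unit_ball_vol (real (?n - 1)) * (2 * h) ^ (?n - 1)))"
      using h by (simp add: ennreal_of_nat_eq_real_of_nat ennreal_mult)
    also have "\<dots> \<le> ennreal K"
    proof (rule ennreal_leI)
      have "real (card T) * (unit_ball_vol (real (?n - 1)) * (2 * h) ^ (?n - 1)) =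
          unit_ball_vol (real (?n - 1)) * 2 ^ (?n - 1) * (real (card T) * h ^ (?n - 1))"
        by (simp add: power_mult_distrib)
      also have "\<dots> \<le> K" unfolding K_def
        using T(1) h by (intro mult_left_mono card_separated_sphere_le) (auto simp: P_def)
      finally show "real (card T) * (unit_ball_vol (real (?n - 1)) * (2 * h) ^ (?n - 1)) \<le> K" .
    qed
    finally show ?thesis .
  qed
  have "hausdorff_outer (?n - 1) (sphere (0::'a) 1) \<le> ennreal K"
    unfolding hausdorff_outer_def
  proof (rule SUP_least)
    fix \<delta> :: real assume "\<delta> \<in> {0<..}"
    then have \<delta>: "0 < \<delta>" by simp
    have "hausdorff_pre (?n - 1) \<delta> (sphere (0::'a) 1) \<le> hausdorff_pre (?n - 1) (4 * min 1 (\<delta> / 4)) (sphere (0::'a) 1)"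
      by (intro hausdorff_pre_antimono) auto
    also have "\<dots> \<le> ennreal K" using \<delta> by (intro small) auto
    finally show "hausdorff_pre (?n - 1) \<delta> (sphere (0::'a) 1) \<le> ennreal K" .
  qed
  then show ?thesis by (simp add: le_less_trans)
qed

text \<open>
  The tube consists of the multiples \<open>t x\<close> with \<open>x \<in> C\<close> and \<open>1 \<le> t \<le> 2\<close>. It is covered by at most \<open>3 / D\<close> balls
  of radius \<open>3 D\<close>, whose centres are spaced by \<open>D\<close> on the ray through one point of \<open>C\<close>.
\<close>
lemma tube_measure_le:
  fixes C :: "'a::euclidean_space set"
  assumes C: "C \<subseteq> sphere 0 1" "\<And>x y. x \<in> C \<Longrightarrow> y \<in> C \<Longrightarrow> dist x y \<le> D" and D: "0 < D" "D \<le> 1"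
  shows "\<exists>T. T \<in> sets borel \<and> (\<forall>x\<in>C. \<forall>t. 1 \<le> t \<and> t \<le> 2 \<longrightarrow> t *\<^sub>R x \<in> T) \<and>
    emeasure lborel T \<le> ennreal (3 * unit_ball_vol (real DIM('a)) * 3 ^ DIM('a) * D ^ (DIM('a) - 1))"
proof (cases "C = {}")
  case True
  then show ?thesis by (intro exI[of _ "{}"]) auto
next
  case False
  then obtain c where c: "c \<in> C" by auto
  define m where "m = nat \<lfloor>1 / D\<rfloor>"
  have m: "real m \<le> 1 / D" "1 / D < real m + 1" using D by (auto simp: m_def)
  define T where "T = (\<Union>j\<in>{0..m}. cball ((1 + real j * D) *\<^sub>R c) (3 * D))"
  have "emeasure lborel T \<le> (\<Sum>j\<in>{0..m}. emeasure lborel (cball ((1 + real j * D) *\<^sub>R c) (3 * D)))"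
    unfolding T_def by (intro emeasure_subadditive_finite) auto
  also have "\<dots> = (\<Sum>j\<in>{0..m}. ennreal (unit_ball_vol (real DIM('a)) * (3 * D) ^ DIM('a)))"
    using D by (simp add: emeasure_cball)
  also have "\<dots> = ennreal (real (Suc m) * (unit_ball_vol (real DIM('a)) * (3 * D) ^ DIM('a)))"
    using D by (simp add: ennreal_of_nat_eq_real_of_nat ennreal_mult del: of_nat_Suc)
  also have "\<dots> \<le> ennreal (3 * unit_ball_vol (real DIM('a)) * 3 ^ DIM('a) * D ^ (DIM('a) - 1))"
  proof (rule ennreal_leI)
    have "real (Suc m) * D \<le> 1 + 1" using m D by (simp add: field_simps)
    then have 1: "real (Suc m) * D \<le> 3" by simp
    have "(3 * D) ^ DIM('a) = 3 ^ DIM('a) * (D * D ^ (DIM('a) - 1))"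
      using DIM_positive[where 'a='a] unfolding power_mult_distrib by (simp add: power_eq_if)
    then have "real (Suc m) * (unit_ball_vol (real DIM('a)) * (3 * D) ^ DIM('a)) =
       (real (Suc m) * D) * (unit_ball_vol (real DIM('a)) * 3 ^ DIM('a) * D ^ (DIM('a) - 1))"
      by (simp only: mult_ac)
    also have "\<dots> \<le> 3 * (unit_ball_vol (real DIM('a)) * 3 ^ DIM('a) * D ^ (DIM('a) - 1))"
      using 1 D by (intro mult_right_mono) auto
    finally show "real (Suc m) * (unit_ball_vol (real DIM('a)) * (3 * D) ^ DIM('a)) \<le> 3 * unit_ball_vol (real DIM('a)) * 3 ^ DIM('a) * D ^ (DIM('a) - 1)"
      by (simp add: mult_ac)
  qed
  finally have le: "emeasure lborel T \<le> ennreal (3 * unit_ball_vol (real DIM('a)) * 3 ^ DIM('a) * D ^ (DIM('a) - 1))" .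
  have "t *\<^sub>R x \<in> T" if x: "x \<in> C" and t: "1 \<le> t" "t \<le> 2" for t x
  proof -
    define j where "j = nat \<lfloor>(t - 1) / D\<rfloor>"
    have j: "real j \<le> (t - 1) / D" "(t - 1) / D < real j + 1" using D t by (auto simp: j_def)
    have jm: "j \<le> m" unfolding j_def m_def using t D by (intro nat_mono floor_mono divide_right_mono) auto
    have jD: "real j * D \<le> t - 1" "t - 1 < real j * D + D" using j D by (simp_all add: field_simps)
    let ?s = "1 + real j * D"
    have s: "1 \<le> ?s" "?s \<le> 2" using jD t D by auto
    have "dist (?s *\<^sub>R c) (t *\<^sub>R x) \<le> dist (?s *\<^sub>R c) (?s *\<^sub>R x) + dist (?s *\<^sub>R x) (t *\<^sub>R x)" by (rule dist_triangle)
    also have "dist (?s *\<^sub>R c) (?s *\<^sub>R x) = ?s * dist c x"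
      using s by (simp add: dist_norm scaleR_diff_right[symmetric])
    also have "dist (?s *\<^sub>R x) (t *\<^sub>R x) = \<bar>?s - t\<bar>"
      using x C(1) by (auto simp: dist_norm scaleR_diff_left[symmetric])
    also have "?s * dist c x \<le> 2 * D" using s C(2)[OF c x] by (intro mult_mono) auto
    finally have "dist (?s *\<^sub>R c) (t *\<^sub>R x) \<le> 3 * D" using jD by simp
    then show ?thesis using jm by (auto simp: T_def intro!: bexI[of _ j])
  qed
  moreover have "T \<in> sets borel" unfolding T_def by (intro sets.finite_UN) auto
  ultimately show ?thesis using le by blast
qed

text \<open>
  Otherwise the sphere has covers of arbitrarily small cost, and the tubes over the sets of such a cover
  would cover the shell \<open>1 \<le> r \<le> 2\<close> with arbitrarily small volume.
\<close>
lemma hausdorff_sphere_pos: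
  assumes n: "DIM('a) \<ge> 2"
  shows "0 < hausdorff_outer (DIM('a) - 1) (sphere (0::'a::euclidean_space) 1)"
proof (rule ccontr)
  let ?d = "DIM('a) - 1"
  assume "\<not> 0 < hausdorff_outer ?d (sphere (0::'a) 1)"
  then have "hausdorff_outer ?d (sphere (0::'a) 1) = 0" by (simp add: zero_less_iff_neq_zero)
  moreover have "hausdorff_pre ?d 1 (sphere (0::'a) 1) \<le> hausdorff_outer ?d (sphere (0::'a) 1)"
    unfolding hausdorff_outer_def by (intro SUP_upper) auto
  ultimately have pre0: "hausdorff_pre ?d 1 (sphere (0::'a) 1) = 0" by simp
  define K where "K = 3 * unit_ball_vol (real DIM('a)) * 3 ^ DIM('a)"
  define \<kappa> where "\<kappa> = unit_ball_vol (real ?d) / 2 ^ ?d"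
  have K: "0 < K" and \<kappa>: "0 < \<kappa>" by (simp_all add: K_def \<kappa>_def)
  define W where "W = cball (0::'a) 2 - ball 0 1"
  have main: "emeasure lborel W \<le> ennreal ((K / \<kappa> + 1) * e)" if e: "0 < e" for e
  proof -
    obtain C where C: "C \<in> hausdorff_covers 1 (sphere (0::'a) 1)" "(\<Sum>i. hausdorff_cost ?d (C i)) < ennreal e"
      using hausdorff_pre_near_optimal[of ?d 1 "sphere (0::'a) 1" e] pre0 e by auto
    have Cb: "bounded (C i)" "diameter (C i) \<le> 1" for i using C(1) by (auto simp: hausdorff_covers_def)
    have "\<exists>T. T \<in> sets borel \<and> (\<forall>x\<in>C i \<inter> sphere 0 1. \<forall>t. 1 \<le> t \<and> t \<le> 2 \<longrightarrow> t *\<^sub>R x \<in> T) \<and>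
       emeasure lborel T \<le> ennreal (K / \<kappa>) * hausdorff_cost ?d (C i) + ennreal (e * (1/2) ^ Suc i)" for i
    proof (cases "C i = {}")
      case True then show ?thesis by (intro exI[of _ "{}"]) auto
    next
      case False
      have dd: "dist x y \<le> diameter (C i)" if "x \<in> C i \<inter> sphere 0 1" "y \<in> C i \<inter> sphere 0 1" for x y
        using that Cb by (intro diameter_bounded_bound) auto
      show ?thesis
      proof (cases "diameter (C i) = 0")
        case d0: True
        \<comment> \<open>A set of diameter 0 costs nothing, but its tube bound needs a positive width.\<close>
        define D where "D = min 1 (e * (1/2) ^ Suc i / K)"
        have D: "0 < D" "D \<le> 1" "K * D \<le> e * (1/2) ^ Suc i" using e K by (auto simp: D_def min_def field_simps)
        have dD: "dist x y \<le> D" if "x \<in> C i \<inter> sphere 0 1" "y \<in> C i \<inter> sphere 0 1" for x y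
          using dd[OF that] d0 D(1) by linarith
        obtain T where T: "T \<in> sets borel" "\<And>t x. x \<in> C i \<inter> sphere 0 1 \<Longrightarrow> 1 \<le> t \<Longrightarrow> t \<le> 2 \<Longrightarrow> t *\<^sub>R x \<in> T"
          "emeasure lborel T \<le> ennreal (3 * unit_ball_vol (real DIM('a)) * 3 ^ DIM('a) * D ^ (DIM('a) - 1))"
          using tube_measure_le[of "C i \<inter> sphere 0 1" D, OF Int_lower2 dD D(1,2)] by blast
        have "D ^ ?d \<le> D ^ 1" using D n by (intro power_decreasing) auto
        then have "K * D ^ ?d \<le> K * D" using K by simp
        then have "ennreal (K * D ^ ?d) \<le> ennreal (e * (1/2) ^ Suc i)" using D(3) by (intro ennreal_leI) simp
        then have "emeasure lborel T \<le> ennreal (e * (1/2) ^ Suc i)" using T(3) unfolding K_def by (rule order_trans[rotated])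
        then show ?thesis using T(1,2) by (intro exI[of _ T]) (auto intro: order_trans)
      next
        case False
        then have D: "0 < diameter (C i)" using diameter_ge_0[OF Cb(1)[of i]] by simp
        obtain T where T: "T \<in> sets borel" "\<And>t x. x \<in> C i \<inter> sphere 0 1 \<Longrightarrow> 1 \<le> t \<Longrightarrow> t \<le> 2 \<Longrightarrow> t *\<^sub>R x \<in> T"
          "emeasure lborel T \<le> ennreal (3 * unit_ball_vol (real DIM('a)) * 3 ^ DIM('a) * diameter (C i) ^ (DIM('a) - 1))"
          using tube_measure_le[of "C i \<inter> sphere 0 1" "diameter (C i)", OF Int_lower2 dd D Cb(2)] by blast
        have "ennreal (K / \<kappa>) * hausdorff_cost ?d (C i) = ennreal (K * diameter (C i) ^ ?d)"
        proof -
          have "hausdorff_cost ?d (C i) = ennreal (\<kappa> * diameter (C i) ^ ?d)"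
            using \<open>C i \<noteq> {}\<close> by (simp add: hausdorff_cost_def \<kappa>_def power_divide)
          then show ?thesis using K \<kappa> by (simp add: ennreal_mult'[symmetric])
        qed
        then have "emeasure lborel T \<le> ennreal (K / \<kappa>) * hausdorff_cost ?d (C i)" using T(3) by (simp add: K_def)
        then show ?thesis using T(1,2) by (intro exI[of _ T]) (auto intro: order_trans)
      qed
    qed
    then obtain T where T: "\<And>i. T i \<in> sets borel" "\<And>i x t. x \<in> C i \<Longrightarrow> x \<in> sphere 0 1 \<Longrightarrow> 1 \<le> t \<Longrightarrow> t \<le> 2 \<Longrightarrow> t *\<^sub>R x \<in> T i"
       "\<And>i. emeasure lborel (T i) \<le> ennreal (K / \<kappa>) * hausdorff_cost ?d (C i) + ennreal (e * (1/2) ^ Suc i)"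
    proof -
      assume *: "\<And>T. (\<And>i. T i \<in> sets borel) \<Longrightarrow>
         (\<And>i x t. x \<in> C i \<Longrightarrow> x \<in> sphere 0 1 \<Longrightarrow> 1 \<le> t \<Longrightarrow> t \<le> 2 \<Longrightarrow> t *\<^sub>R x \<in> T i) \<Longrightarrow>
         (\<And>i. emeasure lborel (T i) \<le> ennreal (K / \<kappa>) * hausdorff_cost ?d (C i) + ennreal (e * (1/2) ^ Suc i)) \<Longrightarrow> thesis"
      assume "\<And>i. \<exists>T. T \<in> sets borel \<and> (\<forall>x\<in>C i \<inter> sphere 0 1. \<forall>t. 1 \<le> t \<and> t \<le> 2 \<longrightarrow> t *\<^sub>R x \<in> T) \<and>
       emeasure lborel T \<le> ennreal (K / \<kappa>) * hausdorff_cost ?d (C i) + ennreal (e * (1/2) ^ Suc i)"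
      then obtain T where "\<forall>i. T i \<in> sets borel \<and> (\<forall>x\<in>C i \<inter> sphere 0 1. \<forall>t. 1 \<le> t \<and> t \<le> 2 \<longrightarrow> t *\<^sub>R x \<in> T i) \<and>
       emeasure lborel (T i) \<le> ennreal (K / \<kappa>) * hausdorff_cost ?d (C i) + ennreal (e * (1/2) ^ Suc i)"
        by metis
      then show thesis by (intro *[of T]) auto
    qed
    have "W \<subseteq> (\<Union>i. T i)"
    proof
      fix w assume "w \<in> W"
      then have w: "1 \<le> norm w" "norm w \<le> 2" by (auto simp: W_def)
      have "norm w \<noteq> 0" using w by linarith
      then have "w /\<^sub>R norm w \<in> sphere 0 1" by simp
      then obtain i where "w /\<^sub>R norm w \<in> C i" using C(1) unfolding hausdorff_covers_def by blast
      then have "norm w *\<^sub>R (w /\<^sub>R norm w) \<in> T i" using T(2) w \<open>w /\<^sub>R norm w \<in> sphere 0 1\<close> by blast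
      moreover have "norm w *\<^sub>R (w /\<^sub>R norm w) = w" using \<open>norm w \<noteq> 0\<close> by simp
      ultimately show "w \<in> (\<Union>i. T i)" by auto
    qed
    then have "emeasure lborel W \<le> emeasure lborel (\<Union>i. T i)" using T(1) by (intro emeasure_mono sets.countable_UN'') auto
    also have "\<dots> \<le> (\<Sum>i. emeasure lborel (T i))" using T(1) by (intro emeasure_subadditive_countably) auto
    also have "\<dots> \<le> (\<Sum>i. ennreal (K / \<kappa>) * hausdorff_cost ?d (C i) + ennreal (e * (1/2) ^ Suc i))"
      by (intro suminf_le T summableI)
    also have "\<dots> = (\<Sum>i. ennreal (K / \<kappa>) * hausdorff_cost ?d (C i)) + (\<Sum>i. ennreal (e * (1/2) ^ Suc i))"
      by (intro suminf_add[symmetric] summableI)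
    also have "(\<Sum>i. ennreal (e * (1/2) ^ Suc i)) = ennreal e"
    proof (rule suminf_ennreal_eq)
      show "(\<lambda>i. e * (1/2) ^ Suc i) sums e" using sums_mult[OF power_half_series, of e] by simp
    qed (use e in auto)
    also have "(\<Sum>i. ennreal (K / \<kappa>) * hausdorff_cost ?d (C i)) = ennreal (K / \<kappa>) * (\<Sum>i. hausdorff_cost ?d (C i))" by simp
    also have "\<dots> \<le> ennreal (K / \<kappa>) * ennreal e" using C(2) by (intro mult_left_mono) auto
    finally have "emeasure lborel W \<le> ennreal (K / \<kappa>) * ennreal e + ennreal e" by (simp add: add_right_mono)
    also have "\<dots> = ennreal ((K / \<kappa> + 1) * e)"
      using K \<kappa> e by (simp add: ennreal_mult'[symmetric] ennreal_plus[symmetric] algebra_simps del: ennreal_plus)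
    finally show ?thesis .
  qed
  have "emeasure lborel W \<le> 0"
  proof (rule ennreal_le_epsilon)
    fix e :: real assume "0 < e"
    have p: "0 < K / \<kappa> + 1" using K \<kappa> by (simp add: add_pos_pos)
    then show "emeasure lborel W \<le> 0 + ennreal e" using main[of "e / (K / \<kappa> + 1)"] \<open>0 < e\<close> by simp
  qed
  obtain b :: 'a where b: "b \<in> Basis" using nonempty_Basis by blast
  have "ball ((3/2) *\<^sub>R b) (1/2) \<subseteq> W"
  proof
    fix z assume "z \<in> ball ((3/2) *\<^sub>R b) (1/2)"
    then have "dist ((3/2) *\<^sub>R b) z < 1/2" by simp
    moreover have "\<bar>norm ((3/2) *\<^sub>R b) - norm z\<bar> \<le> dist ((3/2) *\<^sub>R b) z" unfolding dist_norm by (rule norm_triangle_ineq3)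
    ultimately show "z \<in> W" using b by (auto simp: W_def)
  qed
  then have "emeasure lborel (ball ((3/2) *\<^sub>R b) (1/2)) \<le> emeasure lborel W"
    by (intro emeasure_mono) (auto simp: W_def)
  moreover have "0 < emeasure lborel (ball ((3/2) *\<^sub>R b) (1/2))" by (simp add: emeasure_ball)
  ultimately show False using \<open>emeasure lborel W \<le> 0\<close> by simp
qed


section \<open>The cone measure on the sphere\<close>

lemma powvol_eq_emeasure:
  "B \<in> sets borel \<Longrightarrow> powvol q B = emeasure (density lborel (\<lambda>x. ennreal (norm x powr q))) B"
  unfolding powvol_def by (subst emeasure_density) auto

lemma powvol_UN_le:
  assumes "\<And>i::nat. A i \<in> sets borel"
  shows "powvol q (\<Union>i. A i) \<le> (\<Sum>i. powvol q (A i))"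
  using assms by (simp add: powvol_eq_emeasure sets.countable_UN'' emeasure_subadditive_countably image_subset_iff)

lemma borel_exterior [measurable]: "{x::'a::euclidean_space. R \<le> norm x} \<in> sets borel"
  by measurable

lemma powvol_exterior_eq:
  assumes "0 < R"
  shows "powvol q {x::'a::euclidean_space. R \<le> norm x} = ennreal (R powr (real DIM('a) + q)) * powvol q {x::'a. 1 \<le> norm x}"
proof -
  have "{x::'a. R \<le> norm x} = {x. x /\<^sub>R R \<in> {x. 1 \<le> norm x}}" using assms by (auto simp: field_simps)
  then show ?thesis using powvol_scale[of "{x::'a. 1 \<le> norm x}" R q] assms by simp
qed

text \<open>
  Dyadic shells contribute a geometric series with ratio \<open>2\<close> to the power \<open>n + q\<close>.
\<close>
lemma powvol_exterior_finite:
  assumes q: "q < - real DIM('a)"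
  shows "powvol q {x::'a::euclidean_space. 1 \<le> norm x} < \<infinity>"
proof -
  define A where "A = {x::'a. 1 \<le> norm x \<and> norm x < 2}"
  define \<theta> where "\<theta> = 2 powr (real DIM('a) + q)"
  have \<theta>: "0 < \<theta>" "\<theta> < 1" using q powr_less_mono[of "real DIM('a) + q" 0 2] by (simp_all add: \<theta>_def)
  have A: "A \<in> sets borel" unfolding A_def by measurable
  have Afin: "powvol q A < \<infinity>"
  proof -
    have "powvol q A \<le> (\<integral>\<^sup>+x. indicator (ball 0 2) x \<partial>(lborel::'a measure))"
      unfolding powvol_def
    proof (intro nn_integral_mono)
      fix x :: 'a
      have "norm x powr q \<le> 1" if "1 \<le> norm x"
        using powr_mono[of q 0 "norm x"] q that by (cases "x = 0") auto
      then show "ennreal (norm x powr q) * indicator A x \<le> indicator (ball 0 2) x"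
        by (auto simp: A_def indicator_def ennreal_le_1)
    qed
    also have "\<dots> < \<infinity>" using emeasure_lborel_ball_finite[of "0::'a" 2] by simp
    finally show ?thesis .
  qed
  have "{x::'a. 1 \<le> norm x} \<subseteq> (\<Union>j. {x. x /\<^sub>R (2 ^ j) \<in> A})"
  proof
    fix x :: 'a assume "x \<in> {x. 1 \<le> norm x}"
    then have x: "1 \<le> norm x" by simp
    define j where "j = nat \<lfloor>log 2 (norm x)\<rfloor>"
    have l0: "0 \<le> log 2 (norm x)" by (subst zero_le_log_cancel_iff) (use x in linarith)+
    then have j: "real j \<le> log 2 (norm x)" "log 2 (norm x) < real j + 1" by (auto simp: j_def)
    have x0: "0 < norm x" using x by linarith
    have "2 powr real j \<le> norm x" using j(1) le_log_iff[of 2 "norm x" "real j"] x0 by simp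
    moreover have "norm x < 2 powr (real j + 1)" using j(2) log_less_iff[of 2 "norm x" "real j + 1"] x0 by simp
    ultimately have "2 ^ j \<le> norm x" "norm x < 2 * 2 ^ j" by (simp_all add: powr_realpow powr_add)
    then have "x /\<^sub>R (2 ^ j) \<in> A" by (simp add: A_def field_simps)
    then show "x \<in> (\<Union>j. {x. x /\<^sub>R (2 ^ j) \<in> A})" by blast
  qed
  then have "powvol q {x::'a. 1 \<le> norm x} \<le> powvol q (\<Union>j. {x. x /\<^sub>R (2 ^ j) \<in> A})" by (rule powvol_mono)
  also have "\<dots> \<le> (\<Sum>j. powvol q {x. x /\<^sub>R (2 ^ j) \<in> A})"
  proof (rule powvol_UN_le)
    fix j :: nat
    show "{x. x /\<^sub>R (2 ^ j) \<in> A} \<in> sets borel"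
      using measurable_sets[of "\<lambda>x::'a. x /\<^sub>R 2 ^ j" borel borel A] A by (simp add: vimage_def)
  qed
  also have "\<dots> = (\<Sum>j. ennreal (\<theta> ^ j) * powvol q A)"
  proof (intro suminf_cong)
    fix j :: nat
    have "(2 ^ j) powr (real DIM('a) + q) = \<theta> ^ j"
    proof -
      have "(2 ^ j) powr (real DIM('a) + q) = (2 powr real j) powr (real DIM('a) + q)" by (simp add: powr_realpow)
      also have "\<dots> = \<theta> powr real j" unfolding \<theta>_def powr_powr by (simp only: mult.commute)
      also have "\<dots> = \<theta> ^ j" using \<theta> by (simp add: powr_realpow)
      finally show ?thesis .
    qed
    then show "powvol q {x. x /\<^sub>R (2 ^ j) \<in> A} = ennreal (\<theta> ^ j) * powvol q A"
      using powvol_scale[OF A, of "2 ^ j" q] by simp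
  qed
  also have "\<dots> = (\<Sum>j. ennreal (\<theta> ^ j)) * powvol q A" by simp
  also have "(\<Sum>j. ennreal (\<theta> ^ j)) = ennreal (1 / (1 - \<theta>))"
    using \<theta> by (intro suminf_ennreal_eq geometric_sums) auto
  also have "ennreal (1 / (1 - \<theta>)) * powvol q A < \<infinity>" using Afin by (simp add: ennreal_mult_less_top)
  finally show ?thesis .
qed

lemma powvol_exterior_pos: "0 < powvol q {x::'a::euclidean_space. 1 \<le> norm x}"
proof (rule ccontr)
  assume "\<not> ?thesis"
  then have "powvol q {x::'a. 1 \<le> norm x} = 0" by (simp add: zero_less_iff_neq_zero)
  then have "negligible {x::'a. 1 \<le> norm x}" by (intro powvol_eq_0_imp_negligible borel_imp_lebesgue borel_exterior)
  moreover obtain b :: 'a where b: "b \<in> Basis" using nonempty_Basis by blast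
  have "ball (2 *\<^sub>R b) 1 \<subseteq> {x::'a. 1 \<le> norm x}"
  proof
    fix z assume "z \<in> ball (2 *\<^sub>R b) 1"
    then have "dist (2 *\<^sub>R b) z < 1" by simp
    moreover have "\<bar>norm (2 *\<^sub>R b) - norm z\<bar> \<le> dist (2 *\<^sub>R b) z" unfolding dist_norm by (rule norm_triangle_ineq3)
    ultimately show "z \<in> {x. 1 \<le> norm x}" using b by auto
  qed
  ultimately have "negligible (ball (2 *\<^sub>R b) 1)" using negligible_subset by blast
  then show False by (simp add: open_not_negligible)
qed

lemma powvol_isometry:
  fixes f :: "'a::euclidean_space \<Rightarrow> 'a"
  assumes f: "linear f" "\<And>x. norm (f x) = norm x" and inv: "\<And>x. f (f x) = x" and B: "B \<in> sets borel"
  shows "powvol q (f -` B) = powvol q B"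
proof -
  have "continuous_on UNIV f" using f(1) by (simp add: linear_continuous_on linear_conv_bounded_linear)
  then have m[measurable]: "f \<in> borel_measurable borel" by (rule borel_measurable_continuous_onI)
  note B[measurable]
  have "powvol q B = (\<integral>\<^sup>+x. ennreal (norm x powr q) * indicator B x \<partial>distr lborel borel f)"
    unfolding powvol_def by (simp add: linear_isometry_distr_lborel[OF f inv])
  also have "\<dots> = (\<integral>\<^sup>+x. ennreal (norm (f x) powr q) * indicator B (f x) \<partial>lborel)"
    by (intro nn_integral_distr) auto
  also have "\<dots> = powvol q (f -` B)"
    unfolding powvol_def by (intro nn_integral_cong) (simp add: f(2) indicator_def)
  finally show ?thesis ..
qed

text \<open>
  For \<open>q < - n\<close> the map \<open>B \<mapsto> powvol q (solid_cone B)\<close> is a finite rotation-invariant measure on the unit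
  sphere. The weight is integrable far out but not near the origin, so the cone is truncated from below.
\<close>
definition solid_cone :: "'a::euclidean_space set \<Rightarrow> 'a set" where
  "solid_cone B = {x. 1 \<le> norm x \<and> x /\<^sub>R norm x \<in> B}"

lemma solid_cone_borel: "B \<in> sets borel \<Longrightarrow> solid_cone B \<in> sets borel"
proof -
  assume [measurable]: "B \<in> sets borel"
  show ?thesis unfolding solid_cone_def by measurable
qed

lemma solid_cone_sphere:
  "solid_cone (sphere 0 1) = {x::'a::euclidean_space. 1 \<le> norm x}"
  "solid_cone (- sphere 0 1) = ({}::'a set)"
proof -
  have "x /\<^sub>R norm x \<in> sphere 0 1" if "1 \<le> norm x" for x :: 'a
  proof -
    have "norm x \<noteq> 0" using that by linarith
    then show ?thesis by simp
  qed
  then show "solid_cone (sphere 0 1) = {x::'a. 1 \<le> norm x}" "solid_cone (- sphere 0 1) = ({}::'a set)"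
    unfolding solid_cone_def by blast+
qed

text \<open>
  By compactness finitely many balls of radius \<open>r\<close> cover the sphere, and they all have the same mass.
\<close>
lemma ball_pos_of_sphere_pos:
  fixes \<mu> :: "'a::euclidean_space measure"
  assumes s: "sets \<mu> = sets borel" and S: "0 < emeasure \<mu> (sphere 0 1)"
    and eq: "\<And>x y. x \<in> sphere 0 1 \<Longrightarrow> y \<in> sphere 0 1 \<Longrightarrow> emeasure \<mu> (ball x r) = emeasure \<mu> (ball y r)"
    and x: "x \<in> sphere 0 1" and r: "0 < r"
  shows "0 < emeasure \<mu> (ball x r)"
proof (rule ccontr)
  assume "\<not> ?thesis"
  then have z: "emeasure \<mu> (ball y r) = 0" if "y \<in> sphere 0 1" for y
    using eq[OF that x] by (simp add: zero_less_iff_neq_zero)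
  obtain T where T: "finite T" "T \<subseteq> sphere 0 1" "sphere (0::'a) 1 \<subseteq> (\<Union>y\<in>T. ball y r)"
  proof -
    assume *: "\<And>T. finite T \<Longrightarrow> T \<subseteq> sphere 0 1 \<Longrightarrow> sphere (0::'a) 1 \<subseteq> (\<Union>y\<in>T. ball y r) \<Longrightarrow> thesis"
    have "sphere (0::'a) 1 \<subseteq> (\<Union>y\<in>sphere 0 1. ball y r)"
    proof
      fix y :: 'a assume "y \<in> sphere 0 1"
      then show "y \<in> (\<Union>y\<in>sphere 0 1. ball y r)" using r by (intro UN_I[of y]) simp_all
    qed
    then obtain T where "T \<subseteq> sphere 0 1" "finite T" "sphere (0::'a) 1 \<subseteq> (\<Union>y\<in>T. ball y r)"
      by (rule compactE_image[OF compact_sphere[of "0::'a" 1] open_ball])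
    then show thesis using *[of T] by blast
  qed
  have "emeasure \<mu> (sphere 0 1) \<le> emeasure \<mu> (\<Union>y\<in>T. ball y r)"
    using T s by (intro emeasure_mono sets.finite_UN) auto
  also have "\<dots> \<le> (\<Sum>y\<in>T. emeasure \<mu> (ball y r))" using T s by (intro emeasure_subadditive_finite) auto
  also have "\<dots> = 0" using T z by (intro sum.neutral) auto
  finally show False using S by simp
qed

text \<open>
  Both sides are finite, nonzero and invariant under the reflections that exchange two points of the
  sphere, so they give equal mass to balls of equal radius centred on the sphere.
\<close>
lemma sphere_measure_proportional:
  assumes n: "DIM('a) \<ge> 2" and q: "q < - real DIM('a)"
  obtains c where "0 < c"
    "\<And>B. B \<in> sets borel \<Longrightarrow> B \<subseteq> sphere (0::'a::euclidean_space) 1 \<Longrightarrow>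
       hausdorff_outer (DIM('a) - 1) B = ennreal c * powvol q (solid_cone B)"
proof -
  let ?d = "DIM('a) - 1"
  let ?S = "sphere (0::'a) 1"
  have Sb: "?S \<in> sets borel" by (intro borel_closed) simp
  define \<mu> where "\<mu> = density (hausdorff_measure ?d) (indicator ?S)"
  define \<nu> where "\<nu> = distr (density lborel (\<lambda>x::'a. ennreal (norm x powr q) * indicator {x. 1 \<le> norm x} x)) borel (\<lambda>x. x /\<^sub>R norm x)"
  have sets: "sets \<mu> = sets borel" "sets \<nu> = sets borel" by (simp_all add: \<mu>_def \<nu>_def)
  have em: "emeasure \<mu> B = hausdorff_outer ?d (B \<inter> ?S)" if "B \<in> sets borel" for B
  proof -
    have "emeasure \<mu> B = (\<integral>\<^sup>+x. indicator ?S x * indicator B x \<partial>hausdorff_measure ?d)"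
      unfolding \<mu>_def using that Sb by (intro emeasure_density borel_measurable_indicator) (simp_all only: sets_hausdorff_measure)
    also have "\<dots> = (\<integral>\<^sup>+x. indicator (B \<inter> ?S) x \<partial>hausdorff_measure ?d)"
      by (intro nn_integral_cong) (auto simp: indicator_def)
    also have "\<dots> = hausdorff_outer ?d (B \<inter> ?S)"
      using that Sb by (subst nn_integral_indicator) (auto simp: emeasure_hausdorff_measure)
    finally show ?thesis .
  qed
  have en: "emeasure \<nu> B = powvol q (solid_cone B)" if B: "B \<in> sets borel" for B
  proof -
    note B[measurable]
    have [measurable]: "{x::'a. x /\<^sub>R norm x \<in> B} \<in> sets borel" by measurable
    have "emeasure \<nu> B = emeasure (density lborel (\<lambda>x::'a. ennreal (norm x powr q) * indicator {x. 1 \<le> norm x} x)) {x. x /\<^sub>R norm x \<in> B}"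
      unfolding \<nu>_def by (subst emeasure_distr) (auto simp: vimage_def)
    also have "\<dots> = (\<integral>\<^sup>+x. ennreal (norm x powr q) * indicator {x. 1 \<le> norm x} x * indicator {x. x /\<^sub>R norm x \<in> B} x \<partial>lborel)"
      by (intro emeasure_density) auto
    also have "\<dots> = powvol q (solid_cone B)"
      unfolding powvol_def solid_cone_def by (intro nn_integral_cong) (auto simp: indicator_def)
    finally show ?thesis .
  qed
  have inv: "emeasure \<mu> (ball x r) = emeasure \<mu> (ball y r) \<and> emeasure \<nu> (ball x r) = emeasure \<nu> (ball y r)"
    if x: "x \<in> ?S" and y: "y \<in> ?S" for x y r
  proof -
    obtain f where f: "linear f" "\<And>z. norm (f z) = norm z" "\<And>z. f (f z) = z" "f x = y"
      using reflection_swapping[of x y] x y by auto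
    have fd: "dist (f u) (f v) = dist u v" for u v
      using f(2)[of "u - v"] linear_diff[OF f(1)] by (simp add: dist_norm)
    have le: "hausdorff_outer ?d (f ` A) \<le> hausdorff_outer ?d A" for A
      using hausdorff_outer_lipschitz_image[of 1 A f ?d] fd by (auto simp: lipschitz_on_def)
    have img: "f ` (ball x r \<inter> ?S) = ball y r \<inter> ?S"
    proof (intro equalityI subsetI)
      fix z assume "z \<in> f ` (ball x r \<inter> ?S)"
      then obtain u where u: "u \<in> ball x r" "u \<in> ?S" "z = f u" by blast
      have "dist y z = dist x u" using fd[of x u] u(3) f(4) by simp
      then show "z \<in> ball y r \<inter> ?S" using u f(2)[of u] by simp
    next
      fix z assume z: "z \<in> ball y r \<inter> ?S"
      have "dist x (f z) = dist y z" using fd[of x "f z"] f(4) f(3)[of z] by simp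
      then have "f z \<in> ball x r \<inter> ?S" using z f(2)[of z] by simp
      then have "f (f z) \<in> f ` (ball x r \<inter> ?S)" by (rule imageI)
      then show "z \<in> f ` (ball x r \<inter> ?S)" using f(3)[of z] by simp
    qed
    have "hausdorff_outer ?d (ball y r \<inter> ?S) \<le> hausdorff_outer ?d (ball x r \<inter> ?S)" using le[of "ball x r \<inter> ?S"] img by simp
    moreover have "f ` (ball y r \<inter> ?S) = ball x r \<inter> ?S" unfolding img[symmetric] image_image f(3) by simp
    then have "hausdorff_outer ?d (ball x r \<inter> ?S) \<le> hausdorff_outer ?d (ball y r \<inter> ?S)" using le[of "ball y r \<inter> ?S"] by simp
    ultimately have 1: "emeasure \<mu> (ball x r) = emeasure \<mu> (ball y r)" by (simp add: em)
    have "f -` solid_cone (ball y r) = solid_cone (ball x r)"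
    proof -
      have "f z /\<^sub>R norm (f z) \<in> ball y r \<longleftrightarrow> z /\<^sub>R norm z \<in> ball x r" for z
        using fd[of x "z /\<^sub>R norm z"] f(4) linear_scale[OF f(1), of "inverse (norm z)" z] f(2)[of z] by simp
      then show ?thesis by (simp add: solid_cone_def vimage_def f(2))
    qed
    then have "powvol q (solid_cone (ball x r)) = powvol q (solid_cone (ball y r))"
      using powvol_isometry[OF f(1-3) solid_cone_borel[of "ball y r"]] by simp
    then show ?thesis using 1 by (simp add: en)
  qed
  have fin: "emeasure \<mu> UNIV < \<infinity>" "emeasure \<nu> UNIV < \<infinity>"
    using hausdorff_sphere_finite[where 'a='a] powvol_exterior_finite[OF q] em[of UNIV] en[of UNIV]
    by (simp_all add: solid_cone_def)
  have fm: "finite_measure \<mu>" "finite_measure \<nu>"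
    using fin by (auto intro!: finite_measureI simp: \<mu>_def \<nu>_def)
  have posS: "0 < emeasure \<mu> ?S" "0 < emeasure \<nu> ?S"
  proof -
    show "0 < emeasure \<mu> ?S" using hausdorff_sphere_pos[OF n] em[OF Sb] by simp
    show "0 < emeasure \<nu> ?S" using en[OF Sb] solid_cone_sphere(1)[where 'a='a] powvol_exterior_pos[of q, where 'a='a] by simp
  qed
  have pos: "0 < emeasure \<mu> UNIV" "0 < emeasure \<nu> UNIV"
    using posS emeasure_mono[of ?S UNIV \<mu>] emeasure_mono[of ?S UNIV \<nu>] sets by (auto intro: less_le_trans)
  have AE: "AE x in \<mu>. x \<in> ?S" "AE x in \<nu>. x \<in> ?S"
  proof -
    have c: "- ?S \<in> sets borel" using Sb by (intro borel_comp)
    have "- ?S \<in> null_sets \<mu>" "- ?S \<in> null_sets \<nu>"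
      using em[OF c] en[OF c] c sets unfolding solid_cone_sphere by (auto simp: null_sets_def powvol_def)
    from this[THEN AE_not_in] show "AE x in \<mu>. x \<in> ?S" "AE x in \<nu>. x \<in> ?S" by simp_all
  qed
  obtain x0 :: 'a where "x0 \<in> Basis" using nonempty_Basis by blast
  then have x0: "x0 \<in> ?S" by simp
  have *: "emeasure \<mu> (ball x (1 / real (Suc n))) = ennreal (measure \<mu> (ball x0 (1 / real (Suc n))))"
       "emeasure \<nu> (ball x (1 / real (Suc n))) = ennreal (measure \<nu> (ball x0 (1 / real (Suc n))))"
       if "x \<in> ?S" for x n
    using inv[OF that x0] fm by (simp_all add: finite_measure.emeasure_eq_measure)
  have r: "0 < 1 / real (Suc n)" for n by simp
  have "0 < emeasure \<mu> (ball x0 (1 / real (Suc n)))" "0 < emeasure \<nu> (ball x0 (1 / real (Suc n)))" for n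
    using ball_pos_of_sphere_pos[OF sets(1) posS(1) inv[THEN conjunct1] x0 r]
      ball_pos_of_sphere_pos[OF sets(2) posS(2) inv[THEN conjunct2] x0 r] by simp_all
  then have **: "0 < measure \<mu> (ball x0 (1 / real (Suc n)))" "0 < measure \<nu> (ball x0 (1 / real (Suc n)))" for n
    using fm by (simp_all add: finite_measure.emeasure_eq_measure del: of_nat_Suc)
  obtain c where c: "0 < c" "\<And>A. emeasure \<mu> A = ennreal c * emeasure \<nu> A"
    using uniformly_distributed_proportional[OF fm sets Sb AE *(1) **(1) *(2) **(2) pos] by blast
  show ?thesis
  proof (rule that[OF c(1)])
    fix B assume B: "B \<in> sets borel" "B \<subseteq> ?S"
    then have "B \<inter> ?S = B" by blast
    then show "hausdorff_outer ?d B = ennreal c * powvol q (solid_cone B)" using c(2)[of B] em[OF B(1)] en[OF B(1)] by simp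
  qed
qed


section \<open>Bounds for the weighted perimeter\<close>

text \<open>
  The constant \<open>1 / a\<close> is sharp, as the perimeter bound requires: with \<open>w\<close> the cosine of the angle between
  \<open>x\<close> and \<open>y\<close>, the squared distances are \<open>2 - 2 w\<close> and at least \<open>2 |x| |y| (1 - w)\<close>.
\<close>
lemma radial_projection_lipschitz:
  fixes x y :: "'a::real_inner"
  assumes a: "0 < a" and x: "a \<le> norm x" and y: "a \<le> norm y"
  shows "dist (x /\<^sub>R norm x) (y /\<^sub>R norm y) \<le> (1 / a) * dist x y"
proof -
  define u v where "u = norm x" and "v = norm y"
  have u: "a \<le> u" "0 < u" and v: "a \<le> v" "0 < v" using a x y by (auto simp: u_def v_def)
  have xx: "x \<bullet> x = u\<^sup>2" "y \<bullet> y = v\<^sup>2" by (simp_all add: u_def v_def power2_norm_eq_inner)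
  define w where "w = (x \<bullet> y) / (u * v)"
  have w: "x \<bullet> y = u * v * w" using u v by (simp add: w_def)
  have "x \<bullet> y \<le> u * v" unfolding u_def v_def by (rule norm_cauchy_schwarz)
  then have w1: "w \<le> 1" using u v by (simp add: w_def)
  have "(x /\<^sub>R u - y /\<^sub>R v) \<bullet> (x /\<^sub>R u - y /\<^sub>R v) = (x \<bullet> x) / u\<^sup>2 + (y \<bullet> y) / v\<^sup>2 - 2 * w"
    using u v by (simp add: w_def inner_diff_left inner_diff_right inner_commute[of y x] field_simps power2_eq_square)
  then have "(norm (x /\<^sub>R u - y /\<^sub>R v))\<^sup>2 = 2 - 2 * w"
    using u v by (simp add: power2_norm_eq_inner xx)
  moreover have "(norm (x - y))\<^sup>2 = u\<^sup>2 + v\<^sup>2 - 2 * (u * v * w)"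
    by (simp add: power2_norm_eq_inner inner_diff_left inner_diff_right xx w inner_commute[of y x])
  moreover have "a\<^sup>2 * (2 - 2 * w) \<le> u\<^sup>2 + v\<^sup>2 - 2 * (u * v * w)"
  proof -
    have "a\<^sup>2 \<le> u * v" unfolding power2_eq_square using u v a by (intro mult_mono) auto
    then have "a\<^sup>2 * (2 - 2 * w) \<le> (u * v) * (2 - 2 * w)" using w1 by (intro mult_right_mono) auto
    also have "\<dots> \<le> u\<^sup>2 + v\<^sup>2 - 2 * (u * v * w)"
      using zero_le_power2[of "u - v"] by (simp add: power2_eq_square algebra_simps)
    finally show ?thesis .
  qed
  ultimately have "(a * norm (x /\<^sub>R u - y /\<^sub>R v))\<^sup>2 \<le> (norm (x - y))\<^sup>2"
    by (simp add: power_mult_distrib)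
  then have "a * norm (x /\<^sub>R u - y /\<^sub>R v) \<le> norm (x - y)" by (rule power2_le_imp_le) simp
  then show ?thesis using a by (simp add: dist_norm u_def v_def field_simps)
qed

text \<open>
  The set \<open>A\<close> is the cone over the radial projection of \<open>M\<close>, cut off at distance \<open>a\<close>, with a Borel hull in
  place of the projection. Scaling contributes the power \<open>n + q\<close> of \<open>a\<close>, and the projection
  contributes the power \<open>- (n - 1)\<close>.
\<close>
lemma radial_projection_solid_cone_le:
  assumes n: "DIM('a) \<ge> 2" and a: "0 < a"
    and c: "\<And>B. B \<in> sets borel \<Longrightarrow> B \<subseteq> sphere (0::'a::euclidean_space) 1 \<Longrightarrow>
       hausdorff_outer (DIM('a) - 1) B = ennreal c * powvol q (solid_cone B)"
    and M: "M \<subseteq> {x::'a. a \<le> norm x}"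
  shows "\<exists>A. A \<in> sets borel \<and> (\<forall>x t. t *\<^sub>R x \<in> M \<longrightarrow> 0 < t \<longrightarrow> t \<le> 1 \<longrightarrow> x \<in> A) \<and>
    ennreal c * powvol q A \<le> ennreal (a powr (q + 1)) * hausdorff_outer (DIM('a) - 1) M"
proof -
  let ?d = "DIM('a) - 1"
  let ?\<pi> = "\<lambda>x::'a. x /\<^sub>R norm x"
  have "(1 / a)-lipschitz_on M ?\<pi>"
    using M a by (intro lipschitz_onI radial_projection_lipschitz) auto
  then have le: "hausdorff_outer ?d (?\<pi> ` M) \<le> ennreal ((1 / a) ^ ?d) * hausdorff_outer ?d M"
    using a by (intro hausdorff_outer_lipschitz_image) auto
  obtain B0 where B0: "B0 \<in> sets borel" "?\<pi> ` M \<subseteq> B0" "hausdorff_outer ?d B0 = hausdorff_outer ?d (?\<pi> ` M)"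
    by (rule hausdorff_outer_borel_hull)
  define B where "B = B0 \<inter> sphere 0 1"
  have Bb: "B \<in> sets borel" unfolding B_def by (rule sets.Int[OF B0(1) borel_closed]) simp
  have BM: "?\<pi> ` M \<subseteq> B"
  proof
    fix y assume "y \<in> ?\<pi> ` M"
    then obtain x where x: "x \<in> M" "y = ?\<pi> x" by blast
    have "norm x \<noteq> 0" using M x a by auto
    then have "y \<in> sphere 0 1" using x by simp
    then show "y \<in> B" using B0(2) x unfolding B_def by blast
  qed
  define A where "A = {x. x /\<^sub>R a \<in> solid_cone B}"
  have Ab: "A \<in> sets borel"
    using measurable_sets[of "\<lambda>x::'a. x /\<^sub>R a" borel borel "solid_cone B"] solid_cone_borel[OF Bb] by (simp add: vimage_def A_def)
  have mem: "x \<in> A" if x: "t *\<^sub>R x \<in> M" "0 < t" "t \<le> 1" for x t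
  proof -
    have tx: "a \<le> t * norm x" using M x by auto
    then have "a \<le> norm x" using x(3) mult_right_le_one_le[of "norm x" t] by (simp add: mult.commute mult_left_le_one_le x(2) less_imp_le order_trans)
    have x0: "x \<noteq> 0" using tx a by auto
    have tB: "?\<pi> (t *\<^sub>R x) \<in> B" using BM x(1) by blast
    have "?\<pi> (t *\<^sub>R x) = ?\<pi> x" "?\<pi> (x /\<^sub>R a) = ?\<pi> x" using x(2) x0 a by simp_all
    then have "?\<pi> (x /\<^sub>R a) \<in> B" using tB by (simp only:)
    moreover have "1 \<le> norm (x /\<^sub>R a)" using \<open>a \<le> norm x\<close> a by (simp add: field_simps)
    ultimately show ?thesis unfolding A_def solid_cone_def by blast
  qed
  have "ennreal c * powvol q A = ennreal (a powr (real DIM('a) + q)) * (ennreal c * powvol q (solid_cone B))"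
    unfolding A_def powvol_scale[OF solid_cone_borel[OF Bb] a] by (simp add: mult.left_commute)
  also have "\<dots> = ennreal (a powr (real DIM('a) + q)) * hausdorff_outer ?d B"
    using c[OF Bb] by (simp add: B_def)
  also have "\<dots> \<le> ennreal (a powr (real DIM('a) + q)) * (ennreal ((1 / a) ^ ?d) * hausdorff_outer ?d M)"
    using le hausdorff_outer_mono[of B B0 ?d] B0(3) by (intro mult_left_mono) (auto simp: B_def)
  also have "\<dots> = ennreal (a powr (q + 1)) * hausdorff_outer ?d M"
  proof -
    have "a powr (real DIM('a) + q) * (1 / a) ^ ?d = a powr (q + 1)"
    proof -
      have "(1 / a) ^ ?d = a powr (- real ?d)" by (simp only: powr_minus power_one_over inverse_eq_divide powr_realpow[OF a])
      then show ?thesis using a n by (simp add: powr_add[symmetric] of_nat_diff)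
    qed
    then show ?thesis using a by (simp add: mult.assoc[symmetric] ennreal_mult'[symmetric])
  qed
  finally show ?thesis using Ab mem by (intro exI[of _ A] conjI) blast+
qed

lemma borel_essential_boundary: "E \<in> sets lebesgue \<Longrightarrow> essential_boundary E \<in> sets borel"
  unfolding essential_boundary_eq
  by (intro borel_comp sets.Un borel_density_0 compl_sets_lebesgue)

text \<open>
  Slice the boundary into the shells \<open>a \<le> r < a q\<close>, where \<open>a\<close> runs through the integer powers of \<open>q\<close>. Almost
  every point of \<open>E\<close> lies in the truncated cone over one of the slices. On a slice the density \<open>r\<^sup>p\<close> varies
  by a factor of at most \<open>q powr (- p)\<close>.
\<close>
lemma weighted_perimeter_ge_scaled:
  assumes n: "DIM('a) \<ge> 2" and p: "p < - real DIM('a)" and q: "1 < q"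
    and c: "\<And>B. B \<in> sets borel \<Longrightarrow> B \<subseteq> sphere (0::'a::euclidean_space) 1 \<Longrightarrow>
       hausdorff_outer (DIM('a) - 1) B = ennreal c * powvol (p - 1) (solid_cone B)"
    and E: "E \<in> sets lebesgue" and fin: "weighted_volume p (E::'a set) < \<infinity>"
  shows "ennreal c * powvol (p - 1) E \<le> ennreal (q powr (- p)) * weighted_perimeter p E"
proof -
  let ?d = "DIM('a) - 1" and ?M = "essential_boundary E"
  define a where "a j = q powr real_of_int (int_decode j)" for j
  have a: "0 < a j" for j using q by (simp add: a_def)
  define M where "M j = ?M \<inter> {x. a j \<le> norm x \<and> norm x < a j * q}" for j
  have Mb[measurable]: "M j \<in> sets borel" for j
    unfolding M_def by (intro sets.Int borel_essential_boundary[OF E]) measurable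
  have "\<exists>A. A \<in> sets borel \<and> (\<forall>x t. t *\<^sub>R x \<in> M j \<longrightarrow> 0 < t \<longrightarrow> t \<le> 1 \<longrightarrow> x \<in> A) \<and>
    ennreal c * powvol (p - 1) A \<le> ennreal (a j powr p) * hausdorff_outer ?d (M j)" for j
  proof -
    have "M j \<subseteq> {x. a j \<le> norm x}" by (auto simp: M_def)
    from radial_projection_solid_cone_le[OF n a c this] show ?thesis by simp
  qed
  then obtain A where A: "\<And>j. A j \<in> sets borel" "\<And>j x t. t *\<^sub>R x \<in> M j \<Longrightarrow> 0 < t \<Longrightarrow> t \<le> 1 \<Longrightarrow> x \<in> A j"
    "\<And>j. ennreal c * powvol (p - 1) (A j) \<le> ennreal (a j powr p) * hausdorff_outer ?d (M j)" by metis
  have Mj: "x \<in> (\<Union>j. M j)" if "x \<in> ?M" "x \<noteq> 0" for x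
  proof -
    define i where "i = \<lfloor>log q (norm x)\<rfloor>"
    have "q powr real_of_int i \<le> norm x" "norm x < q powr (real_of_int i + 1)"
      using that(2) q by (simp_all add: i_def le_log_iff[symmetric] log_less_iff[symmetric])
    then have "x \<in> M (int_encode i)" using that q by (simp add: M_def a_def powr_add)
    then show ?thesis by blast
  qed
  have "negligible (insert 0 {x \<in> E. \<forall>t. 0 < t \<and> t \<le> 1 \<longrightarrow> t *\<^sub>R x \<notin> ?M})"
    using negligible_rays_missing_boundary[OF E p fin] by (simp add: negligible_insert)
  moreover have "E - (\<Union>j. A j) \<subseteq> insert 0 {x \<in> E. \<forall>t. 0 < t \<and> t \<le> 1 \<longrightarrow> t *\<^sub>R x \<notin> ?M}"
  proof
    fix x assume x: "x \<in> E - (\<Union>j. A j)"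
    have "t *\<^sub>R x \<notin> ?M" if t: "0 < t" "t \<le> 1" and "x \<noteq> 0" for t
    proof
      assume "t *\<^sub>R x \<in> ?M"
      then obtain j where "t *\<^sub>R x \<in> M j" using Mj[of "t *\<^sub>R x"] t \<open>x \<noteq> 0\<close> by auto
      then show False using A(2) t x by blast
    qed
    then show "x \<in> insert 0 {x \<in> E. \<forall>t. 0 < t \<and> t \<le> 1 \<longrightarrow> t *\<^sub>R x \<notin> ?M}" using x by blast
  qed
  ultimately have neg: "negligible (E - (\<Union>j. A j))" by (rule negligible_subset)
  have eq: "E - E \<inter> (\<Union>j. A j) = E - (\<Union>j. A j)" "E \<inter> (\<Union>j. A j) - E = {}" by auto
  have "powvol (p - 1) E = powvol (p - 1) (E \<inter> (\<Union>j. A j))"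
    by (rule powvol_AE_cong) (simp_all only: eq neg negligible_empty)
  also have "\<dots> \<le> powvol (p - 1) (\<Union>j. A j)" by (rule powvol_mono) auto
  also have "\<dots> \<le> (\<Sum>j. powvol (p - 1) (A j))" by (rule powvol_UN_le[OF A(1)])
  finally have "ennreal c * powvol (p - 1) E \<le> ennreal c * (\<Sum>j. powvol (p - 1) (A j))" by (rule mult_left_mono) simp
  also have "\<dots> = (\<Sum>j. ennreal c * powvol (p - 1) (A j))" by simp
  also have "\<dots> \<le> (\<Sum>j. ennreal (q powr (- p)) * (\<integral>\<^sup>+x\<in>M j. ennreal (norm x powr p) \<partial>hausdorff_measure ?d))"
  proof (intro suminf_le summableI)
    fix j
    have "ennreal ((a j * q) powr p) * hausdorff_outer ?d (M j) = (\<integral>\<^sup>+x. ennreal ((a j * q) powr p) * indicator (M j) x \<partial>hausdorff_measure ?d)"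
      by (subst nn_integral_cmult_indicator) (simp_all add: emeasure_hausdorff_measure)
    also have "\<dots> \<le> (\<integral>\<^sup>+x\<in>M j. ennreal (norm x powr p) \<partial>hausdorff_measure ?d)"
    proof (intro nn_integral_mono)
      fix x :: 'a
      have "(a j * q) powr p \<le> norm x powr p" if "x \<in> M j"
      proof -
        have "0 < norm x" using that a[of j] by (auto simp: M_def)
        then show ?thesis using that p by (intro powr_mono2') (auto simp: M_def)
      qed
      then show "ennreal ((a j * q) powr p) * indicator (M j) x \<le> ennreal (norm x powr p) * indicator (M j) x"
        by (auto simp: indicator_def intro: ennreal_leI)
    qed
    finally have le: "ennreal ((a j * q) powr p) * hausdorff_outer ?d (M j) \<le> (\<integral>\<^sup>+x\<in>M j. ennreal (norm x powr p) \<partial>hausdorff_measure ?d)" .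
    have "ennreal (a j powr p) = ennreal (q powr (- p)) * ennreal ((a j * q) powr p)"
      using a[of j] q by (simp add: ennreal_mult'[symmetric] powr_mult powr_minus)
    then have "ennreal c * powvol (p - 1) (A j) \<le> ennreal (q powr (- p)) * (ennreal ((a j * q) powr p) * hausdorff_outer ?d (M j))"
      using A(3)[of j] by (simp add: mult.assoc)
    also have "\<dots> \<le> ennreal (q powr (- p)) * (\<integral>\<^sup>+x\<in>M j. ennreal (norm x powr p) \<partial>hausdorff_measure ?d)"
      using le by (rule mult_left_mono) simp
    finally show "ennreal c * powvol (p - 1) (A j) \<le> ennreal (q powr (- p)) * (\<integral>\<^sup>+x\<in>M j. ennreal (norm x powr p) \<partial>hausdorff_measure ?d)" .
  qed
  also have "\<dots> = ennreal (q powr (- p)) * (\<Sum>j. \<integral>\<^sup>+x\<in>M j. ennreal (norm x powr p) \<partial>hausdorff_measure ?d)" by simp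
  also have "(\<Sum>j. \<integral>\<^sup>+x\<in>M j. ennreal (norm x powr p) \<partial>hausdorff_measure ?d) = (\<integral>\<^sup>+x. (\<Sum>j. ennreal (norm x powr p) * indicator (M j) x) \<partial>hausdorff_measure ?d)"
    by (rule nn_integral_suminf[symmetric]) (simp add: Mb)
  also have "\<dots> \<le> weighted_perimeter p E"
    unfolding weighted_perimeter_def
  proof (intro nn_integral_mono)
    fix x :: 'a
    have dis: "disjoint_family M"
      unfolding disjoint_family_on_def
    proof (intro ballI impI)
      fix i j :: nat assume ij: "i \<noteq> j"
      show "M i \<inter> M j = {}"
      proof (rule ccontr)
        assume "M i \<inter> M j \<noteq> {}"
        then obtain y where "y \<in> M i" "y \<in> M j" by blast
        then have y: "a i \<le> norm y" "norm y < a i * q" "a j \<le> norm y" "norm y < a j * q" by (auto simp: M_def)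
        then have "a i < a j * q" "a j < a i * q" by linarith+
        then have "q powr real_of_int (int_decode i) < q powr (real_of_int (int_decode j) + 1)"
          "q powr real_of_int (int_decode j) < q powr (real_of_int (int_decode i) + 1)"
          using q by (simp_all add: a_def powr_add)
        then have "int_decode i < int_decode j + 1" "int_decode j < int_decode i + 1" using q by simp_all
        then have "int_decode i = int_decode j" by simp
        then show False using ij by (metis int_decode_inverse)
      qed
    qed
    have "(\<Sum>j. ennreal (norm x powr p) * indicator (M j) x) = ennreal (norm x powr p) * indicator (\<Union>j. M j) x"
      using suminf_indicator[OF dis, of x] by simp
    also have "\<dots> \<le> ennreal (norm x powr p) * indicator ?M x"
      by (intro mult_left_mono) (auto simp: M_def indicator_def)
    finally show "(\<Sum>j. ennreal (norm x powr p) * indicator (M j) x) \<le> ennreal (norm x powr p) * indicator ?M x" .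
  qed
  finally show ?thesis by (simp add: mult_left_mono)
qed

lemma weighted_perimeter_ge:
  assumes n: "DIM('a) \<ge> 2" and p: "p < - real DIM('a)"
    and c: "\<And>B. B \<in> sets borel \<Longrightarrow> B \<subseteq> sphere (0::'a::euclidean_space) 1 \<Longrightarrow>
       hausdorff_outer (DIM('a) - 1) B = ennreal c * powvol (p - 1) (solid_cone B)"
    and E: "E \<in> sets lebesgue" and fin: "weighted_volume p (E::'a set) < \<infinity>"
  shows "ennreal c * powvol (p - 1) E \<le> weighted_perimeter p E"
proof (cases "weighted_perimeter p E")
  case (real P)
  have le: "ennreal c * powvol (p - 1) E \<le> ennreal (q powr (- p) * P)" if q: "1 < q" for q
    using weighted_perimeter_ge_scaled[OF n p q c E fin] real by (simp add: ennreal_mult')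
  have "ennreal c * powvol (p - 1) E \<le> ennreal (2 powr (- p) * P)" by (rule le) simp
  also have "\<dots> < \<infinity>" by simp
  finally have "ennreal c * powvol (p - 1) E < \<infinity>" .
  then obtain X where X: "ennreal c * powvol (p - 1) E = ennreal X" "0 \<le> X" by (cases "ennreal c * powvol (p - 1) E") auto
  have "X \<le> 1 powr (- p) * P"
  proof (rule tendsto_lowerbound)
    show "((\<lambda>q. q powr (- p) * P) \<longlongrightarrow> 1 powr (- p) * P) (at_right 1)" by (intro tendsto_intros) auto
    have "X \<le> q powr (- p) * P" if "1 < q" for q
      using le[OF that] X real that by (simp add: ennreal_le_iff)
    then show "eventually (\<lambda>q. X \<le> q powr (- p) * P) (at_right 1)"
      by (auto simp: eventually_at_right_field intro!: exI[of _ 2])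
  qed simp
  then show ?thesis using X real by (simp add: ennreal_leI)
qed simp

lemma density_0_of_disjoint_ball:
  assumes "0 < \<delta>" "U \<inter> ball x \<delta> = {}"
  shows "has_lebesgue_density_at U 0 x"
proof -
  obtain k where k: "1 / real (Suc k) < \<delta>" using nat_approx_posE[OF assms(1)] by blast
  have "U \<inter> ball x r = {}" if "r < 1 / real (Suc k)" for r
    using assms(2) that k subset_ball[of r \<delta> x] by auto
  then have "x \<in> thin_points U (1 / Suc j) (1 / Suc k)" for j by (simp add: thin_points_def)
  then show ?thesis using density_0_iff by blast
qed

lemma essential_boundary_exterior:
  "essential_boundary (- ball (0::'a::euclidean_space) R) \<subseteq> sphere 0 R"
proof
  fix x :: 'a assume "x \<in> essential_boundary (- ball 0 R)"
  then have x: "x \<notin> dens0 (- ball 0 R)" "x \<notin> dens0 (ball 0 R)"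
    using essential_boundary_eq[OF compl_sets_lebesgue[of "ball (0::'a) R"]] by auto
  have far: "\<bar>norm x - norm y\<bar> \<le> dist x y" for y unfolding dist_norm by (rule norm_triangle_ineq3)
  show "x \<in> sphere 0 R"
  proof (rule ccontr)
    assume "x \<notin> sphere 0 R"
    then consider "norm x < R" | "R < norm x" by force
    then show False
    proof cases
      case 1
      have "- ball 0 R \<inter> ball x (R - norm x) = {}"
      proof (intro equals0I)
        fix y assume "y \<in> - ball 0 R \<inter> ball x (R - norm x)"
        then have "R \<le> norm y" "dist x y < R - norm x" by auto
        then show False using far[of y] by linarith
      qed
      from density_0_of_disjoint_ball[OF _ this] show False using 1 x(1) by simp
    next
      case 2
      have "ball 0 R \<inter> ball x (norm x - R) = {}"
      proof (intro equals0I)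
        fix y assume "y \<in> ball 0 R \<inter> ball x (norm x - R)"
        then have "norm y < R" "dist x y < norm x - R" by auto
        then show False using far[of y] by linarith
      qed
      from density_0_of_disjoint_ball[OF _ this] show False using 2 x(2) by simp
    qed
  qed
qed

text \<open>
  The essential boundary lies on the sphere of radius \<open>R\<close>, which is a dilation of the unit sphere. The
  powers of \<open>R\<close> produced by the density and by the dilation combine to the one in \<open>powvol_exterior_eq\<close>.
\<close>
lemma weighted_perimeter_exterior_le:
  assumes n: "DIM('a) \<ge> 2"
    and c: "\<And>B. B \<in> sets borel \<Longrightarrow> B \<subseteq> sphere (0::'a::euclidean_space) 1 \<Longrightarrow>
       hausdorff_outer (DIM('a) - 1) B = ennreal c * powvol (p - 1) (solid_cone B)"
    and R: "0 < R"
  shows "weighted_perimeter p (- ball (0::'a) R) \<le> ennreal c * powvol (p - 1) (- ball (0::'a) R)"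
proof -
  let ?d = "DIM('a) - 1"
  have Sb: "sphere (0::'a) r \<in> sets borel" for r by (intro borel_closed) simp
  have "weighted_perimeter p (- ball (0::'a) R) \<le> (\<integral>\<^sup>+x. ennreal (R powr p) * indicator (sphere (0::'a) R) x \<partial>hausdorff_measure ?d)"
    unfolding weighted_perimeter_def using essential_boundary_exterior[of R]
    by (intro nn_integral_mono) (auto simp: indicator_def)
  also have "\<dots> = ennreal (R powr p) * hausdorff_outer ?d (sphere (0::'a) R)"
    using Sb by (subst nn_integral_cmult_indicator) (simp_all add: emeasure_hausdorff_measure)
  also have "\<dots> \<le> ennreal (R powr p) * (ennreal (R ^ ?d) * hausdorff_outer ?d (sphere (0::'a) 1))"
  proof (rule mult_left_mono)
    have "sphere (0::'a) R = (\<lambda>x. R *\<^sub>R x) ` sphere 0 1"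
    proof (intro equalityI subsetI)
      fix x :: 'a assume "x \<in> sphere 0 R"
      then show "x \<in> (\<lambda>x. R *\<^sub>R x) ` sphere 0 1" using R by (intro image_eqI[of _ _ "x /\<^sub>R R"]) auto
    qed (use R in auto)
    moreover have "R-lipschitz_on (sphere (0::'a) 1) (\<lambda>x. R *\<^sub>R x)"
      using R by (intro lipschitz_onI) (auto simp: dist_norm scaleR_diff_right[symmetric])
    ultimately show "hausdorff_outer ?d (sphere (0::'a) R) \<le> ennreal (R ^ ?d) * hausdorff_outer ?d (sphere (0::'a) 1)"
      using hausdorff_outer_lipschitz_image[of R "sphere (0::'a) 1" "\<lambda>x. R *\<^sub>R x" ?d] R by simp
  qed simp
  also have "hausdorff_outer ?d (sphere (0::'a) 1) = ennreal c * powvol (p - 1) {x::'a. 1 \<le> norm x}"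
    using c[OF Sb order_refl] solid_cone_sphere(1)[where 'a='a] by simp
  also have "ennreal (R powr p) * (ennreal (R ^ ?d) * (ennreal c * powvol (p - 1) {x::'a. 1 \<le> norm x})) =
     ennreal c * (ennreal (R powr (real DIM('a) + (p - 1))) * powvol (p - 1) {x::'a. 1 \<le> norm x})"
  proof -
    have "R powr p * R ^ ?d = R powr (real DIM('a) + (p - 1))"
      using R n by (simp add: powr_realpow[symmetric] powr_add[symmetric] of_nat_diff algebra_simps)
    then have "ennreal (R powr p) * ennreal (R ^ ?d) = ennreal (R powr (real DIM('a) + (p - 1)))"
      using R by (simp add: ennreal_mult'[symmetric])
    then show ?thesis by (metis mult.assoc mult.left_commute)
  qed
  also have "\<dots> = ennreal c * powvol (p - 1) (- ball (0::'a) R)"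
  proof -
    have "- ball (0::'a) R = {x. R \<le> norm x}" by auto
    then show ?thesis using powvol_exterior_eq[OF R, of "p - 1", where 'a='a] by simp
  qed
  finally show ?thesis .
qed


section \<open>Exteriors of balls as regions\<close>

definition inversion :: "'a::real_inner \<Rightarrow> 'a" where
  "inversion v = (1 / (v \<bullet> v)) *\<^sub>R v"

lemma inversion_inversion: "inversion (inversion v) = v"
proof (cases "v = 0")
  case False
  then show ?thesis by (simp add: inversion_def)
qed (simp add: inversion_def)

lemma inversion_scaleR: "inversion (t *\<^sub>R v) = inversion v /\<^sub>R t"
  by (cases "t = 0") (simp_all add: inversion_def field_simps)

lemma inversion_lipschitz:
  fixes v w :: "'a::real_inner"
  assumes v: "1 \<le> norm v" and w: "1 \<le> norm w"
  shows "dist (inversion v) (inversion w) \<le> dist v w"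
proof -
  define V W where "V = v \<bullet> v" and "W = w \<bullet> w"
  have VW: "1 \<le> V" "1 \<le> W" using v w by (simp_all add: V_def W_def power2_norm_eq_inner[symmetric])
  have "(inversion v - inversion w) \<bullet> (inversion v - inversion w) = (v \<bullet> v) / V\<^sup>2 + (w \<bullet> w) / W\<^sup>2 - 2 * (v \<bullet> w) / (V * W)"
    using VW by (simp add: inversion_def V_def[symmetric] W_def[symmetric]
        inner_diff_left inner_diff_right inner_commute[of w v] field_simps power2_eq_square)
  also have "\<dots> = (V + W - 2 * (v \<bullet> w)) / (V * W)"
    using VW by (simp add: V_def[symmetric] W_def[symmetric] field_simps power2_eq_square)
  also have "\<dots> = ((v - w) \<bullet> (v - w)) / (V * W)"
    by (simp add: V_def W_def inner_diff_left inner_diff_right inner_commute[of w v])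
  also have "\<dots> \<le> ((v - w) \<bullet> (v - w)) / 1"
  proof (rule divide_left_mono)
    have "1 * 1 \<le> V * W" using VW by (intro mult_mono) auto
    then show "1 \<le> V * W" by simp
  qed (use VW in auto)
  finally have "(norm (inversion v - inversion w))\<^sup>2 \<le> (norm (v - w))\<^sup>2" by (simp add: power2_norm_eq_inner)
  then show ?thesis unfolding dist_norm by (rule power2_le_imp_le) simp
qed

text \<open>
  Stereographic projection from \<open>b\<close> is inversion at \<open>b\<close> with radius \<open>sqrt 2\<close>. In this form its inverse is
  visibly Lipschitz on the hyperplane, which keeps distance at least \<open>1\<close> from \<open>b\<close>.
\<close>
lemma sphere_subset_stereographic_image:
  fixes b :: "'a::euclidean_space"
  assumes b: "norm b = 1" and R: "0 < R"
  shows "sphere 0 R \<subseteq> insert (R *\<^sub>R b) ((\<lambda>x. R *\<^sub>R (b + 2 *\<^sub>R inversion (x - b))) ` {x. x \<bullet> b = 0})"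
proof
  fix y :: 'a assume y: "y \<in> sphere 0 R"
  define u where "u = y /\<^sub>R R"
  have yu: "y = R *\<^sub>R u" and u: "norm u = 1" using y R by (simp_all add: u_def)
  show "y \<in> insert (R *\<^sub>R b) ((\<lambda>x. R *\<^sub>R (b + 2 *\<^sub>R inversion (x - b))) ` {x. x \<bullet> b = 0})"
  proof (cases "u = b")
    case False
    define x where "x = b + 2 *\<^sub>R inversion (u - b)"
    have bb: "b \<bullet> b = 1" "u \<bullet> u = 1" using b u by (simp_all add: power2_norm_eq_inner[symmetric])
    have n: "(u - b) \<bullet> (u - b) = 2 - 2 * (u \<bullet> b)"
      by (simp add: inner_diff_left inner_diff_right bb inner_commute[of b u])
    have "(u - b) \<bullet> (u - b) \<noteq> 0" using False by simp
    then have "u \<bullet> b \<noteq> 1" using n by simp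
    then have "x \<bullet> b = 0"
      unfolding x_def inversion_def n by (simp add: inner_add_left inner_diff_left bb field_simps)
    moreover have "R *\<^sub>R (b + 2 *\<^sub>R inversion (x - b)) = y"
      by (simp add: x_def inversion_scaleR inversion_inversion yu)
    ultimately show ?thesis by blast
  qed (simp add: yu)
qed

lemma region_exterior:
  assumes R: "0 < R"
  shows "region (- ball (0::'a::euclidean_space) R)"
  unfolding region_def rectifiable_hypersurface_def
proof (intro conjI)
  show "- ball (0::'a) R \<in> sets lebesgue" by (intro compl_sets_lebesgue) simp
  obtain b :: 'a where b: "b \<in> Basis" using nonempty_Basis by blast
  \<comment> \<open>The constant maps supply the pole that stereographic projection misses.\<close>
  define f where "f i = (if i = 0 then (\<lambda>x. R *\<^sub>R (b + 2 *\<^sub>R inversion (x - b))) else (\<lambda>x. R *\<^sub>R b))" for i :: nat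
  have far: "1 \<le> norm (x - b)" if "x \<bullet> b = 0" for x
  proof -
    have "(norm (x - b))\<^sup>2 = x \<bullet> x + 1"
      using that b by (simp add: power2_norm_eq_inner inner_diff_left inner_diff_right inner_commute[of b x])
    then have "1\<^sup>2 \<le> (norm (x - b))\<^sup>2" by simp
    then show ?thesis by (rule power2_le_imp_le) simp
  qed
  have lip: "(2 * R)-lipschitz_on {x. x \<bullet> b = 0} (f i)" for i
  proof (rule lipschitz_onI)
    fix x y :: 'a assume xy: "x \<in> {x. x \<bullet> b = 0}" "y \<in> {x. x \<bullet> b = 0}"
    have "dist (R *\<^sub>R (b + 2 *\<^sub>R inversion (x - b))) (R *\<^sub>R (b + 2 *\<^sub>R inversion (y - b)))
       = norm ((2 * R) *\<^sub>R (inversion (x - b) - inversion (y - b)))"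
      by (simp add: dist_norm algebra_simps)
    also have "\<dots> = 2 * R * dist (inversion (x - b)) (inversion (y - b))"
      using R by (simp add: dist_norm)
    also have "\<dots> \<le> 2 * R * dist (x - b) (y - b)"
      using xy far R by (intro mult_left_mono inversion_lipschitz) auto
    also have "dist (x - b) (y - b) = dist x y" by (simp add: dist_norm)
    finally show "dist (f i x) (f i y) \<le> 2 * R * dist x y" using R by (simp add: f_def)
  qed (use R in simp)
  have cover: "essential_boundary (- ball (0::'a) R) - (\<Union>i. f i ` {x. x \<bullet> b = 0}) = {}"
  proof -
    have "R *\<^sub>R b \<in> f 1 ` {x. x \<bullet> b = 0}" by (rule image_eqI[of _ _ 0]) (simp_all add: f_def)
    moreover have f0: "f 0 = (\<lambda>x. R *\<^sub>R (b + 2 *\<^sub>R inversion (x - b)))" by (simp add: f_def)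
    have "norm b = 1" using b by simp
    from sphere_subset_stereographic_image[OF this R]
    have "sphere 0 R \<subseteq> insert (R *\<^sub>R b) (f 0 ` {x. x \<bullet> b = 0})" unfolding f0 .
    ultimately have "sphere 0 R \<subseteq> (\<Union>i. f i ` {x. x \<bullet> b = 0})" by blast
    then show ?thesis using essential_boundary_exterior[of R, where 'a='a] by blast
  qed
  show "\<exists>b\<in>Basis. \<exists>(f :: nat \<Rightarrow> 'a \<Rightarrow> 'a) L. (\<forall>i. (L i)-lipschitz_on {x. x \<bullet> b = 0} (f i)) \<and>
      hausdorff_outer (DIM('a) - 1) (essential_boundary (- ball (0::'a) R) - (\<Union>i. f i ` {x. x \<bullet> b = 0})) = 0"
    by (rule bexI[OF _ b], intro exI[of _ f] exI[of _ "\<lambda>_. 2 * R"] conjI allI lip) (simp only: cover hausdorff_outer_empty)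
qed

section \<open>Comparison with the exterior of a ball\<close>

lemma powvol_Un:
  fixes A B :: "'a::euclidean_space set"
  assumes "A \<in> sets lebesgue" "B \<in> sets lebesgue" "A \<inter> B = {}"
  shows "powvol q (A \<union> B) = powvol q A + powvol q B"
proof -
  have "powvol q (A \<union> B) = (\<integral>\<^sup>+x. ennreal (norm x powr q) * indicator A x + ennreal (norm x powr q) * indicator B x \<partial>lebesgue)"
    unfolding powvol_lebesgue using assms(3) by (intro nn_integral_cong) (auto simp: indicator_def)
  also have "\<dots> = powvol q A + powvol q B"
    unfolding powvol_lebesgue
    by (intro nn_integral_add borel_measurable_times_ennreal measurable_norm_powr borel_measurable_indicator assms)
  finally show ?thesis .
qed

lemma norm_powr_diff_1:
  fixes x :: "'a::real_normed_vector"
  assumes "x \<noteq> 0"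
  shows "norm x powr (p - 1) = norm x powr p / norm x"
  using assms by (simp add: powr_diff)

lemma powvol_cmult:
  assumes "B \<in> sets lebesgue"
  shows "(\<integral>\<^sup>+x\<in>B. ennreal k * ennreal (norm x powr q) \<partial>lebesgue) = ennreal k * powvol q (B::'a::euclidean_space set)"
proof -
  have "(\<integral>\<^sup>+x. ennreal k * (ennreal (norm x powr q) * indicator B x) \<partial>lebesgue) = ennreal k * powvol q B"
    unfolding powvol_lebesgue
    by (intro nn_integral_cmult borel_measurable_times_ennreal measurable_norm_powr borel_measurable_indicator assms)
  then show ?thesis by (simp add: mult.assoc)
qed

lemma powvol_outer_le:
  fixes B :: "'a::euclidean_space set"
  assumes R: "0 < R" and B: "B \<in> sets lebesgue" "B \<subseteq> {x. R \<le> norm x}"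
  shows "powvol (p - 1) B \<le> ennreal (1 / R) * powvol p B"
  unfolding powvol_cmult[OF B(1), symmetric] powvol_lebesgue[of "p - 1"]
proof (intro nn_integral_mono)
  fix x :: 'a
  have "norm x powr (p - 1) \<le> 1 / R * norm x powr p" if "x \<in> B"
  proof -
    have x: "R \<le> norm x" "x \<noteq> 0" using that B(2) R by auto
    have "norm x powr p / norm x \<le> norm x powr p / R" using x R by (intro divide_left_mono) auto
    then show ?thesis using x by (simp add: norm_powr_diff_1)
  qed
  then show "ennreal (norm x powr (p - 1)) * indicator B x \<le> ennreal (1 / R) * ennreal (norm x powr p) * indicator B x"
    using R by (auto simp: indicator_def ennreal_mult'[symmetric] intro!: ennreal_leI)
qed

text \<open>
  On the ball the factor \<open>1 / r\<close> exceeds \<open>1 / R\<close>; the excess is kept as a separate integral because its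
  vanishing characterises equality.
\<close>
lemma powvol_inner_eq:
  fixes B :: "'a::euclidean_space set"
  assumes R: "0 < R" and B: "B \<in> sets lebesgue" "B \<subseteq> ball 0 R"
  shows "powvol (p - 1) B = ennreal (1 / R) * powvol p B + (\<integral>\<^sup>+x\<in>B. ennreal (norm x powr (p - 1) - 1 / R * norm x powr p) \<partial>lebesgue)"
proof -
  have le: "1 / R * norm x powr p \<le> norm x powr (p - 1)" if "x \<in> B" for x
  proof (cases "x = 0")
    case False
    have "norm x powr p / R \<le> norm x powr p / norm x" using that B(2) False R by (intro divide_left_mono) auto
    then show ?thesis using False by (simp add: norm_powr_diff_1)
  qed simp
  have "powvol (p - 1) B = (\<integral>\<^sup>+x. ennreal (1 / R) * ennreal (norm x powr p) * indicator B x +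
      ennreal (norm x powr (p - 1) - 1 / R * norm x powr p) * indicator B x \<partial>lebesgue)"
    unfolding powvol_lebesgue
  proof (intro nn_integral_cong)
    fix x :: 'a
    show "ennreal (norm x powr (p - 1)) * indicator B x = ennreal (1 / R) * ennreal (norm x powr p) * indicator B x +
      ennreal (norm x powr (p - 1) - 1 / R * norm x powr p) * indicator B x"
    proof (cases "x \<in> B")
      case True
      have "ennreal (norm x powr (p - 1)) = ennreal (1 / R * norm x powr p + (norm x powr (p - 1) - 1 / R * norm x powr p))" by simp
      also have "\<dots> = ennreal (1 / R * norm x powr p) + ennreal (norm x powr (p - 1) - 1 / R * norm x powr p)"
        using R le[OF True] by (intro ennreal_plus) auto
      also have "ennreal (1 / R * norm x powr p) = ennreal (1 / R) * ennreal (norm x powr p)"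
        using R by (intro ennreal_mult') simp
      finally show ?thesis using True by (simp only: indicator_simps mult_1_right)
    qed simp
  qed
  also have "\<dots> = (\<integral>\<^sup>+x\<in>B. ennreal (1 / R) * ennreal (norm x powr p) \<partial>lebesgue) + (\<integral>\<^sup>+x\<in>B. ennreal (norm x powr (p - 1) - 1 / R * norm x powr p) \<partial>lebesgue)"
    by (intro nn_integral_add borel_measurable_times_ennreal borel_measurable_indicator B(1) measurable_norm_powr borel_measurable_const)
       (rule measurable_completion, measurable)
  also have "(\<integral>\<^sup>+x\<in>B. ennreal (1 / R) * ennreal (norm x powr p) \<partial>lebesgue) = ennreal (1 / R) * powvol p B"
    by (rule powvol_cmult[OF B(1)])
  finally show ?thesis .
qed

text \<open>
  Replacing the part \<open>D1\<close> of \<open>E\<close> inside the ball by the missing part \<open>D2\<close> of the exterior, of the same weighted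
  volume, lowers the integral: the ratio \<open>1 / r\<close> of the two densities is greater than \<open>1 / R\<close> on \<open>D1\<close> and at
  most \<open>1 / R\<close> on \<open>D2\<close>.
\<close>
lemma bathtub_exterior:
  fixes E :: "'a::euclidean_space set"
  assumes R: "0 < R" and E: "E \<in> sets lebesgue"
    and vol: "powvol p E = powvol p (- ball (0::'a) R)" and fin: "powvol p (- ball (0::'a) R) < \<infinity>"
  shows "powvol (p - 1) (- ball (0::'a) R) \<le> powvol (p - 1) E"
    and "powvol (p - 1) E \<le> powvol (p - 1) (- ball (0::'a) R) \<Longrightarrow> negligible (sym_diff E (- ball 0 R))"
proof -
  define A where "A = - ball (0::'a) R"
  have A: "A \<in> sets lebesgue" unfolding A_def by (intro compl_sets_lebesgue) simp
  define C D1 D2 where "C = E \<inter> A" and "D1 = E - A" and "D2 = A - E"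
  have sets: "C \<in> sets lebesgue" "D1 \<in> sets lebesgue" "D2 \<in> sets lebesgue"
    using A E by (auto simp: C_def D1_def D2_def)
  have split: "powvol q E = powvol q C + powvol q D1" "powvol q A = powvol q C + powvol q D2" for q
  proof -
    have "E = C \<union> D1" "A = C \<union> D2" "C \<inter> D1 = {}" "C \<inter> D2 = {}" by (auto simp: C_def D1_def D2_def)
    then show "powvol q E = powvol q C + powvol q D1" "powvol q A = powvol q C + powvol q D2"
      using powvol_Un sets by metis+
  qed
  have finA: "powvol p A < \<infinity>" using fin by (simp add: A_def)
  have finC: "powvol p C < \<infinity>" using finA powvol_mono[of C A p] by (auto simp: C_def intro: le_less_trans)
  have D: "powvol p D1 = powvol p D2"
    using vol split[of p] finC unfolding A_def[symmetric] by (auto simp: ennreal_add_left_cancel)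
  have subA: "D2 \<subseteq> {x. R \<le> norm x}" "A \<subseteq> {x. R \<le> norm x}" "D1 \<subseteq> ball 0 R" by (auto simp: A_def D1_def D2_def)
  define G where "G = (\<integral>\<^sup>+x\<in>D1. ennreal (norm x powr (p - 1) - 1 / R * norm x powr p) \<partial>lebesgue)"
  have q2: "powvol (p - 1) D2 \<le> ennreal (1 / R) * powvol p D1"
    using powvol_outer_le[OF R sets(3) subA(1), of p] D by simp
  have q1: "powvol (p - 1) D1 = ennreal (1 / R) * powvol p D1 + G"
    unfolding G_def by (rule powvol_inner_eq[OF R sets(2) subA(3)])
  have "powvol (p - 1) D2 \<le> powvol (p - 1) D1" unfolding q1 using q2 by (rule order_trans) simp
  then show "powvol (p - 1) (- ball (0::'a) R) \<le> powvol (p - 1) E"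
    unfolding A_def[symmetric] split by (rule add_left_mono)
  assume le: "powvol (p - 1) E \<le> powvol (p - 1) (- ball (0::'a) R)"
  have finqA: "powvol (p - 1) A < \<infinity>"
  proof -
    have "powvol (p - 1) A \<le> ennreal (1 / R) * powvol p A" by (rule powvol_outer_le[OF R A subA(2)])
    also have "\<dots> < \<infinity>" using finA by (simp add: ennreal_mult_less_top)
    finally show ?thesis .
  qed
  then have finqC: "powvol (p - 1) C < \<infinity>" using powvol_mono[of C A "p - 1"] by (auto simp: C_def intro: le_less_trans)
  have l12: "powvol (p - 1) D1 \<le> powvol (p - 1) D2"
    using le finqC unfolding A_def[symmetric] split by (auto simp: ennreal_add_left_cancel_le)
  have "ennreal (1 / R) * powvol p D1 + G \<le> ennreal (1 / R) * powvol p D1 + 0"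
    using order_trans[OF l12 q2] unfolding q1 by (simp only: add_0_right)
  moreover have "ennreal (1 / R) * powvol p D1 < \<infinity>"
    using D finA split(2)[of p] by (simp add: ennreal_mult_less_top)
  ultimately have "G = 0" by (auto simp: ennreal_add_left_cancel_le)
  have n1: "negligible D1"
  proof (rule negligible_if_nn_integral_eq_0[OF sets(2)])
    show "(\<integral>\<^sup>+x\<in>D1. ennreal (norm x powr (p - 1) - 1 / R * norm x powr p) \<partial>lebesgue) = 0"
      using \<open>G = 0\<close> by (simp add: G_def)
    show "(\<lambda>x. ennreal (norm x powr (p - 1) - 1 / R * norm x powr p)) \<in> borel_measurable lebesgue"
      by (rule measurable_completion) measurable
    fix x assume x: "x \<in> D1" "x \<noteq> 0"
    have "norm x powr p / R < norm x powr p / norm x" using x subA(3) R by (intro divide_strict_left_mono) auto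
    then show "0 < ennreal (norm x powr (p - 1) - 1 / R * norm x powr p)" using x by (simp add: norm_powr_diff_1)
  qed
  then have "powvol p D1 = powvol p ({} :: 'a set)" by (intro powvol_AE_cong) auto
  then have "powvol p D2 = 0" using D by (simp add: powvol_def)
  then have "negligible D2" by (rule powvol_eq_0_imp_negligible[OF sets(3)])
  then have "negligible (D1 \<union> D2)" using n1 by (rule negligible_Un[rotated])
  moreover have "D1 \<union> D2 = sym_diff E (- ball 0 R)" by (auto simp: D1_def D2_def A_def)
  ultimately show "negligible (sym_diff E (- ball 0 R))" by simp
qed

lemma exterior_volume_unique_radius:
  assumes p: "p < - real DIM('a::euclidean_space)" and V: "0 < V"
  shows "\<exists>!R. R > 0 \<and> weighted_volume p (- ball (0::'a) R) = ennreal V"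
proof -
  define s where "s = real DIM('a) + p"
  have s: "s < 0" using p by (simp add: s_def)
  have "powvol p {x::'a. 1 \<le> norm x} \<noteq> top" using powvol_exterior_finite[OF p] by auto
  then obtain w where w: "powvol p {x::'a. 1 \<le> norm x} = ennreal w" "0 < w"
    using ennreal_pos_real[OF powvol_exterior_pos[of p, where 'a='a]] by blast
  have eq: "weighted_volume p (- ball (0::'a) R) = ennreal (R powr s * w)" if "0 < R" for R
  proof -
    have "- ball (0::'a) R = {x. R \<le> norm x}" by auto
    then show ?thesis using powvol_exterior_eq[OF that, of p, where 'a='a] w
      by (simp add: weighted_volume_eq_powvol s_def ennreal_mult')
  qed
  have iff: "weighted_volume p (- ball (0::'a) R) = ennreal V \<longleftrightarrow> R = (V / w) powr (1 / s)" if R: "0 < R" for R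
  proof -
    have "weighted_volume p (- ball (0::'a) R) = ennreal V \<longleftrightarrow> R powr s * w = V"
      using eq[OF R] w V by (simp add: ennreal_inj)
    also have "\<dots> \<longleftrightarrow> R powr s = V / w" using w by (auto simp: field_simps)
    also have "\<dots> \<longleftrightarrow> R = (V / w) powr (1 / s)"
    proof
      assume "R powr s = V / w"
      then have "(V / w) powr (1 / s) = (R powr s) powr (1 / s)" by simp
      then show "R = (V / w) powr (1 / s)" using R s by (simp add: powr_powr)
    next
      assume "R = (V / w) powr (1 / s)"
      then show "R powr s = V / w" using V w s by (simp add: powr_powr)
    qed
    finally show ?thesis .
  qed
  have "0 < (V / w) powr (1 / s)" using V w by simp
  then show ?thesis using iff by blast
qed

theorem proposition7p5:
  fixes p V :: real
  assumes "DIM('a::euclidean_space) \<ge> 2" and "p < - real DIM('a)" and "V > 0"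
  shows "(\<exists>!R. R > 0 \<and> weighted_volume p (- ball (0::'a) R) = ennreal V) \<and>
         (\<forall>R>0. weighted_volume p (- ball (0::'a) R) = ennreal V \<longrightarrow>
            isoperimetric p (- ball (0::'a) R) \<and>
            (\<forall>E::'a set. isoperimetric p E \<and> weighted_volume p E = ennreal V \<longrightarrow>
               sym_diff E (- ball 0 R) \<in> null_sets lebesgue))"
proof (intro conjI allI impI)
  show "\<exists>!R. R > 0 \<and> weighted_volume p (- ball (0::'a) R) = ennreal V"
    by (rule exterior_volume_unique_radius[OF assms(2,3)])
next
  fix R :: real assume R: "0 < R" and V: "weighted_volume p (- ball (0::'a) R) = ennreal V"
  have p: "p - 1 < - real DIM('a)" using assms(2) by simp
  obtain c where c: "0 < c" "\<And>B. B \<in> sets borel \<Longrightarrow> B \<subseteq> sphere (0::'a) 1 \<Longrightarrow>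
       hausdorff_outer (DIM('a) - 1) B = ennreal c * powvol (p - 1) (solid_cone B)"
    using sphere_measure_proportional[OF assms(1) p] by metis
  have fin: "powvol p (- ball (0::'a) R) < \<infinity>" using V by (simp add: weighted_volume_eq_powvol)
  have up: "weighted_perimeter p (- ball (0::'a) R) \<le> ennreal c * powvol (p - 1) (- ball (0::'a) R)"
    by (rule weighted_perimeter_exterior_le[OF assms(1) c(2) R])
  have low: "ennreal c * powvol (p - 1) F \<le> weighted_perimeter p F" if "region F" "weighted_volume p F = ennreal V" for F :: "'a set"
    using that by (intro weighted_perimeter_ge[OF assms(1,2) c(2)]) (auto simp: region_def)
  show "isoperimetric p (- ball (0::'a) R)"
    unfolding isoperimetric_def
  proof (intro conjI allI impI region_exterior[OF R])
    fix F :: "'a set" assume F: "region F \<and> weighted_volume p F = weighted_volume p (- ball (0::'a) R)"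
    have "powvol (p - 1) (- ball (0::'a) R) \<le> powvol (p - 1) F"
      using F fin by (intro bathtub_exterior(1)[OF R]) (auto simp: region_def weighted_volume_eq_powvol)
    then have "ennreal c * powvol (p - 1) (- ball (0::'a) R) \<le> ennreal c * powvol (p - 1) F" by (rule mult_left_mono) simp
    also have "\<dots> \<le> weighted_perimeter p F" using low[of F] F V by simp
    finally show "weighted_perimeter p (- ball (0::'a) R) \<le> weighted_perimeter p F"
      by (rule order_trans[OF up])
  qed
  fix E :: "'a set" assume E: "isoperimetric p E \<and> weighted_volume p E = ennreal V"
  have "weighted_perimeter p E \<le> weighted_perimeter p (- ball (0::'a) R)"
    using E V region_exterior[OF R, where 'a='a] unfolding isoperimetric_def by metis
  then have "ennreal c * powvol (p - 1) E \<le> ennreal c * powvol (p - 1) (- ball (0::'a) R)"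
    using up low[of E] E unfolding isoperimetric_def by (meson order_trans)
  then have "powvol (p - 1) E \<le> powvol (p - 1) (- ball (0::'a) R)"
    using c(1) by (simp add: ennreal_mult_le_mult_iff)
  moreover have "E \<in> sets lebesgue" "powvol p E = powvol p (- ball (0::'a) R)"
    using E V by (auto simp: isoperimetric_def region_def weighted_volume_eq_powvol)
  ultimately have "negligible (sym_diff E (- ball 0 R))"
    using bathtub_exterior(2)[OF R _ _ fin] by blast
  then show "sym_diff E (- ball 0 R) \<in> null_sets lebesgue" by (simp add: negligible_iff_null_sets)
qed

end
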